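(* Let $\pi$ be a quasi-index with coefficients in an abelian group $A$ on the diagrams of an oriented virtual knot $\mathcal K$. Denote $\bar A=A/\langle\sigma(\pi)\rangle$, where $\sigma(\pi)$ is the signature of $\pi$. Then the family of maps $P_D\colon\mathcal V(D)\to\bar A\oplus\mathbb Z$ given by $$P_D(v)=\Bigl(\sum_{v'\in\mathcal V(D)}\pi_D(v')\cdot(D^l_v\cdot D^r_{v'}),\ ip_D(v)\Bigr)$$ defines an oriented parity functor on the diagrams of $\mathcal K$ with coefficients in the groups $A(D)\equiv\bar A\oplus\mathbb Z$, where for a Reidemeister move $f\colon D\to D'$ the isomorphism $A(f)$ is $$A(f)(x,y)=(x+\Delta_\pi(f)\cdot y,\ y),$$ with $\Delta_\pi(f)\in A$ the increment defined in the context.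
   Context: Diagrams. A virtual knot diagram $D$ is a generic oriented closed curve in the plane whose double points are marked classical (with over/under information) or virtual. A virtual knot $\mathcal K$ is a class of diagrams modulo isotopy, classical Reidemeister moves R1, R2, R3 and detour moves (replacing a path containing only virtual crossings by another path with the same ends containing only virtual crossings). $\mathcal V(D)$ is the set of classical crossings. A move $f\colon D\to D'$ induces a partial bijection $f_*\colon\mathcal V(D)\to\mathcal V(D')$ between surviving crossings. Local picture. Draw a classical crossing $v$ with both strands directed upward: the incoming arcs are SW, SE, the outgoing ones NW, NE, and the strands run SW$\to$NE and SE$\to$NW. The oriented smoothing at $v$ splits $D$ into the left half $D^l_v$ (leaving $v$ along NW, returning along SW) and the right half $D^r_v$ (leaving along NE, returning along SE). If a triangle $\Delta$ has a corner at $v$, then $\epsilon_\Delta(v)=+1$ if $\Delta$ lies to the left or right of $v$ (between SW and NW, or between SE and NE) and $-1$ if it lies above or below $v$. Intersections. The graph with vertices $\mathcal V(D)$ and edges the arcs of $D$ between consecutive classical crossings is embedded in the closed oriented surface $AD(D)$ obtained by gluing discs to the boundary of the ribbon surface that is the (immersed) neighbourhood of $D$ (virtual crossings not being vertices). $C_1\cdot C_2$ is the intersection number of cycles in $AD(D)$, a transverse intersection counting $+1$ when (tangent of $C_1$, tangent of $C_2$) is positively oriented. The index parity is $ip_D(v)=-(D^l_v\cdot D)\in\mathbb Z$. Quasi-index. A family of maps $\pi_D\colon\mathcal V(D)\to A$ for all diagrams $D$ of $\mathcal K$ such that: (Q0) for any Reidemeister move $f\colon D\to D'$ and any crossing $v\in\mathcal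 V(D)$ which does not take part in the move, $\pi_D(v)=\pi_{D'}(f_*(v))$; (Q2) $\pi_D(v_1)=\pi_D(v_2)$ for any $v_1,v_2$ to which a decreasing R2 can be applied; (Q3) if $v_1,v_2,v_3$ take part in an R3 move $f\colon D\to D'$ with disappearing triangle $\Delta$, then there is $\lambda(f)\in A$ with $\pi_{D'}(f_*(v_i))=\pi_D(v_i)+\epsilon_\Delta(v_i)\lambda(f)$, $i=1,2,3$. Its signature is $\sigma(\pi)=-\sum_{v\in\mathcal V(D)}\pi_D(v)\cdot ip_D(v)\in A$ (independent of $D$). Increments. $\Delta_\pi(f)$ is: for an increasing R1 with new crossing $v'_0$: $-\pi_{D'}(v'_0)$ if the new loop is the left half at $v'_0$, and $0$ if the new loop is the right half; for an increasing R2 with new crossings $v'_1,v'_2$: $-\pi_{D'}(v'_1)$; for an R3 at $v_1,v_2,v_3$: $-\lambda(f)k(f)$, where $k(f)$ is the integer such that every arc of $D$ not a side of $\Delta$ has coefficient $k(f)$ in the chain $\sum_{i=1}^3\epsilon_\Delta(v_i)D^r_{v_i}$; for a decreasing move it is minus the increment of the inverse move; for isotopies and detour moves it is $0$. Parity functor. A partial isomorphism between abelian groups $A_1$, $A_2$ is an isomorphism between subgroups of $A_1$ and $A_2$. An oriented parity functor on the diagrams of $\mathcal K$ is a family of pairs $(P_D,A(D))$, with $A(D)$ an abelian group and $P_D\colon\mathcal V(D)\to A(D)$ a map, and for every isotopy or Reidemeister move $f\colon D\to D'$ a partial isomorphism $A(f)$ between $A(D)$ and $A(D')$, such that: (P0)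 $P_{D'}(f_*(v))=A(f)(P_D(v))$ for corresponding crossings $v$ and $f_*(v)$; (P1) $P_D(v)=0$ if $v$ disappears in a decreasing R1; (P2) $P_D(v_1)+P_D(v_2)=0$ if $v_1,v_2$ disappear in a decreasing R2; (P3+) $\sum_{i=1}^3\epsilon_\Delta(v_i)P_D(v_i)=0$ if $v_1,v_2,v_3$ are the crossings of an R3 with disappearing triangle $\Delta$. *)

theory Defs
  imports
    "HOL-Analysis.Analysis"
    "HOL-Algebra.FiniteProduct"
    "HOL-Algebra.Generated_Groups"
    "HOL-Algebra.Elementary_Groups"
begin

section \<open>Virtual knot diagrams\<close>

text \<open>
  The plane is the type of complex numbers. A closed curve is a map on the reals of period 1.
  A passage of the curve through a crossing is a parameter value; \<open>over\<close> is the (periodic) set of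
  the parameters at which the curve runs on the upper branch of a classical crossing. The double
  points outside \<open>crossings\<close> are the virtual crossings.
\<close>

record vdiagram =
  curve :: "real \<Rightarrow> complex"
  crossings :: "complex set"
  over :: "real set"

definition cross :: "complex \<Rightarrow> complex \<Rightarrow> real" where
  "cross z w = Im (cnj z * w)"
  \<comment> \<open>the determinant of the pair; it is positive iff the pair is a positively oriented basis\<close>

definition tangent :: "vdiagram \<Rightarrow> real \<Rightarrow> complex" where
  "tangent D t = vector_derivative (curve D) (at t)"

definition double_points :: "vdiagram \<Rightarrow> complex set" where
  "double_points D = {p. \<exists>s t. s - t \<notin> \<int> \<and> curve D s = p \<and> curve D t = p}"

definition diagram :: "vdiagram \<Rightarrow> bool" where
  "diagram D \<longleftrightarrow>
     (\<forall>t. curve D (t + 1) = curve D t) \<and>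
     curve D C1_differentiable_on UNIV \<and>
     (\<forall>t. tangent D t \<noteq> 0) \<and>
     finite (double_points D) \<and>
     (\<forall>r s t. curve D r = curve D s \<and> curve D s = curve D t \<longrightarrow>
        r - s \<in> \<int> \<or> s - t \<in> \<int> \<or> r - t \<in> \<int>) \<and>
     (\<forall>s t. curve D s = curve D t \<and> s - t \<notin> \<int> \<longrightarrow> cross (tangent D s) (tangent D t) \<noteq> 0) \<and>
     crossings D \<subseteq> double_points D \<and>
     (\<forall>t. t \<in> over D \<longrightarrow> curve D t \<in> crossings D) \<and>
     (\<forall>t. t + 1 \<in> over D \<longleftrightarrow> t \<in> over D) \<and>
     (\<forall>s t. curve D s = curve D t \<and> curve D s \<in> crossings D \<and> s - t \<notin> \<int> \<longrightarrow>
        (s \<in> over D \<longleftrightarrow> t \<notin> over D))"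


section \<open>Halves and intersection numbers\<close>

definition passages :: "vdiagram \<Rightarrow> real set" where
  "passages D = {t. 0 \<le> t \<and> t < 1 \<and> curve D t \<in> crossings D}"

text \<open>
  If both strands at \<open>v\<close> are directed upward, \<open>sw D v\<close> is the passage of the strand from SW to NE
  and \<open>se D v\<close> the passage of the strand from SE to NW: (NE, NW) is a positive basis.
\<close>

definition sw :: "vdiagram \<Rightarrow> complex \<Rightarrow> real" where
  "sw D v = (THE s. 0 \<le> s \<and> s < 1 \<and> curve D s = v \<and>
     (\<exists>t. curve D t = v \<and> cross (tangent D s) (tangent D t) > 0))"

definition se :: "vdiagram \<Rightarrow> complex \<Rightarrow> real" where
  "se D v = (THE t. 0 \<le> t \<and> t < 1 \<and> curve D t = v \<and>
     (\<exists>s. curve D s = v \<and> cross (tangent D s) (tangent D t) > 0))"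

text \<open>
  The arc between two consecutive classical crossings is denoted by its initial passage, an
  element of \<open>passages D\<close>. Hence the arc leaving a passage \<open>t\<close> is \<open>t\<close> itself, and the arc arriving
  at \<open>t\<close> is the last passage before \<open>t\<close> in the cyclic order. An integral 1-chain of the graph of
  \<open>D\<close> is the function of its coefficients on the arcs (values off \<open>passages D\<close> are irrelevant).
\<close>

type_synonym chain = "real \<Rightarrow> int"

definition arc_in :: "vdiagram \<Rightarrow> real \<Rightarrow> real" where
  "arc_in D t = (ARG_MAX (\<lambda>s. frac (s - t)) s. s \<in> passages D)"

definition arcs_between :: "real \<Rightarrow> real \<Rightarrow> chain" where
  "arcs_between s t = (\<lambda>r. if frac (r - s) < frac (t - s) then 1 else 0)"
  \<comment> \<open>the path along the orientation of the curve from the passage s to the passage t\<close>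

definition whole :: chain where
  "whole = (\<lambda>r. 1)"

definition left_half :: "vdiagram \<Rightarrow> complex \<Rightarrow> chain" where
  "left_half D v = arcs_between (se D v) (sw D v)"

definition right_half :: "vdiagram \<Rightarrow> complex \<Rightarrow> chain" where
  "right_half D v = arcs_between (sw D v) (se D v)"

text \<open>
  The intersection number of two cycles of the graph in the oriented surface \<open>AD(D)\<close>. Near a
  vertex \<open>v\<close> the surface is a disc oriented as the plane, with the four half-edges NE, NW, SW, SE
  in counterclockwise order. Push \<open>C\<^sub>1\<close> off the graph, each arc to its own left. Then \<open>C\<^sub>1\<close> is
  disjoint from \<open>C\<^sub>2\<close> away from the vertices. At \<open>v\<close>, the pushed arcs along NW and SW end in the
  left region of \<open>v\<close> (between NW and SW), the pushed arc leaving along NE lies in the upper region,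
  and the pushed arc arriving along SE lies in the lower region. Joining all of them inside the
  left region, the arc leaving along NE crosses the half-edge NW, which \<open>C\<^sub>2\<close> leaves along:
  this crossing has sign \<open>+1\<close>. The arc arriving along SE crosses the half-edge SW, along which
  \<open>C\<^sub>2\<close> arrives: this crossing has sign \<open>-1\<close>. There are no other crossings, since the boundary
  discs glued to the ribbon surface do not meet the cycles.
\<close>

definition intersection :: "vdiagram \<Rightarrow> chain \<Rightarrow> chain \<Rightarrow> int" where
  "intersection D C\<^sub>1 C\<^sub>2 =
     (\<Sum>v\<in>crossings D. C\<^sub>1 (sw D v) * C\<^sub>2 (se D v)
        - C\<^sub>1 (arc_in D (se D v)) * C\<^sub>2 (arc_in D (sw D v)))"

definition index_parity :: "vdiagram \<Rightarrow> complex \<Rightarrow> int" where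
  "index_parity D v = - intersection D (left_half D v) whole"


section \<open>Moves\<close>

definition op_diffeo :: "(complex \<Rightarrow> complex) \<Rightarrow> bool" where
  "op_diffeo h \<longleftrightarrow> bij h \<and>
     (\<exists>dh. (\<forall>z. (h has_derivative dh z) (at z) \<and> cross (dh z 1) (dh z \<i>) > 0) \<and>
        (\<forall>w. continuous_on UNIV (\<lambda>z. dh z w)))"

definition plane_isotopy :: "(real \<Rightarrow> complex \<Rightarrow> complex) \<Rightarrow> bool" where
  "plane_isotopy H \<longleftrightarrow>
     H 0 = id \<and>
     continuous_on ({0..1} \<times> UNIV) (\<lambda>(u, z). H u z) \<and>
     (\<exists>dH. (\<forall>u\<in>{0..1}. bij (H u) \<and>
               (\<forall>z. (H u has_derivative dH u z) (at z) \<and> cross (dH u z 1) (dH u z \<i>) \<noteq> 0)) \<and>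
        (\<forall>w. continuous_on ({0..1} \<times> UNIV) (\<lambda>(u, z). dH u z w)))"

definition isotopy :: "(complex \<Rightarrow> complex) \<Rightarrow> vdiagram \<Rightarrow> vdiagram \<Rightarrow> bool" where
  "isotopy h D D' \<longleftrightarrow>
     (\<exists>H. plane_isotopy H \<and> H 1 = h) \<and>
     (\<exists>\<theta> \<theta>'. (\<forall>t. (\<theta> has_real_derivative \<theta>' t) (at t) \<and> \<theta>' t > 0 \<and> \<theta> (t + 1) = \<theta> t + 1) \<and>
        (\<forall>t. curve D' (\<theta> t) = h (curve D t) \<and> (\<theta> t \<in> over D' \<longleftrightarrow> t \<in> over D))) \<and>
     crossings D' = h ` crossings D"

definition periodic_interval :: "real \<Rightarrow> real \<Rightarrow> real set" where
  "periodic_interval a b = {t. \<exists>n::int. t + of_int n \<in> {a..b}}"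

definition detour :: "vdiagram \<Rightarrow> vdiagram \<Rightarrow> bool" where
  "detour D D' \<longleftrightarrow>
     (\<exists>a b. a < b \<and> b < a + 1 \<and>
        (\<forall>t\<in>periodic_interval a b. curve D t \<notin> crossings D \<and> curve D' t \<notin> crossings D') \<and>
        (\<forall>t. t \<notin> periodic_interval a b \<longrightarrow>
           curve D' t = curve D t \<and> (t \<in> over D' \<longleftrightarrow> t \<in> over D))) \<and>
     crossings D' = crossings D"

text \<open>
  \<open>D\<close> and \<open>D'\<close> coincide outside a disc \<open>B\<close>, the image of the unit disc under \<open>\<psi>\<close> and under \<open>\<psi>'\<close>.
  The part of each of the diagrams in \<open>B\<close> consists of \<open>n\<close> strands, defined on the intervals
  \<open>{a i..b i}\<close>, which are the images under \<open>\<psi>\<close> resp. \<open>\<psi>'\<close> of the curves \<open>m i\<close> resp. \<open>m' i\<close> in the unit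
  disc, traversed in the direction of increasing (\<open>e i = 1\<close>) or decreasing (\<open>e i = -1\<close>) parameter.
  Two embeddings of the model disc are needed since the curves \<open>m i\<close> and \<open>m' i\<close> agree
  near the boundary only up to a diffeomorphism of the disc.
\<close>

definition strand :: "vdiagram \<Rightarrow> real \<Rightarrow> real \<Rightarrow> (real \<Rightarrow> complex) \<Rightarrow> bool" where
  "strand D a b m \<longleftrightarrow>
     (\<exists>\<tau> \<tau>'. \<forall>t\<in>{a..b}. (\<tau> has_real_derivative \<tau>' t) (at t within {a..b}) \<and> \<tau>' t > 0 \<and>
        curve D t = m (\<tau> t))"

definition local_change ::
  "nat \<Rightarrow> (nat \<Rightarrow> real) \<Rightarrow> (nat \<Rightarrow> real) \<Rightarrow> (nat \<Rightarrow> real) \<Rightarrow>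
   (nat \<Rightarrow> real \<Rightarrow> complex) \<Rightarrow> (nat \<Rightarrow> real \<Rightarrow> complex) \<Rightarrow>
   (complex \<Rightarrow> complex) \<Rightarrow> (complex \<Rightarrow> complex) \<Rightarrow> vdiagram \<Rightarrow> vdiagram \<Rightarrow> bool" where
  "local_change n a b e m m' \<psi> \<psi>' D D' \<longleftrightarrow>
     op_diffeo \<psi> \<and> op_diffeo \<psi>' \<and> \<psi> ` cball 0 1 = \<psi>' ` cball 0 1 \<and>
     (\<forall>i<n. a i < b i \<and> b i < a i + 1 \<and> e i \<in> {1, -1}) \<and>
     (\<forall>i<n. \<forall>j<n. i \<noteq> j \<longrightarrow>
        periodic_interval (a i) (b i) \<inter> periodic_interval (a j) (b j) = {}) \<and>
     (\<forall>i<n. strand D (a i) (b i) (\<lambda>s. \<psi> (m i (e i * s))) \<and>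
            strand D' (a i) (b i) (\<lambda>s. \<psi>' (m' i (e i * s)))) \<and>
     (\<forall>t\<in>(\<Union>i<n. periodic_interval (a i) (b i)).
        curve D t \<in> \<psi> ` cball 0 1 \<and> curve D' t \<in> \<psi> ` cball 0 1) \<and>
     (\<forall>t. t \<notin> (\<Union>i<n. periodic_interval (a i) (b i)) \<longrightarrow>
        curve D t \<notin> \<psi> ` cball 0 1 \<and> curve D' t = curve D t \<and> (t \<in> over D' \<longleftrightarrow> t \<in> over D))"

text \<open>
  Increasing R1: a vertical chord is replaced by a curl with the same end points. The only double
  point of the curl is 0 (\<open>s = -1\<close> and \<open>s = 1\<close>), and its loop is traversed counterclockwise as \<open>s\<close>
  increases. The two values of \<open>e\<close> and the two choices of the upper branch give the four types.
\<close>

definition r1_increasing :: "real \<Rightarrow> real \<Rightarrow> complex \<Rightarrow> vdiagram \<Rightarrow> vdiagram \<Rightarrow> bool" where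
  "r1_increasing a b v D D' \<longleftrightarrow>
     (\<exists>e \<psi> \<psi>'. local_change 1 (\<lambda>_. a) (\<lambda>_. b) e
           (\<lambda>_ s. Complex (1 / 2) s)
           (\<lambda>_ s. Complex ((s\<^sup>2 - 1) / 4) (s * (s\<^sup>2 - 1) / 4)) \<psi> \<psi>' D D' \<and>
        v = \<psi>' 0) \<and>
     crossings D' = insert v (crossings D)"

text \<open>
  Increasing R2: a parabola above the real axis is lowered so that it meets the axis at
  \<open>-1/2\<close> and \<open>1/2\<close>; one of the strands runs over the other one at both crossings.
\<close>

definition r2_increasing :: "complex \<Rightarrow> complex \<Rightarrow> vdiagram \<Rightarrow> vdiagram \<Rightarrow> bool" where
  "r2_increasing v\<^sub>1 v\<^sub>2 D D' \<longleftrightarrow>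
     (\<exists>a b e \<psi> \<psi>'. local_change 2 a b e
           (\<lambda>i s. if i = 0 then Complex s 0 else Complex s (s\<^sup>2 + 1 / 4))
           (\<lambda>i s. if i = 0 then Complex s 0 else Complex s (s\<^sup>2 - 1 / 4)) \<psi> \<psi>' D D' \<and>
        {v\<^sub>1, v\<^sub>2} = {\<psi>' (- 1 / 2), \<psi>' (1 / 2)} \<and>
        ((\<forall>t\<in>{a 0..b 0}. curve D' t \<in> {v\<^sub>1, v\<^sub>2} \<longrightarrow> t \<in> over D') \<or>
         (\<forall>t\<in>{a 0..b 0}. curve D' t \<in> {v\<^sub>1, v\<^sub>2} \<longrightarrow> t \<notin> over D'))) \<and>
     crossings D' = crossings D \<union> {v\<^sub>1, v\<^sub>2}"

text \<open>
  R3: the sides of the disappearing triangle lie on three lines at distance \<open>1/4\<close> from 0, obtained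
  from each other by rotations of order 3, and every line is moved to its mirror image in 0. The
  line \<open>i\<close> meets the line \<open>i + 1\<close> (mod 3) at the point \<open>cis (2 * pi / 3) ^ i * Complex (sqrt 3 / 4) (- 1 / 4)\<close>
  before the move, and at the opposite point after it. The function \<open>ht\<close> orders the strands by
  height. The crossing \<open>v i\<close> of \<open>D\<close> corresponds to the crossing \<open>v' i\<close> of \<open>D'\<close>.
\<close>

definition r3 ::
  "(nat \<Rightarrow> real) \<Rightarrow> (nat \<Rightarrow> real) \<Rightarrow> (nat \<Rightarrow> complex) \<Rightarrow> (nat \<Rightarrow> complex) \<Rightarrow>
   vdiagram \<Rightarrow> vdiagram \<Rightarrow> bool" where
  "r3 a b v v' D D' \<longleftrightarrow>
     (\<exists>e \<psi> \<psi>'. local_change 3 a b e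
           (\<lambda>i s. cis (2 * pi / 3) ^ i * Complex s (- 1 / 4))
           (\<lambda>i s. cis (2 * pi / 3) ^ i * Complex s (1 / 4)) \<psi> \<psi>' D D' \<and>
        (\<forall>i<3. v i = \<psi> (cis (2 * pi / 3) ^ i * Complex (sqrt 3 / 4) (- 1 / 4)) \<and>
               v' i = \<psi>' (- (cis (2 * pi / 3) ^ i * Complex (sqrt 3 / 4) (- 1 / 4))))) \<and>
     (\<exists>ht::nat \<Rightarrow> nat. inj_on ht {..<3} \<and>
        (\<forall>i<3. \<forall>j<3. i \<noteq> j \<longrightarrow>
           (\<forall>s\<in>{a i..b i}. \<forall>t\<in>{a j..b j}.
              (curve D s = curve D t \<longrightarrow> (s \<in> over D \<longleftrightarrow> ht j < ht i)) \<and>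
              (curve D' s = curve D' t \<longrightarrow> (s \<in> over D' \<longleftrightarrow> ht j < ht i))))) \<and>
     v ` {..<3} \<subseteq> crossings D \<and> v' ` {..<3} \<subseteq> crossings D' \<and>
     crossings D' - v' ` {..<3} = crossings D - v ` {..<3}"

text \<open>
  A move is recorded together with the data on which its correspondence of crossings, its increment
  and its triangle depend: the intervals of the moving strands and the crossings taking part in it.
\<close>

datatype vmove =
    Isotopy "complex \<Rightarrow> complex"
  | Detour
  | R1_inc real real complex
  | R1_dec real real complex
  | R2_inc complex complex
  | R2_dec complex complex
  | R3 "nat \<Rightarrow> real" "nat \<Rightarrow> real" "nat \<Rightarrow> complex" "nat \<Rightarrow> complex"

definition is_move :: "vdiagram \<Rightarrow> vmove \<Rightarrow> vdiagram \<Rightarrow> bool" where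
  "is_move D f D' \<longleftrightarrow> diagram D \<and> diagram D' \<and>
     (case f of
        Isotopy h \<Rightarrow> isotopy h D D'
      | Detour \<Rightarrow> detour D D'
      | R1_inc a b v \<Rightarrow> r1_increasing a b v D D'
      | R1_dec a b v \<Rightarrow> r1_increasing a b v D' D
      | R2_inc v\<^sub>1 v\<^sub>2 \<Rightarrow> r2_increasing v\<^sub>1 v\<^sub>2 D D'
      | R2_dec v\<^sub>1 v\<^sub>2 \<Rightarrow> r2_increasing v\<^sub>1 v\<^sub>2 D' D
      | R3 a b v v' \<Rightarrow> r3 a b v v' D D')"

text \<open>The crossings of the source diagram which take part in a move.\<close>

fun participants :: "vmove \<Rightarrow> complex set" where
  "participants (R1_dec a b v) = {v}"
| "participants (R2_dec v\<^sub>1 v\<^sub>2) = {v\<^sub>1, v\<^sub>2}"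
| "participants (R3 a b v v') = v ` {..<3}"
| "participants _ = {}"

text \<open>The partial bijection \<open>f\<^sub>*\<close> between the crossings of the source and of the target.\<close>

fun corr :: "vdiagram \<Rightarrow> vmove \<Rightarrow> (complex \<rightharpoonup> complex)" where
  "corr D (Isotopy h) = (Some \<circ> h) |` crossings D"
| "corr D (R3 a b v v') =
     (\<lambda>p. if p \<in> v ` {..<3} then Some (v' (the_inv_into {..<3} v p))
          else (Some |` crossings D) p)"
| "corr D f = Some |` (crossings D - participants f)"

definition virtual_knots :: "vdiagram set set" where
  "virtual_knots =
     {D. diagram D} //
     {(D, D'). diagram D \<and> diagram D' \<and> equivclp (\<lambda>E E'. \<exists>f. is_move E f E') D D'}"

text \<open>
  The sides of the triangle of an R3 move: the arcs which run from one crossing to another one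
  inside one of the three moving strands.
\<close>

definition sides :: "vdiagram \<Rightarrow> (nat \<Rightarrow> real) \<Rightarrow> (nat \<Rightarrow> real) \<Rightarrow> real set" where
  "sides D a b = {frac s | s. \<exists>i<3. \<exists>t. a i \<le> s \<and> s < t \<and> t \<le> b i \<and>
     curve D s \<in> crossings D \<and> curve D t \<in> crossings D}"

text \<open>
  \<open>\<epsilon>\<^sub>\<Delta>(v)\<close> for a triangle with set of sides \<open>S\<close> and a corner at \<open>v\<close>. The sides at \<open>v\<close> are SW and NW
  or SE and NE if the triangle lies to the left or to the right of \<open>v\<close>.
\<close>

definition corner_sign :: "vdiagram \<Rightarrow> real set \<Rightarrow> complex \<Rightarrow> int" where
  "corner_sign D S v =
     (if arc_in D (sw D v) \<in> S \<and> se D v \<in> S \<or> arc_in D (se D v) \<in> S \<and> sw D v \<in> S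
      then 1 else - 1)"


section \<open>Quasi-indices\<close>

definition quasi_index ::
  "('a, 'b) monoid_scheme \<Rightarrow> vdiagram set \<Rightarrow> (vdiagram \<Rightarrow> complex \<Rightarrow> 'a) \<Rightarrow> bool" where
  "quasi_index A K \<pi> \<longleftrightarrow>
     (\<forall>D\<in>K. \<forall>v\<in>crossings D. \<pi> D v \<in> carrier A) \<and>
     (\<forall>D\<in>K. \<forall>f D' v w. is_move D f D' \<and> v \<notin> participants f \<and> corr D f v = Some w \<longrightarrow>
        \<pi> D v = \<pi> D' w) \<and>
     (\<forall>D\<in>K. \<forall>v\<^sub>1 v\<^sub>2 D'. is_move D (R2_dec v\<^sub>1 v\<^sub>2) D' \<longrightarrow> \<pi> D v\<^sub>1 = \<pi> D v\<^sub>2) \<and>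
     (\<forall>D\<in>K. \<forall>a b v v' D'. is_move D (R3 a b v v') D' \<longrightarrow>
        (\<exists>l\<in>carrier A. \<forall>i<3. \<pi> D' (v' i) =
           \<pi> D (v i) \<otimes>\<^bsub>A\<^esub> l [^]\<^bsub>A\<^esub> corner_sign D (sides D a b) (v i)))"

definition signature ::
  "('a, 'b) monoid_scheme \<Rightarrow> (vdiagram \<Rightarrow> complex \<Rightarrow> 'a) \<Rightarrow> vdiagram \<Rightarrow> 'a" where
  "signature A \<pi> D = inv\<^bsub>A\<^esub> (\<Otimes>\<^bsub>A\<^esub>v\<in>crossings D. \<pi> D v [^]\<^bsub>A\<^esub> index_parity D v)"

definition r3_lambda ::
  "('a, 'b) monoid_scheme \<Rightarrow> (vdiagram \<Rightarrow> complex \<Rightarrow> 'a) \<Rightarrow> vdiagram \<Rightarrow> vdiagram \<Rightarrow>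
   (nat \<Rightarrow> real) \<Rightarrow> (nat \<Rightarrow> real) \<Rightarrow> (nat \<Rightarrow> complex) \<Rightarrow> (nat \<Rightarrow> complex) \<Rightarrow> 'a" where
  "r3_lambda A \<pi> D D' a b v v' =
     (THE l. l \<in> carrier A \<and> (\<forall>i<3. \<pi> D' (v' i) =
        \<pi> D (v i) \<otimes>\<^bsub>A\<^esub> l [^]\<^bsub>A\<^esub> corner_sign D (sides D a b) (v i)))"

definition r3_coefficient ::
  "vdiagram \<Rightarrow> (nat \<Rightarrow> real) \<Rightarrow> (nat \<Rightarrow> real) \<Rightarrow> (nat \<Rightarrow> complex) \<Rightarrow> int" where
  "r3_coefficient D a b v =
     (THE k. \<forall>t\<in>passages D - sides D a b.
        (\<Sum>i<3. corner_sign D (sides D a b) (v i) * right_half D (v i) t) = k)"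

definition loop_is_left_half :: "vdiagram \<Rightarrow> real \<Rightarrow> real \<Rightarrow> complex \<Rightarrow> bool" where
  "loop_is_left_half D a b v \<longleftrightarrow>
     (\<exists>s t. a \<le> s \<and> s < t \<and> t \<le> b \<and> curve D s = v \<and> curve D t = v \<and> frac s = se D v)"

fun increment ::
  "('a, 'b) monoid_scheme \<Rightarrow> (vdiagram \<Rightarrow> complex \<Rightarrow> 'a) \<Rightarrow> vdiagram \<Rightarrow> vmove \<Rightarrow> vdiagram \<Rightarrow> 'a"
where
  "increment A \<pi> D (Isotopy h) D' = \<one>\<^bsub>A\<^esub>"
| "increment A \<pi> D Detour D' = \<one>\<^bsub>A\<^esub>"
| "increment A \<pi> D (R1_inc a b v) D' =
     (if loop_is_left_half D' a b v then inv\<^bsub>A\<^esub> (\<pi> D' v) else \<one>\<^bsub>A\<^esub>)"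
| "increment A \<pi> D (R1_dec a b v) D' =
     inv\<^bsub>A\<^esub> (if loop_is_left_half D a b v then inv\<^bsub>A\<^esub> (\<pi> D v) else \<one>\<^bsub>A\<^esub>)"
| "increment A \<pi> D (R2_inc v\<^sub>1 v\<^sub>2) D' = inv\<^bsub>A\<^esub> (\<pi> D' v\<^sub>1)"
| "increment A \<pi> D (R2_dec v\<^sub>1 v\<^sub>2) D' = inv\<^bsub>A\<^esub> (inv\<^bsub>A\<^esub> (\<pi> D v\<^sub>1))"
| "increment A \<pi> D (R3 a b v v') D' =
     inv\<^bsub>A\<^esub> (r3_lambda A \<pi> D D' a b v v' [^]\<^bsub>A\<^esub> r3_coefficient D a b v)"


section \<open>Oriented parity functors\<close>

text \<open>A partial isomorphism is a partial map whose domain and range are the two subgroups.\<close>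

definition partial_iso ::
  "('g, 'c) monoid_scheme \<Rightarrow> ('h, 'd) monoid_scheme \<Rightarrow> ('g \<rightharpoonup> 'h) \<Rightarrow> bool" where
  "partial_iso G H \<phi> \<longleftrightarrow> subgroup (dom \<phi>) G \<and> subgroup (ran \<phi>) H \<and>
     (\<lambda>x. the (\<phi> x)) \<in> iso (G\<lparr>carrier := dom \<phi>\<rparr>) (H\<lparr>carrier := ran \<phi>\<rparr>)"

definition oriented_parity_functor ::
  "vdiagram set \<Rightarrow> (vdiagram \<Rightarrow> ('g, 'c) monoid_scheme) \<Rightarrow> (vdiagram \<Rightarrow> complex \<Rightarrow> 'g) \<Rightarrow>
   (vdiagram \<Rightarrow> vmove \<Rightarrow> vdiagram \<Rightarrow> ('g \<rightharpoonup> 'g)) \<Rightarrow> bool" where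
  "oriented_parity_functor K G P \<Phi> \<longleftrightarrow>
     (\<forall>D\<in>K. comm_group (G D) \<and> (\<forall>v\<in>crossings D. P D v \<in> carrier (G D))) \<and>
     (\<forall>D\<in>K. \<forall>f D'. is_move D f D' \<longrightarrow>
        partial_iso (G D) (G D') (\<Phi> D f D') \<and>
        (\<forall>v w. corr D f v = Some w \<longrightarrow> \<Phi> D f D' (P D v) = Some (P D' w))) \<and>
     (\<forall>D\<in>K. \<forall>a b v D'. is_move D (R1_dec a b v) D' \<longrightarrow> P D v = \<one>\<^bsub>G D\<^esub>) \<and>
     (\<forall>D\<in>K. \<forall>v\<^sub>1 v\<^sub>2 D'. is_move D (R2_dec v\<^sub>1 v\<^sub>2) D' \<longrightarrow>
        P D v\<^sub>1 \<otimes>\<^bsub>G D\<^esub> P D v\<^sub>2 = \<one>\<^bsub>G D\<^esub>) \<and>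
     (\<forall>D\<in>K. \<forall>a b v v' D'. is_move D (R3 a b v v') D' \<longrightarrow>
        (\<Otimes>\<^bsub>G D\<^esub>i\<in>{..<3}. P D (v i) [^]\<^bsub>G D\<^esub> corner_sign D (sides D a b) (v i)) = \<one>\<^bsub>G D\<^esub>)"

end

theory Submission
  imports Defs
begin

text \<open>
  Write \<open>L_v\<close>, \<open>R_v\<close> for the two halves at a crossing \<open>v\<close> and \<open>D\<close> for the whole cycle. Everything in the
  statement is a sum of intersection numbers \<open>L_v \<cdot> R_w\<close> weighted by the quasi-index, and everything about
  a Reidemeister move follows from one relation between its crossings. If \<open>w_i\<close> are the crossings at the
  corners of the face which a move creates or collapses (a loop, a bigon or a triangle), then for suitable
  integers \<open>c_i\<close> and \<open>k\<close> the cycle \<open>\<Sum> c_i R\<^bsub>w_i\<^esub> - k D\<close> is supported on the sides of that face.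
  Hence it is a multiple of the boundary of a disc and its intersection with every cycle is 0. Since the
  intersection form is antisymmetric, \<open>L_v + R_v = D\<close> and \<open>D \<cdot> R_v = - ip(v)\<close>, the relation says
  (\<open>relation_consequences\<close>)

     \<^item> \<open>\<Sum> c_i (L_u \<cdot> R\<^bsub>w_i\<^esub>) = - k ip(u)\<close>,

     \<^item> \<open>\<Sum> c_i (L\<^bsub>w_i\<^esub> \<cdot> R_u) = (k - \<Sum> c_i) ip(u)\<close>,

     \<^item> \<open>\<Sum> c_i ip(w_i) = 0\<close>.

  Here \<open>c_i = 1\<close> for the first two moves, and \<open>c_i\<close> is the sign of the corner for the third move. For the
  loop \<open>k\<close> is 1 or 0, according as the loop is the left or the right half, for the bigon \<open>k = 1\<close>, and for the
  triangle \<open>k\<close> is the coefficient \<open>k(f)\<close> (\<open>kink_relation\<close>, \<open>bigon_relation\<close>, \<open>triangle_relation\<close>).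

  Weight the second formula with the quasi-index: the combination \<open>\<Sum> c_i P(w_i)\<close> is a multiple of the
  signature in its first component, and by the third formula it is 0 in its second component. This
  is (P1), (P2) and (P3+) modulo the signature (\<open>relation_parity\<close>). A move changes the weighted sums only through
  the \<open>w_i\<close>: either they are new, with a weight \<open>\<lambda>\<close> common to all of them by (Q2), or their weights change by
  \<open>c_i \<lambda>\<close> by (Q3). By the first formula the parity of a surviving crossing \<open>u\<close> changes by \<open>- k \<lambda> ip(u)\<close>, where
  \<open>- k \<lambda>\<close> is the increment, and by the third formula the signature does not change at all (\<open>move_shift\<close>,
  \<open>signature_invariant\<close>). This is (P0), and it makes the quotient by the signature of a single diagram
  legitimate for the whole knot.

  It remains to see that a move does not change \<open>L_u \<cdot> R_w\<close> and \<open>ip(u)\<close> for surviving crossings. An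
  intersection number is a sum over the crossings, and the terms outside the disc of the move are
  literally the same. Inside the disc, the sum of the terms is a function of the coefficients with which
  the two cycles enter and leave the disc along its strands (\<open>vertex_term_kink\<close>, \<open>vertex_terms_bigon\<close>,
  \<open>vertex_terms_triangle_reverse\<close>), and those depend only on the cyclic order of the strands, not on what
  happens in the disc (\<open>arcs_between_exit\<close>, \<open>enters_entry\<close>).

  The geometric content is therefore small. From the explicit models of the moves one has to read
  off in which order the strands meet their crossings and which strand is the one from SW to NE
  (\<open>r1_increasing_kink\<close>, \<open>r2_increasing_bigon\<close>, \<open>r3_triangle_move\<close>). For the third move both sides are
  instances of the same picture, rotated by half a turn, with all strands reversed.
\<close>


section \<open>The cyclic order of parameters\<close>

text \<open>
  The path from \<open>s\<close> to \<open>t\<close> contains the arc leaving \<open>r\<close> iff \<open>r\<close> lies in the half-open cyclic interval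
  \<open>[s, t)\<close>; this is \<open>arcs_between s t r\<close>. It contains the arc arriving at \<open>r\<close> iff \<open>r\<close> lies in \<open>(s, t]\<close>. The latter
  condition does not refer to the other passages, so that it can be compared between diagrams.
\<close>

definition enters :: "real \<Rightarrow> real \<Rightarrow> real \<Rightarrow> int" where
  "enters s t r = (if 0 < frac (r - s) \<and> frac (r - s) \<le> frac (t - s) then 1 else 0)"

lemma frac_cong: "x - y \<in> \<int> \<Longrightarrow> frac x = frac (y::real)"
  by (metis Ints_0 add.commute diff_add_cancel frac_add_int_right)

lemma ex_representative: "\<exists>r'. r' - r \<in> \<int> \<and> b \<le> r' \<and> r' < b + (1::real)"
proof (intro exI conjI)
  have "b + frac (r - b) - r = of_int (- \<lfloor>r - b\<rfloor>)" by (simp add: frac_def)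
  then show "b + frac (r - b) - r \<in> \<int>" by (metis Ints_of_int)
qed (use frac_lt_1 in auto)

lemma arcs_between_cong:
  assumes "s - s' \<in> \<int>" "t - t' \<in> \<int>" "r - r' \<in> \<int>"
  shows "arcs_between s t r = arcs_between s' t' r'" "enters s t r = enters s' t' r'"
proof -
  have "(r - s) - (r' - s') = (r - r') - (s - s')" "(t - s) - (t' - s') = (t - t') - (s - s')" by auto
  then have "(r - s) - (r' - s') \<in> \<int>" "(t - s) - (t' - s') \<in> \<int>"
    using assms Ints_diff by metis+
  then show "arcs_between s t r = arcs_between s' t' r'" "enters s t r = enters s' t' r'"
    by (simp_all add: arcs_between_def enters_def frac_cong[of "r - s"] frac_cong[of "t - s"])
qed

lemma frac_diff_period:
  assumes "b \<le> s" "s < b + 1" "b \<le> r" "r < b + (1::real)"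
  shows "frac (r - s) = (if s \<le> r then r - s else r - s + 1)"
  using assms by (subst frac_unique_iff) auto

text \<open>
  The computational form of both indicators: after moving the three parameters into one period,
  cyclic intervals become inequalities. All the facts about cyclic order below reduce to this.
\<close>

lemma arcs_between_period:
  assumes "b \<le> s" "s < b + 1" "b \<le> t" "t < b + 1" "b \<le> r" "r < b + 1"
  shows "arcs_between s t r = of_bool (if s \<le> t then s \<le> r \<and> r < t else s \<le> r \<or> r < t)"
    and "enters s t r = of_bool (if s \<le> t then s < r \<and> r \<le> t else s < r \<or> r \<le> t)"
  using assms by (auto simp: arcs_between_def enters_def frac_diff_period[of b s])

lemma congruent_in_period:
  assumes "x - y \<in> \<int>" "b \<le> x" "x < b + 1" "b \<le> y" "y < b + (1::real)"
  shows "x = y"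
proof -
  obtain n where "x - y = of_int n" using assms(1) by (auto elim: Ints_cases)
  then have "of_int n < (1::real)" "of_int n > (-1::real)" using assms by auto
  then have "n = 0" by linarith
  then show ?thesis using \<open>x - y = of_int n\<close> by simp
qed

lemma Ints_diff_trans: "x - y \<in> \<int> \<Longrightarrow> y - z \<in> \<int> \<Longrightarrow> x - z \<in> (\<int>::real set)"
  using Ints_add[of "x - y" "y - z"] by simp

lemma Ints_diff_sym: "x - y \<in> \<int> \<Longrightarrow> y - x \<in> (\<int>::real set)"
  using Ints_minus[of "x - y"] by simp

lemma arcs_between_complement:
  assumes "s - t \<notin> \<int>"
  shows "arcs_between s t r + arcs_between t s r = 1" "enters s t r + enters t s r = 1"
proof -
  obtain t' r' where *: "t' - t \<in> \<int>" "s \<le> t'" "t' < s + 1" "r' - r \<in> \<int>" "s \<le> r'" "r' < s + 1"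
    using ex_representative by metis
  have "t' \<noteq> s" using * assms Ints_diff_sym by blast
  then have "arcs_between s t' r' + arcs_between t' s r' = 1" "enters s t' r' + enters t' s r' = 1"
    using * by (auto simp: arcs_between_period[of s])
  then show "arcs_between s t r + arcs_between t s r = 1" "enters s t r + enters t s r = 1"
    using * arcs_between_cong[of s s t' t r' r] arcs_between_cong[of t' t s s r' r] by auto
qed

text \<open>
  Three distinct points of a circle are in one of two cyclic orders. The symmetry allows one to move
  each of the three arguments as if it were the last one.
\<close>

lemma arcs_between_rotate:
  assumes "s - t \<notin> \<int>" "t - r \<notin> \<int>" "r - s \<notin> \<int>"
  shows "arcs_between s t r = arcs_between r s t"
proof -
  obtain t' r' where *: "t' - t \<in> \<int>" "s \<le> t'" "t' < s + 1" "r' - r \<in> \<int>" "s \<le> r'" "r' < s + 1"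
    using ex_representative by metis
  have "t' \<noteq> s" "r' \<noteq> s" using * assms Ints_diff_sym by blast+
  moreover have "t' \<noteq> r'" using * assms(2) Ints_diff_trans Ints_diff_sym by blast
  ultimately have "arcs_between s t' r' = arcs_between r' s t'"
    using * by (auto simp: arcs_between_period[of s])
  then show ?thesis
    using * arcs_between_cong[of s s t' t r' r] arcs_between_cong[of r' r s s t' t] by auto
qed

lemma enters_eq_arcs_between:
  assumes "r - s \<notin> \<int>" "r - t \<notin> \<int>"
  shows "enters s t r = arcs_between s t r"
proof -
  obtain t' r' where *: "t' - t \<in> \<int>" "s \<le> t'" "t' < s + 1" "r' - r \<in> \<int>" "s \<le> r'" "r' < s + 1"
    using ex_representative by metis
  have "r' \<noteq> s" using * assms Ints_diff_sym by blast
  moreover have "t' \<noteq> r'" using * assms(2) Ints_diff_trans Ints_diff_sym by blast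
  ultimately have "enters s t' r' = arcs_between s t' r'"
    using * by (auto simp: arcs_between_period[of s])
  then show ?thesis
    using * arcs_between_cong[of s s t' t r' r] by auto
qed

lemma arcs_between_endpoints:
  assumes "s - t \<notin> \<int>"
  shows "arcs_between s t s = 1" "arcs_between s t t = 0" "enters s t s = 0" "enters s t t = 1"
proof -
  have "t - s \<notin> \<int>" using assms Ints_diff_sym by blast
  then have "frac (t - s) > 0" by (simp add: frac_gt_0_iff)
  then show "arcs_between s t s = 1" "arcs_between s t t = 0" "enters s t s = 0" "enters s t t = 1"
    by (auto simp: arcs_between_def enters_def)
qed

text \<open>
  No end of the path lies strictly between \<open>x\<close> and \<open>y\<close>. For neighbouring passages this identifies the arc
  leaving \<open>x\<close> with the arc arriving at \<open>y\<close>.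
\<close>

lemma arcs_between_eq_enters:
  assumes "x < y" "y \<le> x + 1" "s - t \<notin> \<int>"
    and s: "\<And>z. x < z \<Longrightarrow> z < y \<Longrightarrow> z - s \<notin> \<int>"
    and t: "\<And>z. x < z \<Longrightarrow> z < y \<Longrightarrow> z - t \<notin> \<int>"
  shows "arcs_between s t x = enters s t y"
proof -
  obtain t' x' where *: "t' - t \<in> \<int>" "s \<le> t'" "t' < s + 1" "x' - x \<in> \<int>" "s \<le> x'" "x' < s + 1"
    using ex_representative by metis
  define y' where "y' = y + (x' - x)"
  have y': "y' - y \<in> \<int>" "x' < y'" using * assms(1) by (auto simp: y'_def)
  have "t' \<noteq> s" using * assms Ints_diff_sym by blast
  have ys: "y' \<le> s + 1"
  proof (rule ccontr)
    assume "\<not> ?thesis"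
    then have "x < s + 1 - (x' - x)" "s + 1 - (x' - x) < y" using * by (auto simp: y'_def)
    then have "s + 1 - (x' - x) - s \<notin> \<int>" by (rule s)
    moreover have "s + 1 - (x' - x) - s = 1 - (x' - x)" by simp
    ultimately show False using * by (metis Ints_1 Ints_diff)
  qed
  have tx: "\<not> (x' < t' \<and> t' < y')"
  proof
    assume "x' < t' \<and> t' < y'"
    then have "x < t' - (x' - x)" "t' - (x' - x) < y" by (auto simp: y'_def)
    then have "t' - (x' - x) - t \<notin> \<int>" by (rule t)
    moreover have "t' - (x' - x) - t = (t' - t) - (x' - x)" by simp
    ultimately show False using * by (metis Ints_diff)
  qed
  have "arcs_between s t' x' = enters s t' y'"
  proof (cases "y' = s + 1")
    case True
    have "enters s t' y' = enters s t' s" using True by (intro arcs_between_cong) auto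
    then show ?thesis using * tx True by (auto simp: arcs_between_period[of s])
  next
    case False
    then show ?thesis using * tx ys y' by (auto simp: arcs_between_period[of s])
  qed
  then show ?thesis
    using * y' arcs_between_cong[of s s t' t x' x] arcs_between_cong[of s s t' t y' y] by auto
qed

lemma arcs_between_move:
  assumes "x \<le> y"
    and s: "\<And>z. x \<le> z \<Longrightarrow> z \<le> y \<Longrightarrow> z - s \<notin> \<int>"
    and t: "\<And>z. x \<le> z \<Longrightarrow> z \<le> y \<Longrightarrow> z - t \<notin> \<int>"
  shows "arcs_between s t x = arcs_between s t y"
proof -
  obtain t' x' where *: "t' - t \<in> \<int>" "s \<le> t'" "t' < s + 1" "x' - x \<in> \<int>" "s \<le> x'" "x' < s + 1"
    using ex_representative by metis
  define y' where "y' = y + (x' - x)"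
  have y': "y' - y \<in> \<int>" "x' \<le> y'" using * assms(1) by (auto simp: y'_def)
  have ys: "y' < s + 1"
  proof (rule ccontr)
    assume "\<not> ?thesis"
    then have "x \<le> s + 1 - (x' - x)" "s + 1 - (x' - x) \<le> y" using * by (auto simp: y'_def)
    then have "s + 1 - (x' - x) - s \<notin> \<int>" by (rule s)
    moreover have "s + 1 - (x' - x) - s = 1 - (x' - x)" by simp
    ultimately show False using * by (metis Ints_1 Ints_diff)
  qed
  have tx: "\<not> (x' \<le> t' \<and> t' \<le> y')"
  proof
    assume "x' \<le> t' \<and> t' \<le> y'"
    then have "x \<le> t' - (x' - x)" "t' - (x' - x) \<le> y" by (auto simp: y'_def)
    then have "t' - (x' - x) - t \<notin> \<int>" by (rule t)
    moreover have "t' - (x' - x) - t = (t' - t) - (x' - x)" by simp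
    ultimately show False using * by (metis Ints_diff)
  qed
  have "arcs_between s t' x' = arcs_between s t' y'"
    using * tx ys y' by (auto simp: arcs_between_period[of s])
  then show ?thesis
    using * y' arcs_between_cong[of s s t' t x' x] arcs_between_cong[of s s t' t y' y] by auto
qed

text \<open>
  A path which starts inside a short interval does not come into the interval from outside, and it
  leaves the interval at its end; the next lemma is the dual statement for the end of a path.
\<close>

lemma arcs_between_initial:
  assumes "x \<le> s" "s \<le> y" "y < x + 1"
    and t: "\<And>z. x \<le> z \<Longrightarrow> z \<le> y \<Longrightarrow> z - t \<notin> \<int>"
  shows "enters s t x = 0" "arcs_between s t y = 1"
proof -
  obtain t' where *: "t' - t \<in> \<int>" "x \<le> t'" "t' < x + 1"
    using ex_representative by metis
  have "\<not> t' \<le> y" using t * by auto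
  then have "enters s t' x = 0" "arcs_between s t' y = 1"
    using * assms(1-3) by (auto simp: arcs_between_period[of x])
  then show "enters s t x = 0" "arcs_between s t y = 1"
    using * arcs_between_cong[of s s t' t x x] arcs_between_cong[of s s t' t y y] by auto
qed

lemma arcs_between_final:
  assumes "x \<le> t" "t \<le> y" "y < x + 1"
    and s: "\<And>z. x \<le> z \<Longrightarrow> z \<le> y \<Longrightarrow> z - s \<notin> \<int>"
  shows "enters s t x = 1" "arcs_between s t y = 0"
proof -
  have "s - t \<notin> \<int>" using s[of t] assms Ints_diff_sym by blast
  then show "enters s t x = 1" "arcs_between s t y = 0"
    using arcs_between_complement[of s t x] arcs_between_complement[of s t y]
      arcs_between_initial[of x t y s, OF assms] by auto
qed

text \<open>
  Three consecutive paths close up to a loop that runs once or twice around the circle, depending on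
  the cyclic order of the three points. This is where the coefficient \<open>k(f)\<close> of a third move comes from.
\<close>

lemma arcs_between_cycle:
  assumes "x - y \<notin> \<int>" "y - z \<notin> \<int>" "z - x \<notin> \<int>"
  shows "\<exists>k. \<forall>t. arcs_between x y t + arcs_between y z t + arcs_between z x t = k"
proof -
  obtain y' z' where *: "y' - y \<in> \<int>" "x \<le> y'" "y' < x + 1" "z' - z \<in> \<int>" "x \<le> z'" "z' < x + 1"
    using ex_representative by metis
  have "y' \<noteq> x" "z' \<noteq> x" using * assms Ints_diff_sym by blast+
  moreover have "y' \<noteq> z'" using * assms(2) Ints_diff_trans Ints_diff_sym by blast
  ultimately have k: "arcs_between x y' t + arcs_between y' z' t + arcs_between z' x t
      = (if y' < z' then 1 else 2)" if "x \<le> t" "t < x + 1" for t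
    using * that by (auto simp: arcs_between_period[of x])
  have "arcs_between x y t + arcs_between y z t + arcs_between z x t = (if y' < z' then 1 else 2)" for t
  proof -
    obtain t' where t: "t' - t \<in> \<int>" "x \<le> t'" "t' < x + 1" using ex_representative by metis
    show ?thesis using k[OF t(2,3)] t * arcs_between_cong[of x x y' y t' t]
      arcs_between_cong[of y' y z' z t' t] arcs_between_cong[of z' z x x t' t] by auto
  qed
  then show ?thesis by blast
qed

lemma arcs_between_equivariant:
  assumes "strict_mono \<theta>" "\<And>t. \<theta> (t + 1) = \<theta> t + (1::real)"
  shows "arcs_between (\<theta> s) (\<theta> t) (\<theta> r) = arcs_between s t r"
    and "enters (\<theta> s) (\<theta> t) (\<theta> r) = enters s t r"
proof -
  have n: "\<theta> (t + of_nat n) = \<theta> t + of_nat n" for t n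
    by (induction n) (use assms(2) in \<open>simp_all flip: add.assoc add: add.commute[of 1]\<close>)
  have z: "\<theta> x - \<theta> y \<in> \<int>" if "x - y \<in> \<int>" for x y
  proof -
    obtain k where "x - y = of_int k" using \<open>x - y \<in> \<int>\<close> by (rule Ints_cases)
    then have k: "x = y + of_int k" by simp
    show ?thesis
    proof (cases "k \<ge> 0")
      case True
      then have "x = y + of_nat (nat k)" using k by simp
      then show ?thesis using n[of y "nat k"] by simp
    next
      case False
      then have "y = x + of_nat (nat (-k))" using k by simp
      then show ?thesis using n[of x "nat (-k)"] by simp
    qed
  qed
  obtain t' r' where *: "t' - t \<in> \<int>" "s \<le> t'" "t' < s + 1" "r' - r \<in> \<int>" "s \<le> r'" "r' < s + 1"
    using ex_representative by metis
  have "\<theta> s \<le> \<theta> t'" "\<theta> t' < \<theta> s + 1" "\<theta> s \<le> \<theta> r'" "\<theta> r' < \<theta> s + 1"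
    using * assms strict_mono_less_eq strict_mono_less by metis+
  then have "arcs_between (\<theta> s) (\<theta> t') (\<theta> r') = arcs_between s t' r'"
      "enters (\<theta> s) (\<theta> t') (\<theta> r') = enters s t' r'"
    using * assms(1) by (auto simp: arcs_between_period[of s] arcs_between_period[of "\<theta> s"]
        strict_mono_less_eq strict_mono_less)
  then show "arcs_between (\<theta> s) (\<theta> t) (\<theta> r) = arcs_between s t r"
     "enters (\<theta> s) (\<theta> t) (\<theta> r) = enters s t r"
    using * arcs_between_cong[of s s t' t r' r] z
      arcs_between_cong[of "\<theta> s" "\<theta> s" "\<theta> t'" "\<theta> t" "\<theta> r'" "\<theta> r"] by auto
qed


section \<open>Passages of a diagram\<close>

lemma curve_cong:
  assumes "diagram D" "s - t \<in> \<int>"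
  shows "curve D s = curve D t"
proof -
  have n: "curve D (t + of_nat n) = curve D t" for t n
  proof (induction n)
    case (Suc n)
    have "t + of_nat (Suc n) = (t + of_nat n) + 1" by simp
    then show ?case using Suc assms(1) unfolding diagram_def by metis
  qed simp
  obtain k where "s - t = of_int k" using assms(2) by (rule Ints_cases)
  then have k: "s = t + of_int k" by simp
  show ?thesis
  proof (cases "k \<ge> 0")
    case True
    then have "s = t + of_nat (nat k)" using k by simp
    then show ?thesis using n[of t "nat k"] by simp
  next
    case False
    then have "t = s + of_nat (nat (-k))" using k by simp
    then show ?thesis using n[of s "nat (-k)"] by simp
  qed
qed

lemma has_tangent: "diagram D \<Longrightarrow> (curve D has_vector_derivative tangent D t) (at t)"
  by (auto simp: diagram_def tangent_def C1_differentiable_on_eq vector_derivative_works)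

lemma tangent_cong:
  assumes "diagram D" "s - t \<in> \<int>"
  shows "tangent D s = tangent D t"
proof -
  have "curve D = (\<lambda>x. curve D (x + (s - t)))"
    using curve_cong[OF assms(1)] assms(2) by (metis add_diff_cancel_left')
  moreover have "((\<lambda>x. curve D (x + (s - t))) has_vector_derivative tangent D s) (at t)"
  proof -
    have "((\<lambda>x. x + (s - t)) has_vector_derivative 1) (at t)"
      by (auto intro!: derivative_eq_intros)
    then show ?thesis
      using vector_diff_chain_at[of "\<lambda>x. x + (s - t)" 1 t "curve D" "tangent D s"] has_tangent[OF assms(1), of s]
      by (simp add: o_def)
  qed
  ultimately have "(curve D has_vector_derivative tangent D s) (at t)" by simp
  then show ?thesis
    using has_tangent[OF assms(1), of t] by (rule vector_derivative_unique_at)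
qed

lemma cross_swap: "cross z w = - cross w z"
  by (simp add: cross_def)

lemma cross_self: "cross z z = 0"
  by (simp add: cross_def)

lemma two_passages:
  assumes "diagram D" "curve D s = curve D t" "s - t \<notin> \<int>" "curve D r = curve D t"
  shows "r - s \<in> \<int> \<or> r - t \<in> \<int>"
  using assms unfolding diagram_def by metis

text \<open>
  At a double point the positive pair of tangents determines which passage is which, because there are
  only two passages modulo 1 and the cross product is antisymmetric. So \<open>sw\<close> and \<open>se\<close> can be read off any two
  passages in any period.
\<close>

lemma sw_se_eqI:
  assumes D: "diagram D" and s: "curve D s = v" and t: "curve D t = v"
    and pos: "cross (tangent D s) (tangent D t) > 0"
  shows "sw D v = frac s" "se D v = frac t"
proof -
  have st: "s - t \<notin> \<int>" using pos tangent_cong[OF D, of s t] by (auto simp: cross_self)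
  have cases: "r - s \<in> \<int> \<or> r - t \<in> \<int>" if "curve D r = v" for r
    using two_passages[OF D _ st] s t that by simp
  \<comment> \<open>the reversed pair is negative, and a passage paired with itself gives 0\<close>
  have neg: "\<not> cross (tangent D t) (tangent D s) > 0" using pos cross_swap[of "tangent D t"] by simp
  have fr: "x - frac x \<in> \<int>" "frac x - x \<in> \<int>" for x :: real by (simp_all add: frac_def)
  have eq: "x = frac y" if "0 \<le> x" "x < 1" "x - y \<in> \<int>" for x y :: real
    using that by (metis Ints_diff_sym Ints_diff_trans congruent_in_period[of x "frac y" 0] fr frac_ge_0 frac_lt_1 add_0)
  show "sw D v = frac s" unfolding sw_def
  proof (rule the_equality)
    show "0 \<le> frac s \<and> frac s < 1 \<and> curve D (frac s) = v \<and>
      (\<exists>t. curve D t = v \<and> 0 < cross (tangent D (frac s)) (tangent D t))"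
      using s t pos curve_cong[OF D fr(2), of s] tangent_cong[OF D fr(2), of s] by (auto simp: frac_lt_1)
  next
    fix x assume x: "0 \<le> x \<and> x < 1 \<and> curve D x = v \<and> (\<exists>t. curve D t = v \<and> 0 < cross (tangent D x) (tangent D t))"
    then obtain y where y: "curve D y = v" "0 < cross (tangent D x) (tangent D y)" by blast
    have "\<not> x - t \<in> \<int>"
      using y cases[of y] tangent_cong[OF D] neg by (metis cross_self less_irrefl)
    then have "x - s \<in> \<int>" using cases x by blast
    then show "x = frac s" using eq x by blast
  qed
  show "se D v = frac t" unfolding se_def
  proof (rule the_equality)
    show "0 \<le> frac t \<and> frac t < 1 \<and> curve D (frac t) = v \<and>
      (\<exists>s. curve D s = v \<and> 0 < cross (tangent D s) (tangent D (frac t)))"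
      using s t pos curve_cong[OF D fr(2), of t] tangent_cong[OF D fr(2), of t] by (auto simp: frac_lt_1)
  next
    fix x assume x: "0 \<le> x \<and> x < 1 \<and> curve D x = v \<and> (\<exists>s. curve D s = v \<and> 0 < cross (tangent D s) (tangent D x))"
    then obtain y where y: "curve D y = v" "0 < cross (tangent D y) (tangent D x)" by blast
    have "\<not> x - s \<in> \<int>"
      using y cases[of y] tangent_cong[OF D] neg by (metis cross_self less_irrefl)
    then have "x - t \<in> \<int>" using cases x by blast
    then show "x = frac t" using eq x by blast
  qed
qed

lemma sw_se:
  assumes D: "diagram D" and v: "v \<in> crossings D"
  shows "curve D (sw D v) = v" "curve D (se D v) = v"
    "0 \<le> sw D v" "sw D v < 1" "0 \<le> se D v" "se D v < 1"
    "sw D v - se D v \<notin> \<int>" "cross (tangent D (sw D v)) (tangent D (se D v)) > 0"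
proof -
  obtain s t where st: "s - t \<notin> \<int>" "curve D s = v" "curve D t = v"
    using D v unfolding diagram_def double_points_def by blast
  then have "cross (tangent D s) (tangent D t) \<noteq> 0" using D unfolding diagram_def by metis
  then have "\<exists>s t. curve D s = v \<and> curve D t = v \<and> cross (tangent D s) (tangent D t) > 0"
  proof (cases "cross (tangent D s) (tangent D t) > 0")
    case False
    then have "cross (tangent D t) (tangent D s) > 0"
      using cross_swap[of "tangent D s" "tangent D t"] \<open>cross (tangent D s) (tangent D t) \<noteq> 0\<close> by simp
    then show ?thesis using st by blast
  qed (use st in blast)
  then obtain s t where st: "curve D s = v" "curve D t = v" "cross (tangent D s) (tangent D t) > 0"
    by blast
  have fr: "frac x - x \<in> \<int>" for x :: real by (simp add: frac_def)
  note eq = sw_se_eqI[OF D st]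
  show "curve D (sw D v) = v" "curve D (se D v) = v"
    "0 \<le> sw D v" "sw D v < 1" "0 \<le> se D v" "se D v < 1"
    using curve_cong[OF D fr] st eq by (auto simp: frac_lt_1)
  show *: "cross (tangent D (sw D v)) (tangent D (se D v)) > 0"
    using tangent_cong[OF D fr] st eq by auto
  show "sw D v - se D v \<notin> \<int>" using * tangent_cong[OF D] by (auto simp: cross_self)
qed

lemma crossing_passage_cases:
  assumes "diagram D" "v \<in> crossings D" "curve D t = v"
  shows "frac t = sw D v \<or> frac t = se D v"
proof -
  have "t - sw D v \<in> \<int> \<or> t - se D v \<in> \<int>"
    using two_passages[OF assms(1), of "sw D v" "se D v" t] sw_se[OF assms(1,2)] assms(3) by metis
  then show ?thesis using sw_se[OF assms(1,2)] by (metis frac_unique_iff)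
qed

lemma finite_crossings: "diagram D \<Longrightarrow> finite (crossings D)"
  by (auto simp: diagram_def intro: finite_subset)

lemma frac_passage:
  assumes "diagram D" "curve D t \<in> crossings D"
  shows "frac t \<in> passages D"
proof -
  have "frac t - t \<in> \<int>" by (simp add: frac_def)
  then show ?thesis using assms(2) curve_cong[OF assms(1)] by (auto simp: passages_def frac_lt_1)
qed

lemma passage_frac: "t \<in> passages D \<Longrightarrow> frac t = t"
  by (simp add: passages_def frac_eq)

lemma sw_se_passages:
  assumes "diagram D" "v \<in> crossings D"
  shows "sw D v \<in> passages D" "se D v \<in> passages D"
  using sw_se[OF assms] assms(2) by (auto simp: passages_def)

lemma passages_eq:
  assumes "diagram D"
  shows "passages D = sw D ` crossings D \<union> se D ` crossings D"
proof
  show "passages D \<subseteq> sw D ` crossings D \<union> se D ` crossings D"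
  proof
    fix t assume t: "t \<in> passages D"
    then have "curve D t \<in> crossings D" by (simp add: passages_def)
    then show "t \<in> sw D ` crossings D \<union> se D ` crossings D"
      using crossing_passage_cases[OF assms _ refl, of t] passage_frac[OF t] by force
  qed
  show "sw D ` crossings D \<union> se D ` crossings D \<subseteq> passages D"
    using sw_se_passages[OF assms] by blast
qed

lemma finite_passages: "diagram D \<Longrightarrow> finite (passages D)"
  by (simp add: passages_eq finite_crossings)

lemma passages_incongruent:
  assumes "s \<in> passages D" "t \<in> passages D" "s \<noteq> t"
  shows "s - t \<notin> \<int>"
  using assms congruent_in_period[of s t 0] by (auto simp: passages_def)

lemma sw_se_distinct:
  assumes "diagram D" "u \<in> crossings D" "v \<in> crossings D"
  shows "sw D u = sw D v \<longleftrightarrow> u = v" "se D u = se D v \<longleftrightarrow> u = v" "sw D u \<noteq> se D v" "se D v \<noteq> sw D u"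
proof -
  show "sw D u = sw D v \<longleftrightarrow> u = v" "se D u = se D v \<longleftrightarrow> u = v"
    using sw_se(1,2)[OF assms(1,2)] sw_se(1,2)[OF assms(1,3)] by metis+
  show "sw D u \<noteq> se D v"
  proof
    assume *: "sw D u = se D v"
    then have "u = v" using sw_se(1,2)[OF assms(1,2)] sw_se(1,2)[OF assms(1,3)] by metis
    then show False using sw_se(7)[OF assms(1,3)] * by simp
  qed
  then show "se D v \<noteq> sw D u" by simp
qed

text \<open>
  Every passage is the \<open>sw\<close> or the \<open>se\<close> of exactly one crossing.
\<close>

lemma sum_passages:
  assumes "diagram D"
  shows "(\<Sum>t\<in>passages D. f t) = (\<Sum>v\<in>crossings D. f (sw D v) + f (se D v))"
proof -
  have "inj_on (sw D) (crossings D)" "inj_on (se D) (crossings D)"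
    "sw D ` crossings D \<inter> se D ` crossings D = {}"
    using sw_se_distinct[OF assms] by (auto simp: inj_on_def)
  then show ?thesis
    by (simp add: passages_eq[OF assms] finite_crossings[OF assms] sum.union_disjoint sum.reindex sum.distrib)
qed


section \<open>Neighbouring passages\<close>

text \<open>
  The two passages are given by real representatives in the right order, which need not lie in \<open>{0..<1}\<close>.
  This makes the pairs on a strand of a move directly usable.
\<close>

definition consecutive :: "vdiagram \<Rightarrow> real \<Rightarrow> real \<Rightarrow> bool" where
  "consecutive D x y \<longleftrightarrow> x < y \<and> y \<le> x + 1 \<and> curve D x \<in> crossings D \<and> curve D y \<in> crossings D \<and>
     (\<forall>z. x < z \<and> z < y \<longrightarrow> curve D z \<notin> crossings D)"

lemma arc_in_maximal:
  assumes "diagram D" "t \<in> passages D"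
  shows "arc_in D t \<in> passages D" "s \<in> passages D \<Longrightarrow> frac (s - t) \<le> frac (arc_in D t - t)"
proof -
  let ?f = "\<lambda>s. frac (s - t)"
  have fin: "finite (?f ` passages D)" "?f ` passages D \<noteq> {}"
    using assms finite_passages by auto
  then obtain m where "m \<in> passages D" "?f m = Max (?f ` passages D)"
    using Max_in by (metis (no_types, lifting) imageE)
  then have "is_arg_max ?f (\<lambda>s. s \<in> passages D) m"
    using fin Max_ge by (auto simp: is_arg_max_def not_less)
  then have "is_arg_max ?f (\<lambda>s. s \<in> passages D) (arc_in D t)"
    unfolding arc_in_def arg_max_def by (rule someI)
  then show "arc_in D t \<in> passages D" "s \<in> passages D \<Longrightarrow> frac (s - t) \<le> frac (arc_in D t - t)"
    by (auto simp: is_arg_max_def not_less)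
qed

text \<open>
  Turns the maximality which defines \<open>arc_in\<close> into absence of passages in between: the representative of
  \<open>arc_in D t\<close> in the period before \<open>t\<close> has no passage between itself and \<open>t\<close>.
\<close>

lemma ex_consecutive:
  assumes D: "diagram D" and t: "t \<in> passages D"
  shows "\<exists>x. consecutive D x t \<and> frac x = arc_in D t"
proof (intro exI conjI)
  let ?x = "t - 1 + frac (arc_in D t - t)"
  have m: "arc_in D t \<in> passages D" using arc_in_maximal[OF assms] by simp
  have "?x - arc_in D t = - 1 + of_int (- \<lfloor>arc_in D t - t\<rfloor>)" by (simp add: frac_def)
  then have x: "?x - arc_in D t \<in> \<int>" by (metis Ints_1 Ints_add Ints_minus Ints_of_int)
  then have c: "curve D ?x = curve D (arc_in D t)" by (rule curve_cong[OF D])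
  show "frac ?x = arc_in D t"
    using frac_cong[OF x] passage_frac[OF m] by simp
  show "consecutive D ?x t" unfolding consecutive_def
  proof (intro conjI allI impI)
    show "?x < t" "t \<le> ?x + 1" using frac_lt_1[of "arc_in D t - t"] by (auto simp: algebra_simps)
    show "curve D ?x \<in> crossings D" "curve D t \<in> crossings D"
      using c m t by (auto simp: passages_def)
  next
    fix z assume z: "?x < z \<and> z < t"
    have "frac z - t - (z - t + 1) = of_int (- \<lfloor>z\<rfloor> - 1)" by (simp add: frac_def)
    then have "frac z - t - (z - t + 1) \<in> \<int>" by (metis Ints_of_int)
    moreover have "0 \<le> z - t + 1" using z frac_ge_0[of "arc_in D t - t"] by linarith
    ultimately have fz: "frac (frac z - t) = z - t + 1"
      using z by (simp add: frac_unique_iff)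
    show "curve D z \<notin> crossings D"
    proof
      assume "curve D z \<in> crossings D"
      then have "frac (frac z - t) \<le> frac (arc_in D t - t)"
        by (intro arc_in_maximal[OF assms] frac_passage[OF D])
      then show False using z fz by simp
    qed
  qed
qed

lemma consecutive_unique:
  assumes "diagram D" "consecutive D x y" "consecutive D x' y'"
  shows "frac x = frac x' \<longleftrightarrow> frac y = frac y'"
proof -
  note c = assms(2,3)[unfolded consecutive_def]
  have shift: "curve D (z + of_int k) = curve D z" for z k by (rule curve_cong[OF assms(1)]) simp
  show ?thesis
  proof
    assume "frac x = frac x'"
    then obtain k where k: "x = x' + of_int k" by (rule frac_eqE)
    have "\<not> y < y' + of_int k"
    proof
      assume "y < y' + of_int k"
      then have "x' < y - of_int k" "y - of_int k < y'" using c k by auto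
      then show False using c shift[of "y - of_int k" k] by auto
    qed
    moreover have "\<not> y' + of_int k < y"
    proof
      assume "y' + of_int k < y"
      then have "x < y' + of_int k" using c k by auto
      then show False using c shift[of y' k] \<open>y' + of_int k < y\<close> by auto
    qed
    ultimately have "y = y' + of_int k" by simp
    then show "frac y = frac y'" by (simp add: frac_add_of_int_right)
  next
    assume "frac y = frac y'"
    then obtain k where k: "y = y' + of_int k" by (rule frac_eqE)
    have "\<not> x < x' + of_int k"
    proof
      assume "x < x' + of_int k"
      moreover have "x' + of_int k < y" using c k by auto
      ultimately show False using c shift[of x' k] by auto
    qed
    moreover have "\<not> x' + of_int k < x"
    proof
      assume "x' + of_int k < x"
      then have "x' < x - of_int k" "x - of_int k < y'" using c k by auto
      then show False using c shift[of "x - of_int k" k] by auto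
    qed
    ultimately have "x = x' + of_int k" by simp
    then show "frac x = frac x'" by (simp add: frac_add_of_int_right)
  qed
qed

lemma arc_in_consecutive:
  assumes "diagram D" "consecutive D x y"
  shows "arc_in D (frac y) = frac x"
proof -
  have "frac y \<in> passages D" using assms frac_passage by (auto simp: consecutive_def)
  then obtain z where "consecutive D z (frac y)" "frac z = arc_in D (frac y)"
    using ex_consecutive[OF assms(1)] by blast
  then show ?thesis using consecutive_unique[OF assms(1), of z "frac y" x y] assms(2) by (simp add: frac_frac)
qed

lemma arc_in_inj:
  assumes "diagram D" "s \<in> passages D" "t \<in> passages D"
  shows "arc_in D s = arc_in D t \<longleftrightarrow> s = t"
proof -
  obtain x y where "consecutive D x s" "frac x = arc_in D s" "consecutive D y t" "frac y = arc_in D t"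
    using ex_consecutive[OF assms(1)] assms(2,3) by blast
  then show ?thesis
    using consecutive_unique[OF assms(1), of x s y t] passage_frac assms(2,3) by simp
qed

text \<open>
  Every arc leaves one passage and arrives at one passage, so \<open>arc_in\<close> permutes the passages.
\<close>

lemma sum_arc_in:
  assumes "diagram D"
  shows "(\<Sum>t\<in>passages D. f (arc_in D t)) = (\<Sum>t\<in>passages D. f t)"
proof (rule sum.reindex_bij_betw)
  have "inj_on (arc_in D) (passages D)" "arc_in D ` passages D \<subseteq> passages D"
    using arc_in_inj[OF assms] arc_in_maximal(1)[OF assms] by (auto simp: inj_on_def)
  then show "bij_betw (arc_in D) (passages D) (passages D)"
    using finite_passages[OF assms] by (simp add: bij_betw_def endo_inj_surj)
qed

lemma arcs_between_arc_in:
  assumes D: "diagram D" and "s \<in> passages D" "t \<in> passages D" "s \<noteq> t" "r \<in> passages D"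
  shows "arcs_between s t (arc_in D r) = enters s t r"
proof -
  obtain x where x: "consecutive D x r" "frac x = arc_in D r"
    using ex_consecutive[OF D assms(5)] by blast
  have no: "z - p \<notin> \<int>" if "x < z" "z < r" "p \<in> passages D" for z p
    using x(1) that curve_cong[OF D, of z p] by (auto simp: consecutive_def passages_def)
  have "arcs_between s t (arc_in D r) = arcs_between s t x"
    using x(2) by (intro arcs_between_cong) (auto simp flip: x(2) simp: frac_def)
  also have "\<dots> = enters s t r"
    using x(1) no assms passages_incongruent by (intro arcs_between_eq_enters) (auto simp: consecutive_def)
  finally show ?thesis .
qed


section \<open>Cycles and the intersection form\<close>

definition cycle :: "vdiagram \<Rightarrow> chain \<Rightarrow> bool" where
  "cycle D C \<longleftrightarrow> (\<forall>v\<in>crossings D.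
     C (sw D v) + C (se D v) = C (arc_in D (sw D v)) + C (arc_in D (se D v)))"

text \<open>
  The boundary of a path from \<open>s\<close> to \<open>t\<close> vanishes as soon as \<open>s\<close> and \<open>t\<close> are the two passages of one crossing.
\<close>

lemma cycle_arcs_between:
  assumes "diagram D" "u \<in> crossings D" "{s, t} = {sw D u, se D u}"
  shows "cycle D (arcs_between s t)"
  unfolding cycle_def
proof
  fix v assume v: "v \<in> crossings D"
  note p = sw_se_passages[OF assms(1,2)] sw_se_passages[OF assms(1) v]
  have st: "s \<in> passages D" "t \<in> passages D" "s \<noteq> t"
    using p assms(3) sw_se_distinct(3)[OF assms(1,2,2)] by (auto simp: doubleton_eq_iff)
  note [simp] = arcs_between_arc_in[OF assms(1) st]
  have eq: "enters s t r = arcs_between s t r" if "r \<in> passages D" "r \<noteq> s" "r \<noteq> t" for r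
    using that st passages_incongruent by (intro enters_eq_arcs_between) auto
  have ends: "arcs_between s t s = 1" "arcs_between s t t = 0" "enters s t s = 0" "enters s t t = 1"
    using arcs_between_endpoints[OF passages_incongruent[OF st]] by auto
  show "arcs_between s t (sw D v) + arcs_between s t (se D v) =
      arcs_between s t (arc_in D (sw D v)) + arcs_between s t (arc_in D (se D v))"
  proof (cases "v = u")
    case True
    then show ?thesis using assms(3) p ends by (auto simp: doubleton_eq_iff)
  next
    case False
    then have "sw D v \<notin> {s, t}" "se D v \<notin> {s, t}"
      using sw_se_distinct[OF assms(1) v assms(2)] sw_se_distinct[OF assms(1,2) v] unfolding assms(3) by auto
    then show ?thesis using eq p by auto
  qed
qed

lemma cycle_left_half: "diagram D \<Longrightarrow> v \<in> crossings D \<Longrightarrow> cycle D (left_half D v)"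
  and cycle_right_half: "diagram D \<Longrightarrow> v \<in> crossings D \<Longrightarrow> cycle D (right_half D v)"
  by (auto simp: left_half_def right_half_def intro: cycle_arcs_between)

lemma cycle_whole: "cycle D whole"
  by (simp add: cycle_def whole_def)

lemma cycle_add: "cycle D C \<Longrightarrow> cycle D C' \<Longrightarrow> cycle D (\<lambda>t. C t + C' t)"
  unfolding cycle_def by (auto simp: algebra_simps)

lemma cycle_scale: "cycle D C \<Longrightarrow> cycle D (\<lambda>t. c * C t)"
  by (simp add: cycle_def flip: distrib_left)

lemma left_half_complement:
  assumes "diagram D" "v \<in> crossings D"
  shows "left_half D v = (\<lambda>t. whole t + (- 1) * right_half D v t)"
  using arcs_between_complement(1)[OF sw_se(7)[OF assms]]
  by (auto simp: left_half_def right_half_def whole_def fun_eq_iff algebra_simps)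

lemma intersection_add_left:
  "intersection D (\<lambda>t. C t + C' t) E = intersection D C E + intersection D C' E"
  by (simp add: intersection_def algebra_simps sum.distrib sum_subtractf)

lemma intersection_scale_left:
  "intersection D (\<lambda>t. c * C t) E = c * intersection D C E"
  by (simp add: intersection_def sum_distrib_left right_diff_distrib mult.assoc)

text \<open>
  For cycles \<open>C\<close> and \<open>E\<close> with outgoing values \<open>C(sw)\<close>, \<open>C(se)\<close> and incoming values at a vertex, multiply the two
  conservation laws \<open>C(sw) + C(se) = C(in sw) + C(in se)\<close> and the one for \<open>E\<close>. The mixed products are exactly the
  terms of \<open>C \<cdot> E + E \<cdot> C\<close>, and what remains are the products \<open>C E\<close> of equal arguments, summed once over all
  outgoing and once over all incoming arcs. These two sums agree because \<open>arc_in\<close> is a permutation.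
\<close>

lemma intersection_antisym:
  assumes "diagram D" "cycle D C" "cycle D E"
  shows "intersection D C E = - intersection D E C"
proof -
  let ?a = "arc_in D"
  have "intersection D C E + intersection D E C = (\<Sum>v\<in>crossings D.
      (C (?a (sw D v)) * E (?a (sw D v)) + C (?a (se D v)) * E (?a (se D v)))
      - (C (sw D v) * E (sw D v) + C (se D v) * E (se D v)))"
    unfolding intersection_def sum.distrib[symmetric]
  proof (rule sum.cong[OF refl])
    fix v assume v: "v \<in> crossings D"
    have c: "C (?a (sw D v)) = C (sw D v) + C (se D v) - C (?a (se D v))"
      using assms(2) v by (auto simp: cycle_def)
    have e: "E (?a (sw D v)) = E (sw D v) + E (se D v) - E (?a (se D v))"
      using assms(3) v by (auto simp: cycle_def)
    show "C (sw D v) * E (se D v) - C (?a (se D v)) * E (?a (sw D v)) +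
         (E (sw D v) * C (se D v) - E (?a (se D v)) * C (?a (sw D v))) =
         C (?a (sw D v)) * E (?a (sw D v)) + C (?a (se D v)) * E (?a (se D v)) -
         (C (sw D v) * E (sw D v) + C (se D v) * E (se D v))"
      unfolding c e by (simp add: algebra_simps)
  qed
  also have "\<dots> = (\<Sum>t\<in>passages D. C (?a t) * E (?a t)) - (\<Sum>t\<in>passages D. C t * E t)"
    by (simp add: sum_passages[OF assms(1)] sum_subtractf)
  also have "\<dots> = 0" using sum_arc_in[OF assms(1), of "\<lambda>t. C t * E t"] by simp
  finally show ?thesis by simp
qed

lemma intersection_whole_whole: "intersection D whole whole = 0"
  by (simp add: intersection_def whole_def)

text \<open>
  The whole cycle is the sum of the two halves and does not meet itself, so its intersection with the
  right half is the one of the left half with it.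
\<close>

lemma intersection_whole_right_half:
  assumes "diagram D" "v \<in> crossings D"
  shows "intersection D whole (right_half D v) = - index_parity D v"
proof -
  have "intersection D whole (right_half D v) = - intersection D (right_half D v) whole"
    using assms by (intro intersection_antisym cycle_whole cycle_right_half)
  moreover have "index_parity D v = intersection D (right_half D v) whole"
    unfolding index_parity_def left_half_complement[OF assms]
    by (simp only: intersection_add_left intersection_scale_left intersection_whole_whole)
  ultimately show ?thesis by simp
qed


section \<open>Cycles supported on the sides of a face\<close>

definition vertex_term :: "vdiagram \<Rightarrow> complex \<Rightarrow> chain \<Rightarrow> chain \<Rightarrow> int" where
  "vertex_term D v C E = C (sw D v) * E (se D v) - C (arc_in D (se D v)) * E (arc_in D (sw D v))"

lemma intersection_vertex_terms: "intersection D C E = (\<Sum>v\<in>crossings D. vertex_term D v C E)"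
  by (simp add: intersection_def vertex_term_def)

definition supported_on :: "vdiagram \<Rightarrow> real set \<Rightarrow> chain \<Rightarrow> bool" where
  "supported_on D S C \<longleftrightarrow> (\<forall>t\<in>passages D - S. C t = 0)"

text \<open>
  A cycle which lives on arcs joining crossings of \<open>N\<close> contributes only at \<open>N\<close>: no other crossing
  is an end of such an arc.
\<close>

lemma intersection_supported:
  assumes D: "diagram D" and N: "N \<subseteq> crossings D" and C: "supported_on D S C"
    and S: "\<And>s. s \<in> S \<Longrightarrow> \<exists>x y. s = frac x \<and> consecutive D x y \<and> curve D x \<in> N \<and> curve D y \<in> N"
  shows "intersection D C E = (\<Sum>v\<in>N. vertex_term D v C E)"
proof -
  have vanish: "C t = 0" "C (arc_in D t) = 0" if t: "t \<in> passages D" "curve D t \<notin> N" for t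
  proof -
    have "t \<notin> S"
    proof
      assume "t \<in> S"
      then obtain x where "t = frac x" "curve D x \<in> N" using S by blast
      then show False using t curve_cong[OF D, of "frac x" x] by (simp add: frac_def)
    qed
    then show "C t = 0" using C t by (simp add: supported_on_def)
    have "arc_in D t \<notin> S"
    proof
      assume "arc_in D t \<in> S"
      then obtain x y where xy: "arc_in D t = frac x" "consecutive D x y" "curve D y \<in> N" using S by blast
      then have "frac y \<in> passages D" by (intro frac_passage[OF D]) (auto simp: consecutive_def)
      then have "t = frac y" using xy arc_in_consecutive[OF D xy(2)] arc_in_inj[OF D t(1)] by metis
      then show False using t xy(3) curve_cong[OF D, of "frac y" y] by (simp add: frac_def)
    qed
    then show "C (arc_in D t) = 0"
      using C arc_in_maximal(1)[OF D t(1)] by (simp add: supported_on_def)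
  qed
  have "vertex_term D v C E = 0" if "v \<in> crossings D - N" for v
    using that vanish sw_se_passages[OF D] sw_se(1,2)[OF D] by (simp add: vertex_term_def)
  then show ?thesis unfolding intersection_vertex_terms
    using N by (intro sum.mono_neutral_right finite_crossings[OF D]) auto
qed

definition kink :: "vdiagram \<Rightarrow> complex \<Rightarrow> real \<Rightarrow> real \<Rightarrow> bool" where
  "kink D v x y \<longleftrightarrow> consecutive D x y \<and> curve D x = v \<and> curve D y = v \<and> x - y \<notin> \<int>"

lemma kink_passages:
  assumes "diagram D" "kink D v x y"
  shows "v \<in> crossings D" "arc_in D (frac y) = frac x"
    "sw D v = frac x \<and> se D v = frac y \<or> sw D v = frac y \<and> se D v = frac x"
proof -
  show v: "v \<in> crossings D" using assms(2) by (auto simp: kink_def consecutive_def)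
  show "arc_in D (frac y) = frac x"
    using assms by (auto simp: kink_def intro: arc_in_consecutive)
  have "frac x \<noteq> frac y" using assms(2) by (auto simp: kink_def elim!: frac_eqE)
  then show "sw D v = frac x \<and> se D v = frac y \<or> sw D v = frac y \<and> se D v = frac x"
    using crossing_passage_cases[OF assms(1) v, of x] crossing_passage_cases[OF assms(1) v, of y] assms(2)
    by (auto simp: kink_def)
qed

text \<open>
  Conservation at \<open>v\<close> forces the values before and after the kink to agree. The vertex term is
  then the difference of two equal products: with the loop on the right or on the left it is
  \<open>Z Y' - Z X'\<close> or \<open>Y Z' - X Z'\<close>, with \<open>X = Y\<close> outside and \<open>Z\<close> on the loop.
\<close>

lemma vertex_term_kink:
  assumes "diagram D" "kink D v x y" "cycle D C" "cycle D E"
  shows "vertex_term D v C E = 0"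
proof -
  note k = kink_passages[OF assms(1,2)]
  have "C (frac y) = C (arc_in D (frac x))" "E (frac y) = E (arc_in D (frac x))"
    using k assms(3,4) unfolding cycle_def by force+
  then show ?thesis using k(2,3) by (auto simp: vertex_term_def)
qed

lemma intersection_supported_kink:
  assumes "diagram D" "kink D v x y" "cycle D C" "cycle D E" "supported_on D {frac x} C"
  shows "intersection D C E = 0"
proof -
  have "intersection D C E = (\<Sum>u\<in>{v}. vertex_term D u C E)"
    using assms kink_passages(1)[OF assms(1,2)]
    by (intro intersection_supported[where S = "{frac x}"]) (auto simp: kink_def)
  then show ?thesis using vertex_term_kink[OF assms(1-4)] by simp
qed

text \<open>
  The path from a passage to the next one consists of a single arc.
\<close>

lemma arcs_between_consecutive:
  assumes D: "diagram D" and c: "consecutive D x y" and xy: "x - y \<notin> \<int>"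
  shows "supported_on D {frac x} (arcs_between x y)"
  unfolding supported_on_def
proof
  fix t assume t: "t \<in> passages D - {frac x}"
  have y: "y < x + 1" using c xy by (cases "y = x + 1") (auto simp: consecutive_def)
  obtain t' where t': "t' - t \<in> \<int>" "x \<le> t'" "t' < x + 1" using ex_representative by blast
  have "curve D t' \<in> crossings D" using curve_cong[OF D t'(1)] t by (simp add: passages_def)
  moreover have "t' \<noteq> x" using t t'(1) frac_cong[OF t'(1)] passage_frac[of t D] by auto
  ultimately have "\<not> t' < y" using c t' by (auto simp: consecutive_def)
  then have "arcs_between x y t' = 0"
    using c y t' by (auto simp: arcs_between_period[of x] consecutive_def)
  then show "arcs_between x y t = 0" using arcs_between_cong(1)[of x x y y t' t] t'(1) by simp
qed

text \<open>
  The arcs from \<open>x\<^sub>0\<close> to \<open>y\<^sub>0\<close> and from \<open>x\<^sub>1\<close> to \<open>y\<^sub>1\<close> are the two sides of the bigon. That the first one joins the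
  passage \<open>sw\<close> of \<open>v\<^sub>1\<close> and the passage \<open>se\<close> of \<open>v\<^sub>2\<close>, in one of the two orders, expresses that the
  two crossings have opposite orientation: a strand which crosses the other one from left to right
  crosses back from right to left.
\<close>

definition bigon :: "vdiagram \<Rightarrow> complex \<Rightarrow> complex \<Rightarrow> real \<Rightarrow> real \<Rightarrow> real \<Rightarrow> real \<Rightarrow> bool" where
  "bigon D v\<^sub>1 v\<^sub>2 x\<^sub>0 y\<^sub>0 x\<^sub>1 y\<^sub>1 \<longleftrightarrow> v\<^sub>1 \<in> crossings D \<and> v\<^sub>2 \<in> crossings D \<and> v\<^sub>1 \<noteq> v\<^sub>2 \<and>
     consecutive D x\<^sub>0 y\<^sub>0 \<and> consecutive D x\<^sub>1 y\<^sub>1 \<and>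
     {sw D v\<^sub>1, se D v\<^sub>2} = {frac x\<^sub>0, frac y\<^sub>0} \<and> {se D v\<^sub>1, sw D v\<^sub>2} = {frac x\<^sub>1, frac y\<^sub>1}"

lemma bigon_cases:
  assumes "diagram D" "bigon D v\<^sub>1 v\<^sub>2 x\<^sub>0 y\<^sub>0 x\<^sub>1 y\<^sub>1"
  obtains "sw D v\<^sub>1 = frac x\<^sub>0" "se D v\<^sub>2 = frac y\<^sub>0" "se D v\<^sub>1 = frac x\<^sub>1" "sw D v\<^sub>2 = frac y\<^sub>1"
  | "sw D v\<^sub>1 = frac y\<^sub>0" "se D v\<^sub>2 = frac x\<^sub>0" "se D v\<^sub>1 = frac x\<^sub>1" "sw D v\<^sub>2 = frac y\<^sub>1"
  | "sw D v\<^sub>1 = frac x\<^sub>0" "se D v\<^sub>2 = frac y\<^sub>0" "se D v\<^sub>1 = frac y\<^sub>1" "sw D v\<^sub>2 = frac x\<^sub>1"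
  | "sw D v\<^sub>1 = frac y\<^sub>0" "se D v\<^sub>2 = frac x\<^sub>0" "se D v\<^sub>1 = frac y\<^sub>1" "sw D v\<^sub>2 = frac x\<^sub>1"
proof -
  have "{sw D v\<^sub>1, se D v\<^sub>2} = {frac x\<^sub>0, frac y\<^sub>0}" "{se D v\<^sub>1, sw D v\<^sub>2} = {frac x\<^sub>1, frac y\<^sub>1}"
    using assms(2) by (auto simp: bigon_def)
  then show thesis unfolding doubleton_eq_iff using that by blast
qed

lemma bigon_arc_in:
  assumes "diagram D" "bigon D v\<^sub>1 v\<^sub>2 x\<^sub>0 y\<^sub>0 x\<^sub>1 y\<^sub>1"
  shows "arc_in D (frac y\<^sub>0) = frac x\<^sub>0" "arc_in D (frac y\<^sub>1) = frac x\<^sub>1"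
  using assms by (auto simp: bigon_def intro: arc_in_consecutive)

text \<open>
  For cycles which leave the bigon along each strand with the same value with which they enter it, the
  terms at the two corners are negatives of each other. In each of the four orders this is immediate
  from the definition of the term.
\<close>

lemma vertex_terms_bigon:
  assumes "diagram D" "bigon D v\<^sub>1 v\<^sub>2 x\<^sub>0 y\<^sub>0 x\<^sub>1 y\<^sub>1"
    and "C (arc_in D (frac x\<^sub>0)) = C (frac y\<^sub>0)" "C (arc_in D (frac x\<^sub>1)) = C (frac y\<^sub>1)"
    and "E (arc_in D (frac x\<^sub>0)) = E (frac y\<^sub>0)" "E (arc_in D (frac x\<^sub>1)) = E (frac y\<^sub>1)"
  shows "vertex_term D v\<^sub>1 C E + vertex_term D v\<^sub>2 C E = 0"
  using bigon_arc_in[OF assms(1,2)] assms(3-6)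
  by (cases rule: bigon_cases[OF assms(1,2)]) (simp_all add: vertex_term_def)

text \<open>
  The boundary of a bigon can be pushed off every cycle. If the sides are parallel, the
  two vertex terms cancel literally. If they are antiparallel, conservation forces equal coefficients on
  the two sides, and the sum is this coefficient times the total flow of \<open>E\<close> through the bigon, which is 0.
\<close>

lemma intersection_supported_bigon:
  assumes D: "diagram D" and B: "bigon D v\<^sub>1 v\<^sub>2 x\<^sub>0 y\<^sub>0 x\<^sub>1 y\<^sub>1" and C: "cycle D C" and E: "cycle D E"
    and supp: "supported_on D {frac x\<^sub>0, frac x\<^sub>1} C"
  shows "intersection D C E = 0"
proof -
  have v: "v\<^sub>1 \<in> crossings D" "v\<^sub>2 \<in> crossings D" "v\<^sub>1 \<noteq> v\<^sub>2" using B by (auto simp: bigon_def)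
  have c: "consecutive D x\<^sub>0 y\<^sub>0" "consecutive D x\<^sub>1 y\<^sub>1" using B by (auto simp: bigon_def)
  have fr: "curve D (frac x) = curve D x" for x
    using curve_cong[OF D, of "frac x" x] by (simp add: frac_def)
  note cu = sw_se(1,2)[OF D v(1)] sw_se(1,2)[OF D v(2)]
  have "intersection D C E = (\<Sum>u\<in>{v\<^sub>1, v\<^sub>2}. vertex_term D u C E)"
  proof (rule intersection_supported[OF D _ supp])
    fix s assume "s \<in> {frac x\<^sub>0, frac x\<^sub>1}"
    moreover have "curve D x\<^sub>0 \<in> {v\<^sub>1, v\<^sub>2} \<and> curve D y\<^sub>0 \<in> {v\<^sub>1, v\<^sub>2} \<and>
        curve D x\<^sub>1 \<in> {v\<^sub>1, v\<^sub>2} \<and> curve D y\<^sub>1 \<in> {v\<^sub>1, v\<^sub>2}"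
      by (cases rule: bigon_cases[OF D B]) (use cu in \<open>simp_all add: fr\<close>)
    ultimately show "\<exists>x y. s = frac x \<and> consecutive D x y \<and> curve D x \<in> {v\<^sub>1, v\<^sub>2} \<and> curve D y \<in> {v\<^sub>1, v\<^sub>2}"
      using c by blast
  qed (use v in auto)
  also have "\<dots> = vertex_term D v\<^sub>1 C E + vertex_term D v\<^sub>2 C E" using v by simp
  also have "\<dots> = 0"
  proof -
    note p = sw_se_passages[OF D v(1)] sw_se_passages[OF D v(2)]
    note dist = sw_se_distinct[OF D v(1,2)] sw_se_distinct[OF D v(2,1)] sw_se_distinct[OF D v(1,1)] sw_se_distinct[OF D v(2,2)]
    note ai = bigon_arc_in[OF D B]
    have *: "frac x\<^sub>0 \<in> passages D" "frac x\<^sub>1 \<in> passages D" "frac y\<^sub>0 \<in> passages D" "frac y\<^sub>1 \<in> passages D"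
      using c frac_passage[OF D] by (auto simp: consecutive_def)
    have dis: "frac y\<^sub>0 \<noteq> frac x\<^sub>0 \<and> frac y\<^sub>0 \<noteq> frac x\<^sub>1 \<and> frac y\<^sub>1 \<noteq> frac x\<^sub>0 \<and> frac y\<^sub>1 \<noteq> frac x\<^sub>1"
      by (cases rule: bigon_cases[OF D B]) (use v(3) dist in auto)
    have zero: "C (frac y\<^sub>0) = 0" "C (frac y\<^sub>1) = 0"
      using supp * dis by (auto simp: supported_on_def)
    have "arc_in D (frac x\<^sub>0) \<noteq> arc_in D (frac y\<^sub>0)" "arc_in D (frac x\<^sub>0) \<noteq> arc_in D (frac y\<^sub>1)"
      "arc_in D (frac x\<^sub>1) \<noteq> arc_in D (frac y\<^sub>0)" "arc_in D (frac x\<^sub>1) \<noteq> arc_in D (frac y\<^sub>1)"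
      using arc_in_inj[OF D] * dis by auto
    then have "arc_in D (frac x\<^sub>0) \<notin> {frac x\<^sub>0, frac x\<^sub>1}" "arc_in D (frac x\<^sub>1) \<notin> {frac x\<^sub>0, frac x\<^sub>1}"
      by (simp_all add: ai)
    then have zero': "C (arc_in D (frac x\<^sub>0)) = 0" "C (arc_in D (frac x\<^sub>1)) = 0"
      using supp arc_in_maximal(1)[OF D] * by (auto simp: supported_on_def)
    have cy: "C (sw D v\<^sub>1) + C (se D v\<^sub>1) = C (arc_in D (sw D v\<^sub>1)) + C (arc_in D (se D v\<^sub>1))"
      "E (sw D v\<^sub>1) + E (se D v\<^sub>1) = E (arc_in D (sw D v\<^sub>1)) + E (arc_in D (se D v\<^sub>1))"
      "E (sw D v\<^sub>2) + E (se D v\<^sub>2) = E (arc_in D (sw D v\<^sub>2)) + E (arc_in D (se D v\<^sub>2))"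
      using C E v by (auto simp: cycle_def)
    show ?thesis
    proof (cases rule: bigon_cases[OF D B])
      case 1
      then show ?thesis using ai zero zero' by (simp add: vertex_term_def)
    next
      case 2
      then have e: "C (frac x\<^sub>1) = C (frac x\<^sub>0)"
        "E (frac y\<^sub>0) + E (frac y\<^sub>1) = E (arc_in D (frac x\<^sub>0)) + E (arc_in D (frac x\<^sub>1))"
        using ai zero zero' cy by auto
      show ?thesis using 2 ai zero zero' e(1) arg_cong[OF e(2), of "(*) (C (frac x\<^sub>0))"]
        by (simp add: vertex_term_def algebra_simps)
    next
      case 3
      then have e: "C (frac x\<^sub>1) = C (frac x\<^sub>0)"
        "E (frac y\<^sub>0) + E (frac y\<^sub>1) = E (arc_in D (frac x\<^sub>0)) + E (arc_in D (frac x\<^sub>1))"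
        using ai zero zero' cy by auto
      show ?thesis using 3 ai zero zero' e(1) arg_cong[OF e(2), of "(*) (C (frac x\<^sub>0))"]
        by (simp add: vertex_term_def algebra_simps)
    next
      case 4
      then show ?thesis using ai zero zero' by (simp add: vertex_term_def)
    qed
  qed
  finally show ?thesis .
qed

text \<open>
  The strands and the corners of a triangle are numbered modulo 3.
\<close>

definition nxt :: "nat \<Rightarrow> nat" where "nxt i = (i + 1) mod 3"
definition prv :: "nat \<Rightarrow> nat" where "prv i = (i + 2) mod 3"

lemma nxt_simps [simp]: "nxt 0 = 1" "nxt (Suc 0) = 2" "nxt 1 = 2" "nxt 2 = 0" "prv 0 = 2" "prv (Suc 0) = 0" "prv 1 = 0" "prv 2 = 1"
  by (simp_all add: nxt_def prv_def)

lemma less_3_cases: "i < 3 \<Longrightarrow> (i = 0 \<Longrightarrow> R) \<Longrightarrow> (i = 1 \<Longrightarrow> R) \<Longrightarrow> (i = 2 \<Longrightarrow> R) \<Longrightarrow> R" for i :: nat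
  by linarith

lemma sum_less_3: "(\<Sum>i<3. f i) = f 0 + f 1 + f (2::nat)"
  by (simp add: numeral_3_eq_3 numeral_2_eq_2)

text \<open>
  The strands of a triangle are numbered modulo 3. On strand \<open>i\<close> lie one passage \<open>P i\<close> of the crossing \<open>i\<close> of the
  strands \<open>i\<close> and \<open>i + 1\<close>, and one passage \<open>Q i\<close> of the crossing \<open>i - 1\<close>; the strand meets \<open>Q i\<close> first iff \<open>e i\<close>. For a
  cycle let \<open>X i\<close> be the value on the arc arriving at the first one of the two, and \<open>d i\<close> the amount by which the
  value jumps at \<open>P i\<close>. By conservation at the crossings, the value jumps by \<open>- d (i - 1)\<close> at \<open>Q i\<close>. So \<open>X\<close>
  and \<open>d\<close> determine the values on the arcs leaving and arriving at \<open>P i\<close> and \<open>Q i\<close>, which are the following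
  four functions, and \<open>X\<close> and \<open>d\<close> are subject to no further condition.
\<close>

definition p_out where "p_out e X d i = (if e i then X i + d i - d (prv i) else X i + d i :: int)"
definition p_in where "p_in e X d i = (if e i then X i - d (prv i) else X i :: int)"
definition q_out where "q_out e X d i = (if e i then X i - d (prv i) else X i + d i - d (prv i) :: int)"
definition q_in where "q_in e X d i = (if e i then X i else X i + d i :: int)"

text \<open>
  The sum of the vertex terms at the three corners, where \<open>sw\<close> at the corner \<open>i\<close> is \<open>P i\<close> if \<open>e i = e (i + 1)\<close> and \<open>Q (i + 1)\<close>
  otherwise.
\<close>

definition triangle_form ::
  "(nat \<Rightarrow> bool) \<Rightarrow> (nat \<Rightarrow> int) \<Rightarrow> (nat \<Rightarrow> int) \<Rightarrow> (nat \<Rightarrow> int) \<Rightarrow> (nat \<Rightarrow> int) \<Rightarrow> int" where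
  "triangle_form e X d X' d' = (\<Sum>i<3. if e i = e (nxt i)
      then p_out e X d i * q_out e X' d' (nxt i) - q_in e X d (nxt i) * p_in e X' d' i
      else q_out e X d (nxt i) * p_out e X' d' i - p_in e X d i * q_in e X' d' (nxt i))"

text \<open>
  The algebraic heart of the invariance under a third move, in which the order of the two crossings on
  each strand is reversed. The values with which a cycle enters and leaves the triangle determine \<open>d\<close> only up
  to a common constant, which is the multiplicity of the boundary of the triangle.
\<close>

lemma triangle_form_reverse:
  "triangle_form (\<lambda>i. \<not> e i) X (\<lambda>i. d i + c) X' (\<lambda>i. d' i + c') = triangle_form e X d X' d'"
  by (cases "e 0"; cases "e 1"; cases "e 2";
      simp only: triangle_form_def sum_less_3 nxt_simps p_out_def p_in_def q_out_def q_in_def if_True if_False simp_thms;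
      algebra)

lemma triangle_form_cong:
  assumes "\<And>i. i < 3 \<Longrightarrow> X i = Y i" "\<And>i. i < 3 \<Longrightarrow> X' i = Y' i" "\<And>i. i < 3 \<Longrightarrow> d i = f i" "\<And>i. i < 3 \<Longrightarrow> d' i = f' i"
  shows "triangle_form e X d X' d' = triangle_form e Y f Y' f'"
proof -
  have "X 0 = Y 0" "X 1 = Y 1" "X 2 = Y 2" "X' 0 = Y' 0" "X' 1 = Y' 1" "X' 2 = Y' 2"
    "d 0 = f 0" "d 1 = f 1" "d 2 = f 2" "d' 0 = f' 0" "d' 1 = f' 1" "d' 2 = f' 2"
    using assms by auto
  then show ?thesis
    by (simp only: triangle_form_def sum_less_3 nxt_simps p_out_def p_in_def q_out_def q_in_def)
qed

text \<open>
  A multiple of the boundary of the triangle is compared with the cycle 0 on the other side of the move.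
\<close>

lemma triangle_form_zero:
  assumes "\<And>i. i < 3 \<Longrightarrow> X i = 0" "\<And>i. i < 3 \<Longrightarrow> d i = c"
  shows "triangle_form e X d X' d' = 0"
proof -
  have "triangle_form e X d X' d' = triangle_form e (\<lambda>_. 0) (\<lambda>_. c) X' d'"
    using assms by (intro triangle_form_cong) auto
  also have "\<dots> = triangle_form (\<lambda>i. \<not> e i) (\<lambda>_. 0) (\<lambda>_. c + - c) X' (\<lambda>i. d' i + 0)"
    by (rule triangle_form_reverse[symmetric])
  also have "\<dots> = 0"
    by (auto simp: triangle_form_def p_out_def p_in_def q_out_def q_in_def intro!: sum.neutral)
  finally show ?thesis .
qed

text \<open>
  The condition on \<open>sw\<close> is the one for lines in general position: consecutive strands with the same sense
  around the triangle cross positively.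
\<close>

definition triangle ::
  "vdiagram \<Rightarrow> (nat \<Rightarrow> bool) \<Rightarrow> (nat \<Rightarrow> real) \<Rightarrow> (nat \<Rightarrow> real) \<Rightarrow> (nat \<Rightarrow> complex) \<Rightarrow> bool" where
  "triangle D e P Q v \<longleftrightarrow> inj_on v {..<3} \<and> (\<forall>i<3. v i \<in> crossings D \<and>
     consecutive D (if e i then Q i else P i) (if e i then P i else Q i) \<and>
     curve D (P i) = v i \<and> curve D (Q (nxt i)) = v i \<and>
     sw D (v i) = frac (if e i = e (nxt i) then P i else Q (nxt i)) \<and>
     se D (v i) = frac (if e i = e (nxt i) then Q (nxt i) else P i))"

definition entry :: "vdiagram \<Rightarrow> (nat \<Rightarrow> bool) \<Rightarrow> (nat \<Rightarrow> real) \<Rightarrow> (nat \<Rightarrow> real) \<Rightarrow> chain \<Rightarrow> nat \<Rightarrow> int" where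
  "entry D e P Q C i = C (arc_in D (frac (if e i then Q i else P i)))"

definition exit :: "(nat \<Rightarrow> bool) \<Rightarrow> (nat \<Rightarrow> real) \<Rightarrow> (nat \<Rightarrow> real) \<Rightarrow> chain \<Rightarrow> nat \<Rightarrow> int" where
  "exit e P Q C i = C (frac (if e i then P i else Q i))"

definition jump :: "vdiagram \<Rightarrow> (nat \<Rightarrow> real) \<Rightarrow> chain \<Rightarrow> nat \<Rightarrow> int" where
  "jump D P C i = C (frac (P i)) - C (arc_in D (frac (P i)))"

lemma triangleD:
  assumes "triangle D e P Q v" "i < 3"
  shows "v i \<in> crossings D"
    "consecutive D (if e i then Q i else P i) (if e i then P i else Q i)"
    "curve D (P i) = v i" "curve D (Q (nxt i)) = v i"
    "sw D (v i) = frac (if e i = e (nxt i) then P i else Q (nxt i))"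
    "se D (v i) = frac (if e i = e (nxt i) then Q (nxt i) else P i)"
  using assms by (auto simp only: triangle_def)

lemma cycleD:
  assumes "cycle D C" "v \<in> crossings D"
  shows "C (sw D v) + C (se D v) = C (arc_in D (sw D v)) + C (arc_in D (se D v))"
  using assms by (simp add: cycle_def)

text \<open>
  Translates a cycle into the parameters of the triangle form, and expresses the values with which it
  leaves the triangle by these parameters.
\<close>

lemma triangle_values:
  assumes D: "diagram D" and T: "triangle D e P Q v" and C: "cycle D C" and i: "i < 3"
  shows "C (frac (P i)) = p_out e (entry D e P Q C) (jump D P C) i"
    "C (arc_in D (frac (P i))) = p_in e (entry D e P Q C) (jump D P C) i"
    "C (frac (Q i)) = q_out e (entry D e P Q C) (jump D P C) i"
    "C (arc_in D (frac (Q i))) = q_in e (entry D e P Q C) (jump D P C) i"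
    "exit e P Q C i = entry D e P Q C i + jump D P C i - jump D P C (prv i)"
proof -
  have ai: "arc_in D (frac (if e i then P i else Q i)) = frac (if e i then Q i else P i)"
    by (rule arc_in_consecutive[OF D triangleD(2)[OF T i]])
  have p: "prv i < 3" "nxt (prv i) = i" using i by (auto elim!: less_3_cases)
  note t = triangleD[OF T p(1), unfolded p(2)]
  have "C (frac (Q i)) - C (arc_in D (frac (Q i))) = - jump D P C (prv i)"
    using cycleD[OF C t(1)] unfolding t(5,6) by (cases "e (prv i) = e i") (simp_all add: jump_def)
  then show "C (frac (P i)) = p_out e (entry D e P Q C) (jump D P C) i"
    "C (arc_in D (frac (P i))) = p_in e (entry D e P Q C) (jump D P C) i"
    "C (frac (Q i)) = q_out e (entry D e P Q C) (jump D P C) i"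
    "C (arc_in D (frac (Q i))) = q_in e (entry D e P Q C) (jump D P C) i"
    "exit e P Q C i = entry D e P Q C i + jump D P C i - jump D P C (prv i)"
    using ai by (cases "e i"; simp add: p_out_def p_in_def q_out_def q_in_def entry_def exit_def jump_def)+
qed

lemma vertex_terms_triangle:
  assumes D: "diagram D" and T: "triangle D e P Q v" and C: "cycle D C" and E: "cycle D E"
  shows "(\<Sum>i<3. vertex_term D (v i) C E) =
    triangle_form e (entry D e P Q C) (jump D P C) (entry D e P Q E) (jump D P E)"
  unfolding triangle_form_def
proof (rule sum.cong[OF refl])
  fix i :: nat assume i: "i \<in> {..<3}"
  then have n: "i < 3" "nxt i < 3" by (auto elim!: less_3_cases)
  note vals = triangle_values[OF D T C n(1)] triangle_values[OF D T C n(2)]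
    triangle_values[OF D T E n(1)] triangle_values[OF D T E n(2)]
  have "sw D (v i) = frac (if e i = e (nxt i) then P i else Q (nxt i))"
     "se D (v i) = frac (if e i = e (nxt i) then Q (nxt i) else P i)"
    using triangleD[OF T n(1)] by auto
  then show "vertex_term D (v i) C E = (if e i = e (nxt i)
      then p_out e (entry D e P Q C) (jump D P C) i * q_out e (entry D e P Q E) (jump D P E) (nxt i)
         - q_in e (entry D e P Q C) (jump D P C) (nxt i) * p_in e (entry D e P Q E) (jump D P E) i
      else q_out e (entry D e P Q C) (jump D P C) (nxt i) * p_out e (entry D e P Q E) (jump D P E) i
         - p_in e (entry D e P Q C) (jump D P C) i * q_in e (entry D e P Q E) (jump D P E) (nxt i))"
    by (simp add: vertex_term_def vals)
qed

text \<open>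
  Equal cyclic differences mean that the difference of the two functions is invariant under \<open>nxt\<close>.
\<close>

lemma jumps_differ_by_constant:
  fixes d d' :: "nat \<Rightarrow> int"
  assumes "\<And>i. i < 3 \<Longrightarrow> d' i - d' (prv i) = d i - d (prv i)"
    and "i < 3"
  shows "d' i = d i + (d' 0 - d 0)"
proof -
  have "d' 1 - d' 0 = d 1 - d 0" "d' 2 - d' 1 = d 2 - d 1" using assms(1)[of 1] assms(1)[of 2] by auto
  moreover have "i = 0 \<or> i = 1 \<or> i = 2" using assms(2) by linarith
  ultimately show ?thesis by auto
qed

text \<open>
  The three corners before and after a third move contribute equally to the intersection of cycles
  which agree outside the disc of the move.
\<close>

lemma vertex_terms_triangle_reverse:
  assumes D: "diagram D" and T: "triangle D e P Q v" and C: "cycle D C" and E: "cycle D E"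
    and D': "diagram D'" and T': "triangle D' (\<lambda>i. \<not> e i) P' Q' v'" and C': "cycle D' C'" and E': "cycle D' E'"
    and CC': "\<And>i. i < 3 \<Longrightarrow> entry D' (\<lambda>i. \<not> e i) P' Q' C' i = entry D e P Q C i"
      "\<And>i. i < 3 \<Longrightarrow> exit (\<lambda>i. \<not> e i) P' Q' C' i = exit e P Q C i"
    and EE': "\<And>i. i < 3 \<Longrightarrow> entry D' (\<lambda>i. \<not> e i) P' Q' E' i = entry D e P Q E i"
      "\<And>i. i < 3 \<Longrightarrow> exit (\<lambda>i. \<not> e i) P' Q' E' i = exit e P Q E i"
  shows "(\<Sum>i<3. vertex_term D' (v' i) C' E') = (\<Sum>i<3. vertex_term D (v i) C E)"
proof -
  have dC: "jump D' P' C' i = jump D P C i + (jump D' P' C' 0 - jump D P C 0)" if "i < 3" for i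
    using that triangle_values(5)[OF D T C] triangle_values(5)[OF D' T' C'] CC'
    by (intro jumps_differ_by_constant) force+
  have dE: "jump D' P' E' i = jump D P E i + (jump D' P' E' 0 - jump D P E 0)" if "i < 3" for i
    using that triangle_values(5)[OF D T E] triangle_values(5)[OF D' T' E'] EE'
    by (intro jumps_differ_by_constant) force+
  have "(\<Sum>i<3. vertex_term D' (v' i) C' E') = triangle_form (\<lambda>i. \<not> e i)
      (entry D' (\<lambda>i. \<not> e i) P' Q' C') (jump D' P' C') (entry D' (\<lambda>i. \<not> e i) P' Q' E') (jump D' P' E')"
    by (rule vertex_terms_triangle[OF D' T' C' E'])
  also have "\<dots> = triangle_form (\<lambda>i. \<not> e i)
      (entry D e P Q C) (\<lambda>i. jump D P C i + (jump D' P' C' 0 - jump D P C 0))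
      (entry D e P Q E) (\<lambda>i. jump D P E i + (jump D' P' E' 0 - jump D P E 0))"
    by (intro triangle_form_cong CC' EE' dC dE)
  also have "\<dots> = triangle_form e (entry D e P Q C) (jump D P C) (entry D e P Q E) (jump D P E)"
    by (rule triangle_form_reverse)
  also have "\<dots> = (\<Sum>i<3. vertex_term D (v i) C E)"
    by (rule vertex_terms_triangle[OF D T C E, symmetric])
  finally show ?thesis .
qed

text \<open>
  A cycle supported on the sides has entries and exits 0, so all its jumps agree.
\<close>

lemma intersection_supported_triangle:
  assumes D: "diagram D" and T: "triangle D e P Q v" and C: "cycle D C" and E: "cycle D E"
    and supp: "supported_on D {frac (if e i then Q i else P i) | i. i < 3} C"
    and second: "\<And>i j. i < 3 \<Longrightarrow> j < 3 \<Longrightarrow> frac (if e i then P i else Q i) \<noteq> frac (if e j then Q j else P j)"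
  shows "intersection D C E = 0"
proof -
  let ?x = "\<lambda>i. if e i then Q i else P i" and ?y = "\<lambda>i. if e i then P i else Q i"
  have con: "consecutive D (?x i) (?y i)" if "i < 3" for i by (rule triangleD(2)[OF T that])
  have pas: "frac (?x i) \<in> passages D" "frac (?y i) \<in> passages D" if "i < 3" for i
    using con[OF that] by (auto simp: consecutive_def simp del: if_split intro!: frac_passage[OF D])
  have cur: "curve D (P i) \<in> v ` {..<3}" "curve D (Q i) \<in> v ` {..<3}" if "i < 3" for i
  proof -
    have "prv i < 3" "nxt (prv i) = i" using that by (auto elim!: less_3_cases)
    then have "curve D (P i) = v i" "curve D (Q i) = v (prv i)"
      using triangleD(3)[OF T that] triangleD(4)[OF T, of "prv i"] by auto
    then show "curve D (P i) \<in> v ` {..<3}" "curve D (Q i) \<in> v ` {..<3}"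
      using that \<open>prv i < 3\<close> by auto
  qed
  have "intersection D C E = (\<Sum>u\<in>v ` {..<3}. vertex_term D u C E)"
  proof (rule intersection_supported[OF D _ supp])
    show "v ` {..<3} \<subseteq> crossings D" using triangleD(1)[OF T] by auto
    fix s assume "s \<in> {frac (?x i) | i. i < 3}"
    then obtain i where "i < 3" "s = frac (?x i)" by blast
    then show "\<exists>x y. s = frac x \<and> consecutive D x y \<and> curve D x \<in> v ` {..<3} \<and> curve D y \<in> v ` {..<3}"
      using con[of i] cur[of i] by (intro exI[of _ "?x i"] exI[of _ "?y i"]) auto
  qed
  also have "\<dots> = (\<Sum>i<3. vertex_term D (v i) C E)"
    using T by (simp add: sum.reindex triangle_def)
  also have "\<dots> = triangle_form e (entry D e P Q C) (jump D P C) (entry D e P Q E) (jump D P E)"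
    by (rule vertex_terms_triangle[OF D T C E])
  also have "\<dots> = 0"
  proof -
    have ex: "exit e P Q C i = 0" if "i < 3" for i
    proof -
      have "frac (?y i) \<notin> {frac (?x i) | i. i < 3}" using second[OF that] by blast
      then show ?thesis using supp pas(2)[OF that] by (simp add: supported_on_def exit_def)
    qed
    have en: "entry D e P Q C i = 0" if "i < 3" for i
    proof -
      have "arc_in D (frac (?x i)) \<notin> {frac (?x i) | i. i < 3}"
      proof
        assume "arc_in D (frac (?x i)) \<in> {frac (?x i) | i. i < 3}"
        then obtain j where j: "j < 3" "arc_in D (frac (?x i)) = frac (?x j)" by blast
        then have "arc_in D (frac (?x i)) = arc_in D (frac (?y j))" using arc_in_consecutive[OF D con] by metis
        then show False using arc_in_inj[OF D pas(1)[OF that] pas(2)[OF j(1)]] second[OF j(1) that] by auto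
      qed
      then show ?thesis
        using supp arc_in_maximal(1)[OF D pas(1)[OF that]] by (simp add: supported_on_def entry_def)
    qed
    have jump: "jump D P C i = 0 + (jump D P C 0 - 0)" if "i < 3" for i
      by (rule jumps_differ_by_constant[where d = "\<lambda>_. 0", OF _ that])
        (use triangle_values(5)[OF D T C] ex en in force)
    define c where "c = jump D P C 0"
    have "jump D P C i = c" if "i < 3" for i
      unfolding c_def by (rule trans[OF jump[OF that]]) simp
    with en show ?thesis by (rule triangle_form_zero)
  qed
  finally show ?thesis .
qed


section \<open>Relations between halves\<close>

lemma intersection_zero_left: "intersection D (\<lambda>t. 0) E = 0"
  by (simp add: intersection_def)

lemma intersection_sum_left:
  "intersection D (\<lambda>t. \<Sum>i\<in>I. c i * F i t) E = (\<Sum>i\<in>I. c i * intersection D (F i) E)"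
  by (induction I rule: infinite_finite_induct)
    (simp_all add: intersection_zero_left intersection_add_left intersection_scale_left)

lemma cycle_sum:
  assumes "\<And>i. i \<in> I \<Longrightarrow> cycle D (F i)"
  shows "cycle D (\<lambda>t. \<Sum>i\<in>I. c i * F i t)"
proof -
  have "cycle D (\<lambda>t. 0)" by (simp add: cycle_def)
  then show ?thesis
    using assms by (induction I rule: infinite_finite_induct) (simp_all add: cycle_add cycle_scale)
qed

text \<open>
  The cycle \<open>\<Sum> c_i R\<^bsub>w_i\<^esub> - k D\<close>.
\<close>

definition relation_chain :: "vdiagram \<Rightarrow> 'i set \<Rightarrow> ('i \<Rightarrow> int) \<Rightarrow> ('i \<Rightarrow> complex) \<Rightarrow> int \<Rightarrow> chain" where
  "relation_chain D I c w k = (\<lambda>t. (\<Sum>i\<in>I. c i * right_half D (w i) t) + (- k) * whole t)"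

lemma cycle_relation_chain:
  assumes "diagram D" "w ` I \<subseteq> crossings D"
  shows "cycle D (relation_chain D I c w k)"
  unfolding relation_chain_def
  using assms by (intro cycle_add cycle_scale cycle_whole cycle_sum cycle_right_half) auto

abbreviation left_right :: "vdiagram \<Rightarrow> complex \<Rightarrow> complex \<Rightarrow> int" where
  "left_right D v w \<equiv> intersection D (left_half D v) (right_half D w)"

text \<open>
  If \<open>C = \<Sum> c_i R\<^bsub>w_i\<^esub> - k D\<close> meets every cycle in 0, then \<open>\<Sum> c_i R\<^bsub>w_i\<^esub>\<close> can be replaced by \<open>k D\<close>, and
  \<open>\<Sum> c_i L\<^bsub>w_i\<^esub>\<close> by \<open>(\<Sum> c_i - k) D\<close>, in every intersection number. The three formulas are the
  intersections with \<open>L_u\<close>, \<open>R_u\<close> and \<open>D\<close>.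
\<close>

lemma relation_consequences:
  assumes D: "diagram D" and w: "w ` I \<subseteq> crossings D"
    and null: "\<And>E. cycle D E \<Longrightarrow> intersection D (relation_chain D I c w k) E = 0"
  shows "u \<in> crossings D \<Longrightarrow> (\<Sum>i\<in>I. c i * left_right D u (w i)) = - k * index_parity D u"
    and "u \<in> crossings D \<Longrightarrow> (\<Sum>i\<in>I. c i * left_right D (w i) u) = (k - sum c I) * index_parity D u"
    and "(\<Sum>i\<in>I. c i * index_parity D (w i)) = 0"
proof -
  have right: "(\<Sum>i\<in>I. c i * intersection D (right_half D (w i)) E) = k * intersection D whole E" if "cycle D E" for E
    using null[OF that] unfolding relation_chain_def
    by (simp only: intersection_add_left intersection_scale_left intersection_sum_left)
  have left: "(\<Sum>i\<in>I. c i * intersection D (left_half D (w i)) E) = (sum c I - k) * intersection D whole E"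
    if "cycle D E" for E
  proof -
    have "c i * intersection D (left_half D (w i)) E
        = c i * intersection D whole E - c i * intersection D (right_half D (w i)) E" if "i \<in> I" for i
    proof -
      have "w i \<in> crossings D" using w that by auto
      then show ?thesis unfolding left_half_complement[OF D \<open>w i \<in> crossings D\<close>]
        by (simp only: intersection_add_left intersection_scale_left) (simp add: algebra_simps)
    qed
    then have "(\<Sum>i\<in>I. c i * intersection D (left_half D (w i)) E)
        = sum c I * intersection D whole E - (\<Sum>i\<in>I. c i * intersection D (right_half D (w i)) E)"
      by (simp add: sum_subtractf sum_distrib_right)
    then show ?thesis using right[OF that] by (simp add: algebra_simps)
  qed
  show "(\<Sum>i\<in>I. c i * left_right D u (w i)) = - k * index_parity D u" if u: "u \<in> crossings D"
  proof -
    have "c i * left_right D u (w i) = - (c i * intersection D (right_half D (w i)) (left_half D u))" if "i \<in> I" for i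
    proof -
      have "w i \<in> crossings D" using w that by auto
      then show ?thesis
        using intersection_antisym[OF D cycle_left_half[OF D u] cycle_right_half[OF D \<open>w i \<in> crossings D\<close>]] by simp
    qed
    then have "(\<Sum>i\<in>I. c i * left_right D u (w i)) = - (k * intersection D whole (left_half D u))"
      using right[OF cycle_left_half[OF D u]] by (simp add: sum_negf)
    then show ?thesis
      using intersection_antisym[OF D cycle_whole cycle_left_half[OF D u]] by (simp add: index_parity_def)
  qed
  show "(\<Sum>i\<in>I. c i * left_right D (w i) u) = (k - sum c I) * index_parity D u" if u: "u \<in> crossings D"
    using left[OF cycle_right_half[OF D u]] intersection_whole_right_half[OF D u] by (simp add: algebra_simps)
  show "(\<Sum>i\<in>I. c i * index_parity D (w i)) = 0"
    using left[OF cycle_whole] by (simp add: index_parity_def intersection_whole_whole sum_negf)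
qed


section \<open>The cyclic order relative to disjoint intervals\<close>

lemma periodic_interval_iff: "t \<in> periodic_interval a b \<longleftrightarrow> (\<exists>z. z - t \<in> \<int> \<and> a \<le> z \<and> z \<le> b)"
proof
  assume "t \<in> periodic_interval a b"
  then obtain n :: int where "t + of_int n \<in> {a..b}" by (auto simp: periodic_interval_def)
  then show "\<exists>z. z - t \<in> \<int> \<and> a \<le> z \<and> z \<le> b" by (intro exI[of _ "t + of_int n"]) auto
next
  assume "\<exists>z. z - t \<in> \<int> \<and> a \<le> z \<and> z \<le> b"
  then obtain z where z: "z - t \<in> \<int>" "z \<in> {a..b}" by auto
  obtain k where "z - t = of_int k" using z(1) by (rule Ints_cases)
  then have "t + of_int k \<in> {a..b}" using z by (simp add: algebra_simps)
  then show "t \<in> periodic_interval a b" by (auto simp: periodic_interval_def)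
qed

lemma periodic_interval_cong:
  assumes "s - t \<in> \<int>"
  shows "s \<in> periodic_interval a b \<longleftrightarrow> t \<in> periodic_interval a b"
  unfolding periodic_interval_iff using assms Ints_diff_trans Ints_diff_sym by blast

lemma in_periodic_interval: "a \<le> t \<Longrightarrow> t \<le> b \<Longrightarrow> t \<in> periodic_interval a b"
  unfolding periodic_interval_iff by (intro exI[of _ t]) auto

text \<open>
  The parameter intervals of the strands of a local change. A parameter outside of all of them belongs to
  the part of the diagram that stays fixed.
\<close>

locale strands =
  fixes n :: nat and a b :: "nat \<Rightarrow> real"
  assumes bounds: "i < n \<Longrightarrow> a i < b i" "i < n \<Longrightarrow> b i < a i + 1"
    and disjoint: "i < n \<Longrightarrow> j < n \<Longrightarrow> t \<in> periodic_interval (a i) (b i) \<Longrightarrow> t \<in> periodic_interval (a j) (b j) \<Longrightarrow> i = j"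
begin

abbreviation "I i \<equiv> periodic_interval (a i) (b i)"

text \<open>
  Two parameters are equivalent if they are equal or lie on the same strand. The cyclic order of
  three parameters in different cells does not change if they are replaced by equivalent ones.
\<close>

definition same_cell :: "real \<Rightarrow> real \<Rightarrow> bool" where
  "same_cell s s' \<longleftrightarrow> s = s' \<or> (\<exists>i<n. s \<in> I i \<and> s' \<in> I i)"

definition separated :: "real \<Rightarrow> real \<Rightarrow> bool" where
  "separated s t \<longleftrightarrow> s - t \<notin> \<int> \<and> (\<forall>i<n. \<not> (s \<in> I i \<and> t \<in> I i))"

lemma same_cell_I: "same_cell s s' \<Longrightarrow> i < n \<Longrightarrow> s \<in> I i \<longleftrightarrow> s' \<in> I i"
  using disjoint by (auto simp: same_cell_def)

lemma separated_sym: "separated s t \<Longrightarrow> separated t s"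
  using Ints_diff_sym by (auto simp: separated_def)

lemma separated_I: "i < n \<Longrightarrow> t \<in> I i \<Longrightarrow> s \<notin> I i \<Longrightarrow> separated s t"
  using disjoint periodic_interval_cong[of s t] by (auto simp: separated_def)

lemma separated_same_cell: "separated s r \<Longrightarrow> same_cell r r' \<Longrightarrow> separated s r'"
  unfolding same_cell_def using separated_I by (auto simp: separated_def)

lemma arcs_between_move_in_cell:
  assumes "separated s r" "separated t r" "same_cell r r'"
  shows "arcs_between s t r = arcs_between s t r'"
proof (cases "r = r'")
  case False
  then obtain i where i: "i < n" "r \<in> I i" "r' \<in> I i" using assms(3) by (auto simp: same_cell_def)
  obtain z z' where z: "z - r \<in> \<int>" "a i \<le> z" "z \<le> b i" "z' - r' \<in> \<int>" "a i \<le> z'" "z' \<le> b i"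
    using i by (auto simp: periodic_interval_iff)
  have notin: "s \<notin> I i" "t \<notin> I i" using assms(1,2) i by (auto simp: separated_def)
  have out: "x - s \<notin> \<int>" "x - t \<notin> \<int>" if "a i \<le> x" "x \<le> b i" for x
    using notin in_periodic_interval[OF that] periodic_interval_cong[of x] by blast+
  have "arcs_between s t z = arcs_between s t z'" if "z \<le> z'" "a i \<le> z" "z' \<le> b i" for z z'
    using that out by (intro arcs_between_move) auto
  then have "arcs_between s t z = arcs_between s t z'" using z by (metis linear)
  then show ?thesis using z arcs_between_cong(1)[of s s t t z r] arcs_between_cong(1)[of s s t t z' r'] by simp
qed simp

text \<open>
  Move the three points one after the other. A rotation makes each of them the last argument, for
  which nothing is crossed on the way inside its strand.
\<close>

lemma arcs_between_same_cell:
  assumes st: "separated s t" and tr: "separated t r" and rs: "separated r s"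
    and s: "same_cell s s'" and t: "same_cell t t'" and r: "same_cell r r'"
  shows "arcs_between s t r = arcs_between s' t' r'"
proof -
  note sym = separated_sym
  have tr': "separated t r'" using separated_same_cell[OF tr r] .
  have sr': "separated s r'" using separated_same_cell[OF sym[OF rs] r] .
  have st': "separated s t'" using separated_same_cell[OF st t] .
  have rt': "separated r' t'" using separated_same_cell[OF sym[OF tr'] t] .
  have ts': "separated t' s'" using separated_same_cell[OF sym[OF st'] s] .
  have rs': "separated r' s'" using separated_same_cell[OF sym[OF sr'] s] .
  have ints: "separated x y \<Longrightarrow> x - y \<notin> \<int>" for x y by (simp add: separated_def)
  have "arcs_between s t r = arcs_between s t r'"
    by (rule arcs_between_move_in_cell[OF sym[OF rs] tr r])
  also have "\<dots> = arcs_between r' s t"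
    using st tr' sr' sym by (intro arcs_between_rotate ints) blast+
  also have "\<dots> = arcs_between r' s t'"
    by (rule arcs_between_move_in_cell[OF sym[OF tr'] st t])
  also have "\<dots> = arcs_between t' r' s"
    using sr' st' rt' sym by (intro arcs_between_rotate ints) blast+
  also have "\<dots> = arcs_between t' r' s'"
    by (rule arcs_between_move_in_cell[OF sym[OF st'] sym[OF sr'] s])
  also have "\<dots> = arcs_between s' t' r'"
    using ts' rs' rt' sym by (intro arcs_between_rotate ints) blast+
  finally show ?thesis .
qed

lemma same_cell_outside: "same_cell s s' \<Longrightarrow> \<forall>i<n. s \<notin> I i \<Longrightarrow> s' = s"
  by (auto simp: same_cell_def)

text \<open>
  Up to equality of cells, the values of a path at a fixed passage do not depend on the positions of its
  ends within their strands. A fixed passage may itself be an end; then this end does not move.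
\<close>

lemma arcs_between_outside:
  assumes st: "separated s t" and s: "same_cell s s'" and t: "same_cell t t'" and r: "\<forall>i<n. r \<notin> I i"
  shows "arcs_between s t r = arcs_between s' t' r" "enters s t r = enters s' t' r"
proof -
  have st': "separated s' t'" using separated_sym separated_same_cell st s t by blast
  have ints: "s - t \<notin> \<int>" "s' - t' \<notin> \<int>" using st st' by (auto simp: separated_def)
  have *: "arcs_between s t r = arcs_between s' t' r \<and> enters s t r = enters s' t' r"
  proof (cases "r - s \<in> \<int>")
    case True
    then have "\<forall>i<n. s \<notin> I i" using r periodic_interval_cong by blast
    then have "s' = s" using same_cell_outside[OF s] by simp
    moreover have "arcs_between s t r = arcs_between s t s" "arcs_between s t' r = arcs_between s t' s"
      "enters s t r = enters s t s" "enters s t' r = enters s t' s"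
      using True by (auto intro: arcs_between_cong)
    ultimately show ?thesis using arcs_between_endpoints[OF ints(1)] arcs_between_endpoints[OF ints(2)] by simp
  next
    case rs: False
    show ?thesis
    proof (cases "r - t \<in> \<int>")
      case True
      then have "\<forall>i<n. t \<notin> I i" using r periodic_interval_cong by blast
      then have "t' = t" using same_cell_outside[OF t] by simp
      moreover have "arcs_between s t r = arcs_between s t t" "arcs_between s' t r = arcs_between s' t t"
        "enters s t r = enters s t t" "enters s' t r = enters s' t t"
        using True by (auto intro: arcs_between_cong)
      ultimately show ?thesis using arcs_between_endpoints[OF ints(1)] arcs_between_endpoints[OF ints(2)] by simp
    next
      case False
      then have sep: "separated r s" "separated r t" using rs r by (auto simp: separated_def)
      then have "separated r s'" "separated r t'" using separated_same_cell s t by blast+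
      then have "r - s' \<notin> \<int>" "r - t' \<notin> \<int>" by (auto simp: separated_def)
      moreover have "arcs_between s t r = arcs_between s' t' r"
        using sep st s t separated_sym by (intro arcs_between_same_cell) (auto simp: same_cell_def)
      ultimately show ?thesis using rs False by (simp add: enters_eq_arcs_between)
    qed
  qed
  then show "arcs_between s t r = arcs_between s' t' r" "enters s t r = enters s' t' r" by auto
qed

text \<open>
  Whenever \<open>s\<close> lies on the strand \<open>k\<close>, it does so at or before the parameter \<open>y\<close>; dually for \<open>after\<close>. This is used with
  the last and the first passage of a strand.
\<close>

definition before :: "nat \<Rightarrow> real \<Rightarrow> real \<Rightarrow> bool" where
  "before k y s \<longleftrightarrow> (s \<in> I k \<longrightarrow> (\<exists>z. z - s \<in> \<int> \<and> a k \<le> z \<and> z \<le> y))"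

definition after :: "nat \<Rightarrow> real \<Rightarrow> real \<Rightarrow> bool" where
  "after k x s \<longleftrightarrow> (s \<in> I k \<longrightarrow> (\<exists>z. z - s \<in> \<int> \<and> x \<le> z \<and> z \<le> b k))"

text \<open>
  Only one end of the path lies on the strand, and it precedes \<open>y\<close>; so no other end comes between it
  and \<open>y\<close>, and the value at \<open>y\<close> depends only on which end it is.
\<close>

lemma exit_values:
  assumes k: "k < n" and y: "a k \<le> y" "y \<le> b k" and st: "separated s t"
    and s: "before k y s" and t: "before k y t"
  shows "s \<in> I k \<Longrightarrow> arcs_between s t y = 1" "t \<in> I k \<Longrightarrow> arcs_between s t y = 0"
proof -
  have out: "x - r \<notin> \<int>" if "a k \<le> x" "x \<le> b k" "r \<notin> I k" for x r
    using in_periodic_interval[OF that(1,2)] periodic_interval_cong[of x r] that(3) by blast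
  show "arcs_between s t y = 1" if "s \<in> I k"
  proof -
    obtain z where z: "z - s \<in> \<int>" "a k \<le> z" "z \<le> y" using s \<open>s \<in> I k\<close> by (auto simp: before_def)
    have "t \<notin> I k" using st \<open>s \<in> I k\<close> k by (auto simp: separated_def)
    then have "arcs_between z t y = 1"
      using z y bounds[OF k] out by (intro arcs_between_initial(2)[of z]) auto
    then show ?thesis using z arcs_between_cong(1)[of z s t t y y] by simp
  qed
  show "arcs_between s t y = 0" if "t \<in> I k"
  proof -
    obtain z where z: "z - t \<in> \<int>" "a k \<le> z" "z \<le> y" using t \<open>t \<in> I k\<close> by (auto simp: before_def)
    have "s \<notin> I k" using st \<open>t \<in> I k\<close> k by (auto simp: separated_def)
    then have "arcs_between s z y = 0"
      using z y bounds[OF k] out by (intro arcs_between_final(2)[of z]) auto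
    then show ?thesis using z arcs_between_cong(1)[of s s z t y y] by simp
  qed
qed

lemma entry_values:
  assumes k: "k < n" and x: "a k \<le> x" "x \<le> b k" and st: "separated s t"
    and s: "after k x s" and t: "after k x t"
  shows "s \<in> I k \<Longrightarrow> enters s t x = 0" "t \<in> I k \<Longrightarrow> enters s t x = 1"
proof -
  have out: "z - r \<notin> \<int>" if "a k \<le> z" "z \<le> b k" "r \<notin> I k" for z r
    using in_periodic_interval[OF that(1,2)] periodic_interval_cong[of z r] that(3) by blast
  show "enters s t x = 0" if "s \<in> I k"
  proof -
    obtain z where z: "z - s \<in> \<int>" "x \<le> z" "z \<le> b k" using s \<open>s \<in> I k\<close> by (auto simp: after_def)
    have "t \<notin> I k" using st \<open>s \<in> I k\<close> k by (auto simp: separated_def)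
    then have "enters z t x = 0"
      using z x bounds[OF k] out by (intro arcs_between_initial(1)[of x _ z]) auto
    then show ?thesis using z arcs_between_cong(2)[of z s t t x x] by simp
  qed
  show "enters s t x = 1" if "t \<in> I k"
  proof -
    obtain z where z: "z - t \<in> \<int>" "x \<le> z" "z \<le> b k" using t \<open>t \<in> I k\<close> by (auto simp: after_def)
    have "s \<notin> I k" using st \<open>t \<in> I k\<close> k by (auto simp: separated_def)
    then have "enters s z x = 1"
      using z x bounds[OF k] out by (intro arcs_between_final(1)[of x _ z]) auto
    then show ?thesis using z arcs_between_cong(2)[of s s z t x x] by simp
  qed
qed

text \<open>
  The value with which a path leaves a strand after its last passage depends only on the cells of the
  ends of the path; dually for \<open>enters_entry\<close>, the value with which it enters the strand.
\<close>

lemma arcs_between_exit: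
  assumes k: "k < n" and y: "a k \<le> y" "y \<le> b k" "a k \<le> y'" "y' \<le> b k"
    and st: "separated s t" and s: "same_cell s s'" and t: "same_cell t t'"
    and before: "before k y s" "before k y t" "before k y' s'" "before k y' t'"
  shows "arcs_between s t y = arcs_between s' t' y'"
proof -
  have st': "separated s' t'" using separated_sym separated_same_cell st s t by blast
  have yI: "y \<in> I k" "y' \<in> I k" using y in_periodic_interval by auto
  note exits = exit_values[OF k y(1,2) st before(1,2)] exit_values[OF k y(3,4) st' before(3,4)]
  consider "s \<in> I k" | "t \<in> I k" | "s \<notin> I k" "t \<notin> I k" by blast
  then show ?thesis
  proof cases
    case 1
    then show ?thesis using exits same_cell_I[OF s k] by simp
  next
    case 2
    then show ?thesis using exits same_cell_I[OF t k] by simp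
  next
    case 3
    then have "separated s y" "separated t y" using separated_I[OF k yI(1)] by auto
    moreover have "same_cell y y'" using yI k by (auto simp: same_cell_def)
    ultimately show ?thesis using st s t separated_sym by (intro arcs_between_same_cell) auto
  qed
qed

lemma enters_entry:
  assumes k: "k < n" and x: "a k \<le> x" "x \<le> b k" "a k \<le> x'" "x' \<le> b k"
    and st: "separated s t" and s: "same_cell s s'" and t: "same_cell t t'"
    and after: "after k x s" "after k x t" "after k x' s'" "after k x' t'"
  shows "enters s t x = enters s' t' x'"
proof -
  have st': "separated s' t'" using separated_sym separated_same_cell st s t by blast
  have xI: "x \<in> I k" "x' \<in> I k" using x in_periodic_interval by auto
  note entries = entry_values[OF k x(1,2) st after(1,2)] entry_values[OF k x(3,4) st' after(3,4)]
  consider "s \<in> I k" | "t \<in> I k" | "s \<notin> I k" "t \<notin> I k" by blast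
  then show ?thesis
  proof cases
    case 1
    then show ?thesis using entries same_cell_I[OF s k] by simp
  next
    case 2
    then show ?thesis using entries same_cell_I[OF t k] by simp
  next
    case 3
    then have sep: "separated s x" "separated t x" using separated_I[OF k xI(1)] by auto
    have "s' \<notin> I k" "t' \<notin> I k" using 3 same_cell_I[OF s k] same_cell_I[OF t k] by auto
    then have sep': "separated s' x'" "separated t' x'" using separated_I[OF k xI(2)] by auto
    have ints: "x - s \<notin> \<int>" "x - t \<notin> \<int>" "x' - s' \<notin> \<int>" "x' - t' \<notin> \<int>"
      using sep sep' separated_sym unfolding separated_def by blast+
    have "same_cell x x'" using xI k by (auto simp: same_cell_def)
    then have "arcs_between s t x = arcs_between s' t' x'"
      using sep st s t separated_sym by (intro arcs_between_same_cell) auto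
    then show ?thesis using ints by (simp add: enters_eq_arcs_between)
  qed
qed


section \<open>Comparison of two diagrams\<close>

text \<open>
  A crossing outside the disc of a local change, seen from both diagrams.
\<close>

definition outer :: "vdiagram \<Rightarrow> vdiagram \<Rightarrow> complex \<Rightarrow> bool" where
  "outer D D' u \<longleftrightarrow> u \<in> crossings D \<and> u \<in> crossings D' \<and> sw D' u = sw D u \<and> se D' u = se D u \<and>
     (\<forall>i<n. sw D u \<notin> I i \<and> se D u \<notin> I i)"

text \<open>
  The two passages of corresponding crossings lie on the same strands, or coincide if they are outside.
  So do the ends of the halves, which is all that the values of the halves outside the disc depend on.
\<close>

definition corresponding :: "vdiagram \<Rightarrow> vdiagram \<Rightarrow> complex \<Rightarrow> complex \<Rightarrow> bool" where
  "corresponding D D' u u' \<longleftrightarrow> u \<in> crossings D \<and> u' \<in> crossings D' \<and> separated (sw D u) (se D u) \<and>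
     same_cell (sw D u) (sw D' u') \<and> same_cell (se D u) (se D' u')"

definition agree_at :: "vdiagram \<Rightarrow> chain \<Rightarrow> vdiagram \<Rightarrow> chain \<Rightarrow> complex \<Rightarrow> bool" where
  "agree_at D C D' C' u \<longleftrightarrow> C' (sw D' u) = C (sw D u) \<and> C' (se D' u) = C (se D u) \<and>
     C' (arc_in D' (sw D' u)) = C (arc_in D (sw D u)) \<and> C' (arc_in D' (se D' u)) = C (arc_in D (se D u))"

lemma vertex_term_agree:
  "agree_at D C D' C' u \<Longrightarrow> agree_at D E D' E' u \<Longrightarrow> vertex_term D' u C' E' = vertex_term D u C E"
  by (simp add: agree_at_def vertex_term_def)

lemma outer_corresponding:
  assumes "diagram D" "outer D D' u"
  shows "corresponding D D' u u"
  using assms sw_se(7)[OF assms(1)] by (auto simp: outer_def corresponding_def same_cell_def separated_def)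

lemma agree_at_arcs_between:
  assumes D: "diagram D" "diagram D'" and u: "outer D D' u"
    and p: "s \<in> passages D" "t \<in> passages D" "s' \<in> passages D'" "t' \<in> passages D'"
    and st: "separated s t" "same_cell s s'" "same_cell t t'"
  shows "agree_at D (arcs_between s t) D' (arcs_between s' t') u"
proof -
  have "separated s' t'" using separated_sym separated_same_cell st by blast
  then have ne: "s \<noteq> t" "s' \<noteq> t'" using st(1) by (auto simp: separated_def)
  have u': "u \<in> crossings D" "u \<in> crossings D'" using u by (auto simp: outer_def)
  note pu = sw_se_passages[OF D(1) u'(1)] sw_se_passages[OF D(2) u'(2)]
  have out: "\<forall>i<n. sw D u \<notin> I i" "\<forall>i<n. se D u \<notin> I i" and eq: "sw D' u = sw D u" "se D' u = se D u"
    using u by (auto simp: outer_def)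
  show ?thesis unfolding agree_at_def
    using arcs_between_outside[OF st(1-3) out(1)] arcs_between_outside[OF st(1-3) out(2)] pu eq
    by (simp add: arcs_between_arc_in[OF D(1) p(1,2) ne(1)] arcs_between_arc_in[OF D(2) p(3,4) ne(2)])
qed

lemma agree_at_halves:
  assumes D: "diagram D" "diagram D'" and u: "outer D D' u" and v: "corresponding D D' v v'"
  shows "agree_at D (left_half D v) D' (left_half D' v') u"
    "agree_at D (right_half D v) D' (right_half D' v') u"
  unfolding left_half_def right_half_def
  using v sw_se_passages D separated_sym
  by (auto simp: corresponding_def intro!: agree_at_arcs_between[OF D u])

lemma agree_at_whole: "agree_at D whole D' whole u"
  by (simp add: agree_at_def whole_def)

text \<open>
  To compare two intersection numbers it suffices to compare the sums of the terms in the disc.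
\<close>

lemma intersection_agree:
  assumes "diagram D" "diagram D'" "N \<subseteq> crossings D" "N' \<subseteq> crossings D'"
    and "crossings D - N = crossings D' - N'"
    and "\<And>u. u \<in> crossings D - N \<Longrightarrow> agree_at D C D' C' u"
    and "\<And>u. u \<in> crossings D - N \<Longrightarrow> agree_at D E D' E' u"
    and "(\<Sum>u\<in>N'. vertex_term D' u C' E') = (\<Sum>u\<in>N. vertex_term D u C E)"
  shows "intersection D' C' E' = intersection D C E"
proof -
  have "(\<Sum>u\<in>crossings D' - N'. vertex_term D' u C' E') = (\<Sum>u\<in>crossings D - N. vertex_term D u C E)"
    using assms(5-7) vertex_term_agree by (intro sum.cong) auto
  then show ?thesis
    using assms(8) unfolding intersection_vertex_terms
    by (simp add: sum.subset_diff[OF assms(3) finite_crossings[OF assms(1)]]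
        sum.subset_diff[OF assms(4) finite_crossings[OF assms(2)]])
qed

text \<open>
  The case of a move which only adds crossings, and whose new terms vanish for all cycles: kinks
  and, without any new crossing, detours.
\<close>

lemma intersections_outer:
  assumes D: "diagram D" "diagram D'" and outer: "\<And>u. u \<in> crossings D \<Longrightarrow> outer D D' u"
    and N: "crossings D' = crossings D \<union> N" "crossings D \<inter> N = {}"
    and zero: "\<And>C E. cycle D' C \<Longrightarrow> cycle D' E \<Longrightarrow> (\<Sum>u\<in>N. vertex_term D' u C E) = 0"
    and uw: "u \<in> crossings D" "w \<in> crossings D"
  shows "left_right D' u w = left_right D u w" "index_parity D' u = index_parity D u"
proof -
  have *: "intersection D' C' E' = intersection D C E"
    if "cycle D' C'" "cycle D' E'" "\<And>u. u \<in> crossings D \<Longrightarrow> agree_at D C D' C' u"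
      "\<And>u. u \<in> crossings D \<Longrightarrow> agree_at D E D' E' u" for C C' E E'
    using that zero N by (intro intersection_agree[OF D, of "{}" N]) auto
  have u': "u \<in> crossings D'" "w \<in> crossings D'" using uw N by auto
  have ag: "agree_at D (left_half D z) D' (left_half D' z) q" "agree_at D (right_half D z) D' (right_half D' z) q"
    if "z \<in> crossings D" "q \<in> crossings D" for z q
    using agree_at_halves[OF D outer[OF that(2)] outer_corresponding[OF D(1) outer[OF that(1)]]] by auto
  show "left_right D' u w = left_right D u w"
    using u' uw ag by (intro * cycle_left_half cycle_right_half D) auto
  show "index_parity D' u = index_parity D u" unfolding index_parity_def
    using u' uw ag by (intro arg_cong[of _ _ uminus] * cycle_left_half cycle_whole agree_at_whole D) auto
qed

text \<open>
  A path whose ends are not on the strand runs through the whole strand or avoids it.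
\<close>

lemma enters_eq_arcs_between_in_cell:
  assumes k: "k < n" and xy: "x \<in> I k" "y \<in> I k" and st: "separated s t" "s \<notin> I k" "t \<notin> I k"
  shows "enters s t x = arcs_between s t y"
proof -
  have sep: "separated s x" "separated t x" using separated_I[OF k xy(1)] st by auto
  then have "enters s t x = arcs_between s t x"
    using separated_sym unfolding separated_def by (intro enters_eq_arcs_between) blast+
  also have "\<dots> = arcs_between s t y"
    using sep xy k by (intro arcs_between_move_in_cell) (auto simp: same_cell_def)
  finally show ?thesis .
qed

text \<open>
  The order of the two passages is left open, since it differs between the two sides of a third move.
\<close>

definition only_passages :: "vdiagram \<Rightarrow> (nat \<Rightarrow> real) \<Rightarrow> (nat \<Rightarrow> real) \<Rightarrow> bool" where
  "only_passages D P Q \<longleftrightarrow> (\<forall>k<n. a k \<le> P k \<and> P k \<le> b k \<and> a k \<le> Q k \<and> Q k \<le> b k \<and>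
     (\<forall>z. a k \<le> z \<and> z \<le> b k \<and> curve D z \<in> crossings D \<longrightarrow> z = P k \<or> z = Q k))"

lemma only_passages_before_after:
  assumes D: "diagram D" and only: "only_passages D P Q" and k: "k < n" and s: "s \<in> passages D"
    and xy: "{x, y} = {P k, Q k}" "x \<le> y"
  shows "before k y s" "after k x s"
proof -
  have *: "\<exists>z. z - s \<in> \<int> \<and> x \<le> z \<and> z \<le> y" if sI: "s \<in> I k"
  proof -
    obtain z where z: "z - s \<in> \<int>" "a k \<le> z" "z \<le> b k" using sI by (auto simp: periodic_interval_iff)
    then have "curve D z \<in> crossings D" using s curve_cong[OF D z(1)] by (simp add: passages_def)
    then have "z \<in> {P k, Q k}" using only k z by (auto simp: only_passages_def)
    then show ?thesis using z xy(2) unfolding xy(1)[symmetric] by auto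
  qed
  have "a k \<le> x" "y \<le> b k" using only k xy(1) by (auto simp: only_passages_def doubleton_eq_iff)
  then show "before k y s" "after k x s"
    unfolding before_def after_def using * by (meson order_trans)+
qed

text \<open>
  On all arcs except those between the two passages of a strand, each end of a path may be moved to the
  last passage of its strand. This reduces the relations to statements about cyclic orders of the strands.
\<close>

lemma arcs_between_last:
  assumes D: "diagram D" and only: "only_passages D x y" and xy: "\<And>k. k < n \<Longrightarrow> x k \<le> y k"
    and ij: "i < n" "j < n" "i \<noteq> j" and s: "s - x i \<in> \<int> \<or> s - y i \<in> \<int>" and t: "t - x j \<in> \<int> \<or> t - y j \<in> \<int>"
    and r: "r \<in> passages D" "\<And>k. k < n \<Longrightarrow> r \<noteq> frac (x k)"
  shows "arcs_between s t r = arcs_between (y i) (y j) r"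
proof -
  have mem: "x k \<in> I k" "y k \<in> I k" and bd: "a k \<le> x k" "x k \<le> b k" "a k \<le> y k" "y k \<le> b k" if "k < n" for k
    using only that in_periodic_interval by (auto simp: only_passages_def)
  have sI: "s \<in> I i" and tI: "t \<in> I j"
    using s t mem ij periodic_interval_cong by blast+
  have "t \<notin> I i" using disjoint[OF ij(1,2) _ tI] ij(3) by blast
  then have st: "separated s t" using separated_I[OF ij(1) sI] separated_sym by blast
  have cell: "same_cell s (y i)" "same_cell t (y j)" using sI tI mem ij by (auto simp: same_cell_def)
  show ?thesis
  proof (cases "\<exists>k<n. r \<in> I k")
    case False
    then show ?thesis by (intro arcs_between_outside(1)[OF st cell]) blast
  next
    case True
    then obtain k where k: "k < n" "r \<in> I k" by blast
    then obtain z where z: "z - r \<in> \<int>" "a k \<le> z" "z \<le> b k" by (auto simp: periodic_interval_iff)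
    then have "curve D z \<in> crossings D" using r(1) curve_cong[OF D z(1)] by (simp add: passages_def)
    then have "z = x k \<or> z = y k" using only k z by (auto simp: only_passages_def)
    moreover have "z \<noteq> x k" using r(2)[OF k(1)] frac_cong[OF z(1)] passage_frac[OF r(1)] by auto
    ultimately have zy: "z = y k" by blast
    have before: "before k (y k) q" if q: "q - x l \<in> \<int> \<or> q - y l \<in> \<int>" "l < n" for q l
      unfolding before_def
    proof
      assume "q \<in> I k"
      moreover have "q \<in> I l" using q mem[OF q(2)] periodic_interval_cong by blast
      ultimately have "l = k" using disjoint q(2) k(1) by blast
      then have "x k - q \<in> \<int> \<or> y k - q \<in> \<int>" using q(1) Ints_diff_sym by blast
      then show "\<exists>z. z - q \<in> \<int> \<and> a k \<le> z \<and> z \<le> y k" using bd[OF k(1)] xy[OF k(1)] by blast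
    qed
    have "arcs_between s t (y k) = arcs_between (y i) (y j) (y k)"
      using bd[OF k(1)] ij by (intro arcs_between_exit[OF k(1) _ _ _ _ st cell] before[OF s] before[OF t]
        before[of "y i" i] before[of "y j" j]) auto
    then show ?thesis
      using z zy arcs_between_cong(1)[of s s t t "y k" r] arcs_between_cong(1)[of "y i" "y i" "y j" "y j" "y k" r] by simp
  qed
qed

end

text \<open>
  If \<open>sw\<close> comes first, the right half is the loop itself. If \<open>se\<close> comes first, the left half is the loop, and
  the right half minus the whole cycle is minus the loop.
\<close>

lemma kink_relation:
  assumes D: "diagram D" and k: "kink D v x y" and E: "cycle D E"
  shows "intersection D (relation_chain D {v} (\<lambda>_. 1) id (if se D v = frac x then 1 else 0)) E = 0"
proof (rule intersection_supported_kink[OF D k _ E])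
  note p = kink_passages[OF D k]
  show "cycle D (relation_chain D {v} (\<lambda>_. 1) id (if se D v = frac x then 1 else 0))"
    using p(1) by (intro cycle_relation_chain D) auto
  have con: "consecutive D x y" "x - y \<notin> \<int>" using k by (auto simp: kink_def)
  then have "frac x \<noteq> frac y" by (auto elim!: frac_eqE)
  have fr: "arcs_between (frac s) (frac t) z = arcs_between s t z" for s t z
    by (rule arcs_between_cong; simp add: frac_def)
  have "relation_chain D {v} (\<lambda>_. 1) id (if se D v = frac x then 1 else 0) t
      = (if se D v = frac x then - 1 else 1) * arcs_between x y t" for t
    using p(3)
  proof
    assume "sw D v = frac x \<and> se D v = frac y"
    then show ?thesis
      using \<open>frac x \<noteq> frac y\<close> by (simp add: relation_chain_def right_half_def fr)
  next
    assume "sw D v = frac y \<and> se D v = frac x"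
    then show ?thesis
      using arcs_between_complement(1)[OF con(2), of t]
      by (simp add: relation_chain_def right_half_def whole_def fr)
  qed
  then show "supported_on D {frac x} (relation_chain D {v} (\<lambda>_. 1) id (if se D v = frac x then 1 else 0))"
    using arcs_between_consecutive[OF D con] by (simp add: supported_on_def)
qed


section \<open>The bigon of a second move\<close>

text \<open>
  The strand \<open>l\<close> contains the passages \<open>sw\<close> of \<open>v\<^sub>1\<close> and \<open>se\<close> of \<open>v\<^sub>2\<close>.
\<close>

locale bigon_move = strands 2 a b for a b +
  fixes D D' :: vdiagram and x y :: "nat \<Rightarrow> real" and l m :: nat and v\<^sub>1 v\<^sub>2 :: complex
  assumes D: "diagram D" and D': "diagram D'" and lm: "{l, m} = {0, 1}"
    and B: "bigon D' v\<^sub>1 v\<^sub>2 (x l) (y l) (x m) (y m)"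
    and only: "only_passages D' x y"
    and outer: "u \<in> crossings D \<Longrightarrow> outer D D' u"
    and rest: "crossings D' = crossings D \<union> {v\<^sub>1, v\<^sub>2}" "v\<^sub>1 \<notin> crossings D" "v\<^sub>2 \<notin> crossings D"
begin

lemma l_m_less: "l < 2" "m < 2" "l \<noteq> m"
  using lm by (auto simp: doubleton_eq_iff)

lemma consecutive_pairs: "consecutive D' (x k) (y k)" if "k < 2"
proof -
  have "k \<in> {l, m}" unfolding lm using that by auto
  then show ?thesis using B by (auto simp: bigon_def)
qed

text \<open>
  The ends of a half at a surviving crossing are outside the two strands, so that the half enters and
  leaves the bigon with equal values along each of them.
\<close>

lemma half_constant:
  assumes u: "u \<in> crossings D" and k: "k < 2" and st: "{s, t} = {sw D' u, se D' u}"
  shows "arcs_between s t (arc_in D' (frac (x k))) = arcs_between s t (frac (y k))"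
proof -
  have o: "u \<in> crossings D'" "sw D' u \<notin> I k" "se D' u \<notin> I k"
    using outer[OF u] k by (auto simp: outer_def)
  moreover have "sw D' u - se D' u \<notin> \<int>" "se D' u - sw D' u \<notin> \<int>"
    using sw_se(7)[OF D' o(1)] Ints_diff_sym by blast+
  ultimately have st': "s \<notin> I k" "t \<notin> I k" "s \<in> passages D'" "t \<in> passages D'" "s - t \<notin> \<int>"
    using st sw_se_passages[OF D'] by (auto simp: doubleton_eq_iff)
  moreover have "\<forall>i<2. s \<notin> I i \<and> t \<notin> I i"
    using outer[OF u] st by (auto simp: outer_def doubleton_eq_iff)
  ultimately have sep: "separated s t" "s \<noteq> t" by (auto simp: separated_def)
  have xy: "x k \<in> I k" "y k \<in> I k" using only k by (auto simp: only_passages_def intro: in_periodic_interval)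
  have fr: "arcs_between s t (frac z) = arcs_between s t z" "enters s t (frac z) = enters s t z" for z
    by (rule arcs_between_cong; simp add: frac_def)+
  have "frac (x k) \<in> passages D'" using consecutive_pairs[OF k] by (auto simp: consecutive_def intro: frac_passage[OF D'])
  then show ?thesis
    using enters_eq_arcs_between_in_cell[OF k xy sep(1) st'(1,2)]
    by (simp add: arcs_between_arc_in[OF D' st'(3,4) sep(2)] fr)
qed

text \<open>
  The cycle \<open>C\<close> continues to \<open>C'\<close> straight through the new crossings.
\<close>

definition related :: "chain \<Rightarrow> chain \<Rightarrow> bool" where
  "related C C' \<longleftrightarrow> (\<forall>u\<in>crossings D. agree_at D C D' C' u) \<and>
     (\<forall>k<2. C' (arc_in D' (frac (x k))) = C' (frac (y k)))"

lemma intersection_related: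
  assumes "related C C'" "related E E'"
  shows "intersection D' C' E' = intersection D C E"
proof (rule intersection_agree[OF D D', of "{}" "{v\<^sub>1, v\<^sub>2}"])
  have "v\<^sub>1 \<noteq> v\<^sub>2" using B by (simp add: bigon_def)
  then show "(\<Sum>u\<in>{v\<^sub>1, v\<^sub>2}. vertex_term D' u C' E') = (\<Sum>u\<in>{}. vertex_term D u C E)"
    using vertex_terms_bigon[OF D' B, of C' E'] assms l_m_less by (simp add: related_def)
qed (use assms rest in \<open>auto simp: related_def\<close>)

lemma related_whole: "related whole whole"
  by (simp add: related_def agree_at_whole) (simp add: whole_def)

lemma related_halves:
  assumes "u \<in> crossings D"
  shows "related (left_half D u) (left_half D' u)" "related (right_half D u) (right_half D' u)"
proof -
  have "left_half D' u (arc_in D' (frac (x k))) = left_half D' u (frac (y k))"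
    "right_half D' u (arc_in D' (frac (x k))) = right_half D' u (frac (y k))" if "k < 2" for k
    unfolding left_half_def right_half_def using that by (intro half_constant[OF assms]; auto)+
  then show "related (left_half D u) (left_half D' u)" "related (right_half D u) (right_half D' u)"
    using agree_at_halves[OF D D' outer outer_corresponding[OF D outer[OF assms]]]
    by (auto simp: related_def)
qed

theorem intersections_unchanged:
  assumes "u \<in> crossings D" "w \<in> crossings D"
  shows "left_right D' u w = left_right D u w" "index_parity D' u = index_parity D u"
  using related_halves[OF assms(1)] related_halves[OF assms(2)] related_whole intersection_related
  by (simp_all add: index_parity_def)

text \<open>
  Off the sides of the bigon, the right half of \<open>v\<^sub>1\<close> runs from the strand \<open>l\<close> to the strand \<open>m\<close>, and the right half of
  \<open>v\<^sub>2\<close> back from \<open>m\<close> to \<open>l\<close>. Together they run once around the circle.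
\<close>

theorem bigon_relation:
  assumes E: "cycle D' E"
  shows "intersection D' (relation_chain D' {v\<^sub>1, v\<^sub>2} (\<lambda>_. 1) id 1) E = 0"
proof (rule intersection_supported_bigon[OF D' B _ E])
  have v: "v\<^sub>1 \<in> crossings D'" "v\<^sub>2 \<in> crossings D'" "v\<^sub>1 \<noteq> v\<^sub>2" using B by (auto simp: bigon_def)
  then show "cycle D' (relation_chain D' {v\<^sub>1, v\<^sub>2} (\<lambda>_. 1) id 1)"
    by (intro cycle_relation_chain D') auto
  show "supported_on D' {frac (x l), frac (x m)} (relation_chain D' {v\<^sub>1, v\<^sub>2} (\<lambda>_. 1) id 1)"
    unfolding supported_on_def
  proof
    fix t assume t: "t \<in> passages D' - {frac (x l), frac (x m)}"
    have fr: "frac z - z \<in> \<int>" for z :: real by (simp add: frac_def)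
    have mem: "sw D' v\<^sub>1 - x l \<in> \<int> \<or> sw D' v\<^sub>1 - y l \<in> \<int>" "se D' v\<^sub>2 - x l \<in> \<int> \<or> se D' v\<^sub>2 - y l \<in> \<int>"
      "se D' v\<^sub>1 - x m \<in> \<int> \<or> se D' v\<^sub>1 - y m \<in> \<int>" "sw D' v\<^sub>2 - x m \<in> \<int> \<or> sw D' v\<^sub>2 - y m \<in> \<int>"
      using B fr by (auto simp: bigon_def doubleton_eq_iff)
    have xy: "x k \<le> y k" if "k < 2" for k using consecutive_pairs[OF that] by (simp add: consecutive_def)
    have nx: "t \<noteq> frac (x k)" if "k < 2" for k
    proof -
      have "k \<in> {l, m}" unfolding lm using that by auto
      then show ?thesis using t by auto
    qed
    have "right_half D' v\<^sub>1 t = arcs_between (y l) (y m) t"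
      unfolding right_half_def
      using t nx by (intro arcs_between_last[OF D' only xy l_m_less mem(1,3)]) auto
    moreover have "right_half D' v\<^sub>2 t = arcs_between (y m) (y l) t"
      unfolding right_half_def
      using t nx by (intro arcs_between_last[OF D' only xy l_m_less(2,1) _ mem(4,2)]) (use l_m_less in auto)
    moreover have "y l - y m \<notin> \<int>"
    proof
      assume "y l - y m \<in> \<int>"
      moreover have "y l \<in> I l" "y m \<in> I m"
        using only l_m_less by (auto simp: only_passages_def intro: in_periodic_interval)
      ultimately show False using disjoint[OF l_m_less(1,2), of "y m"] periodic_interval_cong l_m_less(3) by blast
    qed
    ultimately show "relation_chain D' {v\<^sub>1, v\<^sub>2} (\<lambda>_. 1) id 1 t = 0"
      using v arcs_between_complement(1)[of "y l" "y m" t] by (simp add: relation_chain_def whole_def)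
  qed
qed

end


section \<open>The triangle of a third move\<close>

text \<open>
  Both sides of a third move carry a triangle with the same corners in the combinatorial sense, and
  with all strands reversed.
\<close>

locale triangle_move = strands 3 a b for a b +
  fixes D D' :: vdiagram and e :: "nat \<Rightarrow> bool" and P Q P' Q' :: "nat \<Rightarrow> real" and v v' :: "nat \<Rightarrow> complex"
  assumes D: "diagram D" and D': "diagram D'"
    and T: "triangle D e P Q v" and T': "triangle D' (\<lambda>i. \<not> e i) P' Q' v'"
    and only: "only_passages D P Q" "only_passages D' P' Q'"
    and outer: "u \<in> crossings D - v ` {..<3} \<Longrightarrow> outer D D' u"
    and rest: "crossings D - v ` {..<3} = crossings D' - v' ` {..<3}"
begin

lemma entry_exit_arcs_between:
  assumes k: "k < 3"
    and p: "s \<in> passages D" "t \<in> passages D" "s' \<in> passages D'" "t' \<in> passages D'"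
    and st: "separated s t" "same_cell s s'" "same_cell t t'"
  shows "entry D' (\<lambda>i. \<not> e i) P' Q' (arcs_between s' t') k = entry D e P Q (arcs_between s t) k"
    "exit (\<lambda>i. \<not> e i) P' Q' (arcs_between s' t') k = exit e P Q (arcs_between s t) k"
proof -
  define x y where "x = (if e k then Q k else P k)" and "y = (if e k then P k else Q k)"
  define x' y' where "x' = (if \<not> e k then Q' k else P' k)" and "y' = (if \<not> e k then P' k else Q' k)"
  have con: "consecutive D x y" "consecutive D' x' y'"
    using triangleD(2)[OF T k] triangleD(2)[OF T' k] by (simp_all only: x_def y_def x'_def y'_def)
  then have xy: "{x, y} = {P k, Q k}" "x \<le> y" "{x', y'} = {P' k, Q' k}" "x' \<le> y'"
    by (auto simp: x_def y_def x'_def y'_def consecutive_def)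
  have bd: "a k \<le> x" "x \<le> b k" "a k \<le> y" "y \<le> b k" "a k \<le> x'" "x' \<le> b k" "a k \<le> y'" "y' \<le> b k"
    using only k by (auto simp: only_passages_def x_def y_def x'_def y'_def)
  have pas: "frac x \<in> passages D" "frac x' \<in> passages D'"
    using con D D' by (auto simp: consecutive_def intro: frac_passage)
  have "separated s' t'" using separated_sym separated_same_cell st by blast
  then have ne: "s \<noteq> t" "s' \<noteq> t'" using st(1) by (auto simp: separated_def)
  have fr: "arcs_between s t (frac z) = arcs_between s t z" "enters s t (frac z) = enters s t z" for s t z
    by (rule arcs_between_cong; simp add: frac_def)+
  have "enters s' t' x' = enters s t x"
    using only_passages_before_after(2)[OF D only(1) k _ xy(1,2)] only_passages_before_after(2)[OF D' only(2) k _ xy(3,4)]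
    by (intro enters_entry[symmetric, OF k bd(1,2,5,6) st]) (use p in auto)
  then have "arcs_between s' t' (arc_in D' (frac x')) = arcs_between s t (arc_in D (frac x))"
    by (simp add: arcs_between_arc_in[OF D p(1,2) ne(1) pas(1)] arcs_between_arc_in[OF D' p(3,4) ne(2) pas(2)] fr)
  then show "entry D' (\<lambda>i. \<not> e i) P' Q' (arcs_between s' t') k = entry D e P Q (arcs_between s t) k"
    by (simp only: entry_def x_def x'_def)
  have "arcs_between s' t' y' = arcs_between s t y"
    using only_passages_before_after(1)[OF D only(1) k _ xy(1,2)] only_passages_before_after(1)[OF D' only(2) k _ xy(3,4)]
    by (intro arcs_between_exit[symmetric, OF k bd(3,4,7,8) st]) (use p in auto)
  then have "arcs_between s' t' (frac y') = arcs_between s t (frac y)" by (simp only: fr)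
  then show "exit (\<lambda>i. \<not> e i) P' Q' (arcs_between s' t') k = exit e P Q (arcs_between s t) k"
    by (simp only: exit_def y_def y'_def)
qed

text \<open>
  \<open>C\<close> and \<open>C'\<close> agree outside the disc and on its boundary.
\<close>

definition related :: "chain \<Rightarrow> chain \<Rightarrow> bool" where
  "related C C' \<longleftrightarrow> cycle D C \<and> cycle D' C' \<and> (\<forall>u\<in>crossings D - v ` {..<3}. agree_at D C D' C' u) \<and>
     (\<forall>k<3. entry D' (\<lambda>i. \<not> e i) P' Q' C' k = entry D e P Q C k \<and>
        exit (\<lambda>i. \<not> e i) P' Q' C' k = exit e P Q C k)"

lemma intersection_related:
  assumes "related C C'" "related E E'"
  shows "intersection D' C' E' = intersection D C E"
proof (rule intersection_agree[OF D D' _ _ rest])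
  have "(\<Sum>i<3. vertex_term D' (v' i) C' E') = (\<Sum>i<3. vertex_term D (v i) C E)"
    using assms by (intro vertex_terms_triangle_reverse[OF D T _ _ D' T']) (auto simp: related_def)
  then show "(\<Sum>u\<in>v' ` {..<3}. vertex_term D' u C' E') = (\<Sum>u\<in>v ` {..<3}. vertex_term D u C E)"
    using T T' by (simp add: sum.reindex triangle_def)
  show "v ` {..<3} \<subseteq> crossings D" "v' ` {..<3} \<subseteq> crossings D'"
    using triangleD(1)[OF T] triangleD(1)[OF T'] by auto
qed (use assms in \<open>auto simp: related_def\<close>)

lemma related_whole: "related whole whole"
  by (simp add: related_def cycle_whole agree_at_whole entry_def exit_def) (simp add: whole_def)

lemma related_halves:
  assumes c: "corresponding D D' u u'"
  shows "related (left_half D u) (left_half D' u')" "related (right_half D u) (right_half D' u')"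
proof -
  have u: "u \<in> crossings D" "u' \<in> crossings D'" and st: "separated (sw D u) (se D u)"
    "same_cell (sw D u) (sw D' u')" "same_cell (se D u) (se D' u')"
    using c by (auto simp: corresponding_def)
  note p = sw_se_passages[OF D u(1)] sw_se_passages[OF D' u(2)]
  show "related (left_half D u) (left_half D' u')"
    unfolding related_def
    using cycle_left_half[OF D u(1)] cycle_left_half[OF D' u(2)] agree_at_halves(1)[OF D D' outer c]
      entry_exit_arcs_between[OF _ p(2,1,4,3) separated_sym[OF st(1)] st(3,2)]
    by (simp add: left_half_def)
  show "related (right_half D u) (right_half D' u')"
    unfolding related_def
    using cycle_right_half[OF D u(1)] cycle_right_half[OF D' u(2)] agree_at_halves(2)[OF D D' outer c]
      entry_exit_arcs_between[OF _ p st]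
    by (simp add: right_half_def)
qed

lemma corresponding_corner:
  assumes i: "i < 3"
  shows "corresponding D D' (v i) (v' i)"
proof -
  have n: "nxt i < 3" "nxt i \<noteq> i" using i by (auto elim!: less_3_cases)
  have fr: "frac z - z \<in> \<int>" for z :: real by (simp add: frac_def)
  have mem: "frac (P i) \<in> I i" "frac (P' i) \<in> I i" "frac (Q (nxt i)) \<in> I (nxt i)" "frac (Q' (nxt i)) \<in> I (nxt i)"
    using only i n periodic_interval_cong[OF fr] by (auto simp: only_passages_def intro!: in_periodic_interval)
  have "sw D (v i) - se D (v i) \<notin> \<int>" by (rule sw_se(7)[OF D triangleD(1)[OF T i]])
  then show ?thesis
    unfolding corresponding_def separated_def same_cell_def
    using triangleD(1,5,6)[OF T i] triangleD(1,5,6)[OF T' i] mem i n disjoint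
    by (cases "e i = e (nxt i)") (simp; metis)+
qed

text \<open>
  The correspondence of crossings of the move as a total function.
\<close>

definition carry :: "complex \<Rightarrow> complex" where
  "carry u = (if u \<in> v ` {..<3} then v' (the_inv_into {..<3} v u) else u)"

lemma corresponding_carry:
  assumes "u \<in> crossings D"
  shows "corresponding D D' u (carry u)"
proof (cases "u \<in> v ` {..<3}")
  case True
  then obtain i where "i < 3" "u = v i" by auto
  then show ?thesis
    using T corresponding_corner by (simp add: carry_def the_inv_into_f_f triangle_def)
next
  case False
  then show ?thesis using assms outer outer_corresponding[OF D] by (simp add: carry_def)
qed

theorem intersections_carry:
  assumes "u \<in> crossings D" "w \<in> crossings D"
  shows "left_right D' (carry u) (carry w) = left_right D u w" "index_parity D' (carry u) = index_parity D u"
  using related_halves[OF corresponding_carry[OF assms(1)]] related_halves[OF corresponding_carry[OF assms(2)]]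
    related_whole intersection_related by (simp_all add: index_parity_def)

abbreviation "first i \<equiv> (if e i then Q i else P i)"
abbreviation "second i \<equiv> (if e i then P i else Q i)"

lemma only_first_second: "only_passages D first second"
  using only(1) unfolding only_passages_def by auto

lemma first_less_second: "i < 3 \<Longrightarrow> first i < second i"
  using triangleD(2)[OF T] unfolding consecutive_def by blast

lemma first_second_in: "i < 3 \<Longrightarrow> first i \<in> I i" "i < 3 \<Longrightarrow> second i \<in> I i"
  using only_first_second unfolding only_passages_def by (blast intro: in_periodic_interval)+

lemma frac_in_iff: "frac z \<in> I i \<longleftrightarrow> z \<in> I i"
  by (rule periodic_interval_cong) (simp add: frac_def)

lemma second_neq_first:
  assumes "i < 3" "j < 3"
  shows "frac (second i) \<noteq> frac (first j)"
proof
  assume eq: "frac (second i) = frac (first j)"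
  have "i = j" using disjoint[OF assms, of "frac (second i)"] first_second_in(2)[OF assms(1)]
      first_second_in(1)[OF assms(2)] unfolding frac_in_iff eq[symmetric] using eq frac_in_iff by metis
  then have eq: "frac (second i) = frac (first i)" using eq by simp
  have "a i \<le> first i" "second i \<le> b i" using only_first_second assms(1) unfolding only_passages_def by blast+
  then have "second i < first i + 1" using bounds(2)[OF assms(1)] by linarith
  moreover obtain z where "second i = first i + of_int z" using eq by (rule frac_eqE)
  ultimately show False using first_less_second[OF assms(1)] by auto
qed

text \<open>
  A side runs from the first to the second passage of a strand, and it is named by its initial passage.
\<close>

lemma sides_eq: "sides D a b = {frac (first i) | i. i < 3}"
proof (intro equalityI subsetI)
  fix r assume "r \<in> sides D a b"
  then obtain i s t where *: "r = frac s" "i < 3" "a i \<le> s" "s < t" "t \<le> b i" "curve D s \<in> crossings D" "curve D t \<in> crossings D"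
    unfolding sides_def by blast
  then have "s = first i \<or> s = second i" "t = first i \<or> t = second i"
    using only_first_second unfolding only_passages_def by (meson less_imp_le order_trans)+
  then have "s = first i" using * first_less_second[OF *(2)] by linarith
  then show "r \<in> {frac (first i) | i. i < 3}" using * by blast
next
  fix r assume "r \<in> {frac (first i) | i. i < 3}"
  then obtain i where i: "r = frac (first i)" "i < 3" by blast
  have "a i \<le> first i" "second i \<le> b i" using only_first_second i(2) unfolding only_passages_def by blast+
  moreover have "curve D (first i) \<in> crossings D" "curve D (second i) \<in> crossings D"
    using triangleD(2)[OF T i(2)] unfolding consecutive_def by blast+
  ultimately show "r \<in> sides D a b"
    using i first_less_second[OF i(2)] unfolding sides_def by blast
qed

lemma first_passage: "i < 3 \<Longrightarrow> frac (first i) \<in> passages D"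
  and second_passage: "i < 3 \<Longrightarrow> frac (second i) \<in> passages D"
  using triangleD(2)[OF T] unfolding consecutive_def by (blast intro: frac_passage[OF D])+

lemma arc_in_second: "i < 3 \<Longrightarrow> arc_in D (frac (second i)) = frac (first i)"
  by (rule arc_in_consecutive[OF D triangleD(2)[OF T]])

text \<open>
  The side of a strand leaves its first and arrives at its second passage; the other two arcs there are
  not sides, since \<open>arc_in\<close> is injective.
\<close>

lemma side_iff:
  assumes "i < 3"
  shows "frac (first i) \<in> sides D a b" "frac (second i) \<notin> sides D a b"
    "arc_in D (frac (second i)) \<in> sides D a b" "arc_in D (frac (first i)) \<notin> sides D a b"
proof -
  show 1: "frac (first i) \<in> sides D a b" unfolding sides_eq using assms by blast
  show "frac (second i) \<notin> sides D a b" unfolding sides_eq using second_neq_first[OF assms] by blast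
  show "arc_in D (frac (second i)) \<in> sides D a b" unfolding arc_in_second[OF assms] by (rule 1)
  show "arc_in D (frac (first i)) \<notin> sides D a b"
  proof
    assume "arc_in D (frac (first i)) \<in> sides D a b"
    then obtain j where j: "j < 3" "arc_in D (frac (first i)) = frac (first j)" unfolding sides_eq by blast
    then have "arc_in D (frac (first i)) = arc_in D (frac (second j))" using arc_in_second by simp
    then have "frac (first i) = frac (second j)"
      using arc_in_inj[OF D first_passage[OF assms] second_passage[OF j(1)]] by blast
    then show False using second_neq_first[OF j(1) assms] by simp
  qed
qed

text \<open>
  The triangle lies to the left or right of a corner iff one of the two sides there arrives and the other
  one leaves, that is, iff the two strands run around the triangle in the same sense.
\<close>

lemma corner_sign_eq:
  assumes i: "i < 3"
  shows "corner_sign D (sides D a b) (v i) = (if e i = e (nxt i) then 1 else - 1)"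
proof -
  have n: "nxt i < 3" using i by (auto elim!: less_3_cases)
  show ?thesis
    using side_iff[OF i] side_iff[OF n] triangleD(5,6)[OF T i]
    by (cases "e i"; cases "e (nxt i)") (simp_all add: corner_sign_def)
qed

abbreviation "eps i \<equiv> corner_sign D (sides D a b) (v i)"

text \<open>
  A positive corner contributes the path from the strand \<open>i\<close> to the strand \<open>i + 1\<close>. A negative one contributes
  minus the path from \<open>i + 1\<close> to \<open>i\<close>, which is the path from \<open>i\<close> to \<open>i + 1\<close> minus the whole cycle. So up to a constant
  the sum is a closed sequence of three paths, which covers all arcs off the sides equally often.
\<close>

lemma ex_coefficient: "\<exists>k. \<forall>t\<in>passages D - sides D a b. (\<Sum>i<3. eps i * right_half D (v i) t) = k"
proof -
  \<comment> \<open>off the sides, all paths may be taken between the last passages of the strands\<close>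
  define Y where "Y = (\<lambda>i. second i)"
  have inc: "Y i - Y j \<notin> \<int>" if "i < 3" "j < 3" "i \<noteq> j" for i j
  proof
    assume "Y i - Y j \<in> \<int>"
    then have "Y j \<in> I i" using first_second_in(2)[OF that(1)] periodic_interval_cong unfolding Y_def by blast
    then show False using disjoint[OF that(1,2)] first_second_in(2)[OF that(2)] that(3) unfolding Y_def by blast
  qed
  obtain k where k: "\<And>t. arcs_between (Y 0) (Y 1) t + arcs_between (Y 1) (Y 2) t + arcs_between (Y 2) (Y 0) t = k"
    using arcs_between_cycle[of "Y 0" "Y 1" "Y 2"] inc[of 0 1] inc[of 1 2] inc[of 2 0] by auto
  have term_eq: "eps i * right_half D (v i) t = arcs_between (Y i) (Y (nxt i)) t - (if e i = e (nxt i) then 0 else 1)"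
    if t: "t \<in> passages D - sides D a b" and i: "i < 3" for t i
  proof -
    have n: "nxt i < 3" "i \<noteq> nxt i" using i by (auto elim!: less_3_cases)
    have nf: "t \<noteq> frac (first j)" if "j < 3" for j using t side_iff(1)[OF that] by auto
    have le: "first j \<le> second j" if "j < 3" for j using first_less_second[OF that] by simp
    have fr: "frac z - z \<in> \<int>" for z :: real by (simp add: frac_def)
    have PQ: "frac (P i) - first i \<in> \<int> \<or> frac (P i) - second i \<in> \<int>"
        "frac (Q (nxt i)) - first (nxt i) \<in> \<int> \<or> frac (Q (nxt i)) - second (nxt i) \<in> \<int>"
      using fr by auto
    have *: "arcs_between (frac (P i)) (frac (Q (nxt i))) t = arcs_between (Y i) (Y (nxt i)) t"
      unfolding Y_def using t nf by (intro arcs_between_last[OF D only_first_second le i n PQ]) auto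
    have "sw D (v i) - se D (v i) \<notin> \<int>" by (rule sw_se(7)[OF D triangleD(1)[OF T i]])
    then have "frac (P i) - frac (Q (nxt i)) \<notin> \<int>"
      using triangleD(5,6)[OF T i] Ints_diff_sym by (auto split: if_splits)
    from arcs_between_complement(1)[OF this, of t] show ?thesis
      using * triangleD(5,6)[OF T i] corner_sign_eq[OF i] by (auto simp: right_half_def)
  qed
  show ?thesis
  proof (intro exI ballI)
    fix t assume t: "t \<in> passages D - sides D a b"
    show "(\<Sum>i<3. eps i * right_half D (v i) t) = k - (\<Sum>i<3. if e i = e (nxt i) then 0 else 1)"
      using term_eq[OF t, of 0] term_eq[OF t, of 1] term_eq[OF t, of 2] k[of t]
      by (simp only: sum_less_3 nxt_simps)
  qed
qed

text \<open>
  The arc leaving a second passage is not a side, so \<open>k(f)\<close> is determined.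
\<close>

lemma coefficient:
  assumes "t \<in> passages D - sides D a b"
  shows "(\<Sum>i<3. eps i * right_half D (v i) t) = r3_coefficient D a b v"
proof -
  obtain k where k: "\<And>t. t \<in> passages D - sides D a b \<Longrightarrow> (\<Sum>i<3. eps i * right_half D (v i) t) = k"
    using ex_coefficient by blast
  have "frac (second 0) \<in> passages D - sides D a b" using second_passage[of 0] side_iff(2)[of 0] by simp
  then have "r3_coefficient D a b v = k"
    unfolding r3_coefficient_def
  proof (intro the_equality ballI)
    fix j assume "\<forall>t\<in>passages D - sides D a b. (\<Sum>i<3. eps i * right_half D (v i) t) = j"
    then have "(\<Sum>i<3. eps i * right_half D (v i) (frac (second 0))) = j"
      using \<open>frac (second 0) \<in> passages D - sides D a b\<close> by (rule bspec)
    then show "j = k" using k[OF \<open>frac (second 0) \<in> passages D - sides D a b\<close>] by (rule trans[OF sym])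
  qed (rule k)
  then show ?thesis using k assms by simp
qed

theorem triangle_relation:
  assumes E: "cycle D E"
  shows "intersection D (relation_chain D {..<3} eps v (r3_coefficient D a b v)) E = 0"
proof (rule intersection_supported_triangle[OF D T _ E])
  show "cycle D (relation_chain D {..<3} eps v (r3_coefficient D a b v))"
    using triangleD(1)[OF T] by (intro cycle_relation_chain D) auto
  show "supported_on D {frac (first i) | i. i < 3} (relation_chain D {..<3} eps v (r3_coefficient D a b v))"
    using coefficient by (simp add: supported_on_def relation_chain_def whole_def flip: sides_eq)
qed (rule second_neq_first)

end


section \<open>Detour moves\<close>

lemma tangent_eq_on_open:
  assumes "open U" "s \<in> U" "\<And>t. t \<in> U \<Longrightarrow> curve D' t = curve D t" "diagram D" "diagram D'"
  shows "tangent D' s = tangent D s"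
proof -
  have "(curve D has_vector_derivative tangent D' s) (at s)"
    using has_tangent[OF assms(5), of s]
    by (rule has_vector_derivative_transform_within_open[OF _ assms(1,2)]) (rule assms(3))
  then show ?thesis using has_tangent[OF assms(4), of s] by (rule vector_derivative_unique_at)
qed

text \<open>
  The tangents at a passage are known only if the curves agree in a neighbourhood.
\<close>

lemma sw_se_unchanged:
  assumes D: "diagram D" "diagram D'" and u: "u \<in> crossings D"
    and U: "open U" "sw D u \<in> U" "se D u \<in> U" "\<And>t. t \<in> U \<Longrightarrow> curve D' t = curve D t"
  shows "sw D' u = sw D u" "se D' u = se D u"
proof -
  note s = sw_se[OF D(1) u]
  have "curve D' (sw D u) = u" "curve D' (se D u) = u" using U s by auto
  moreover have "cross (tangent D' (sw D u)) (tangent D' (se D u)) > 0"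
    using s tangent_eq_on_open[OF U(1) _ U(4) D] U by simp
  ultimately have "sw D' u = frac (sw D u)" "se D' u = frac (se D u)"
    using sw_se_eqI[OF D(2)] by blast+
  then show "sw D' u = sw D u" "se D' u = se D u"
    using passage_frac sw_se_passages[OF D(1) u] by auto
qed

text \<open>
  If \<open>t\<close> is outside, it is congruent to a parameter strictly between \<open>b\<close> and \<open>a + 1\<close>, and so are its neighbours.
\<close>

lemma closed_periodic_interval:
  assumes "b < a + 1"
  shows "closed (periodic_interval a b)"
  unfolding closed_def open_dist
proof (intro ballI)
  fix t assume t: "t \<in> - periodic_interval a b"
  obtain f where f: "f - t \<in> \<int>" "a \<le> f" "f < a + 1" using ex_representative by blast
  then have "b < f" using t by (auto simp: periodic_interval_iff not_le[symmetric])
  show "\<exists>e>0. \<forall>t'. dist t' t < e \<longrightarrow> t' \<in> - periodic_interval a b"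
  proof (intro exI[of _ "min (f - b) (a + 1 - f)"] conjI allI impI)
    fix t' assume "dist t' t < min (f - b) (a + 1 - f)"
    then have b: "b < f + (t' - t)" "f + (t' - t) < a + 1" by (auto simp: dist_real_def)
    show "t' \<in> - periodic_interval a b"
    proof
      assume "t' \<in> periodic_interval a b"
      then obtain z where z: "z - t' \<in> \<int>" "a \<le> z" "z \<le> b" by (auto simp: periodic_interval_iff)
      have "z - (f + (t' - t)) = (z - t') - (f - t)" by simp
      then have "z - (f + (t' - t)) \<in> \<int>" using z f by (metis Ints_diff)
      then have "z = f + (t' - t)" using z b assms by (intro congruent_in_period[of _ _ a]) auto
      then show False using b z by simp
    qed
  qed (use f \<open>b < f\<close> in auto)
qed

context strands
begin

lemma open_outside: "open {t. \<forall>i<n. t \<notin> I i}"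
proof -
  have "closed (\<Union>i<n. I i)" using bounds closed_periodic_interval by (intro closed_UN) auto
  moreover have "{t. \<forall>i<n. t \<notin> I i} = - (\<Union>i<n. I i)" by auto
  ultimately show ?thesis by (simp add: open_closed)
qed

lemma outerI:
  assumes D: "diagram D" "diagram D'" and u: "u \<in> crossings D" "u \<in> crossings D'"
    and out: "\<And>i. i < n \<Longrightarrow> sw D u \<notin> I i" "\<And>i. i < n \<Longrightarrow> se D u \<notin> I i"
    and eq: "\<And>t. \<forall>i<n. t \<notin> I i \<Longrightarrow> curve D' t = curve D t"
  shows "outer D D' u"
  using sw_se_unchanged[OF D u(1) open_outside] assms by (simp add: outer_def)

end

lemma detour_intersections:
  assumes D: "diagram D" "diagram D'" and m: "detour D D'" and uw: "u \<in> crossings D" "w \<in> crossings D"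
  shows "left_right D' u w = left_right D u w" "index_parity D' u = index_parity D u" "crossings D' = crossings D"
proof -
  obtain a b where ab: "a < b" "b < a + 1"
    and ins: "\<And>t. t \<in> periodic_interval a b \<Longrightarrow> curve D t \<notin> crossings D"
    and out: "\<And>t. t \<notin> periodic_interval a b \<Longrightarrow> curve D' t = curve D t"
    using m by (auto simp: detour_def)
  show cr: "crossings D' = crossings D" using m by (simp add: detour_def)
  interpret strands 1 "\<lambda>_. a" "\<lambda>_. b" by unfold_locales (use ab in auto)
  have "outer D D' z" if "z \<in> crossings D" for z
    using that cr ins[of "sw D z"] ins[of "se D z"] out sw_se(1,2)[OF D(1) that] by (intro outerI D) auto
  then show "left_right D' u w = left_right D u w" "index_parity D' u = index_parity D u"
    using intersections_outer[OF D _ _ _ _ uw, of "{}"] cr by auto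
qed


section \<open>Isotopies\<close>

lemma has_derivative_complex_split:
  assumes "bounded_linear f"
  shows "f w = Re w *\<^sub>R f 1 + Im w *\<^sub>R f \<i>"
proof -
  interpret bounded_linear f by fact
  have "w = Re w *\<^sub>R 1 + Im w *\<^sub>R \<i>" by (simp add: complex_eq_iff)
  then have "f w = f (Re w *\<^sub>R 1 + Im w *\<^sub>R \<i>)" by simp
  then show ?thesis by (simp add: add scaleR)
qed

lemma cross_linear:
  assumes "bounded_linear f"
  shows "cross (f z) (f w) = cross (f 1) (f \<i>) * cross z w"
  unfolding has_derivative_complex_split[OF assms, of z] has_derivative_complex_split[OF assms, of w]
  by (simp add: cross_def algebra_simps)

lemma cross_scaleR: "cross (x *\<^sub>R z) (y *\<^sub>R w) = x * y * cross z w"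
  by (simp add: cross_def algebra_simps)

text \<open>
  The Jacobian determinant is continuous in time, never 0, and 1 at the start. So every isotopy preserves
  the orientation of the plane.
\<close>

lemma plane_isotopy_op_diffeo:
  assumes "plane_isotopy H"
  shows "bij (H 1)" "\<exists>dh. \<forall>z. (H 1 has_derivative dh z) (at z) \<and> cross (dh z 1) (dh z \<i>) > 0"
proof -
  obtain dH where dH: "\<And>u z. u \<in> {0..1} \<Longrightarrow> (H u has_derivative dH u z) (at z)"
    "\<And>u z. u \<in> {0..1} \<Longrightarrow> cross (dH u z 1) (dH u z \<i>) \<noteq> 0"
    and bij: "\<And>u. u \<in> {0..1} \<Longrightarrow> bij (H u)"
    and cont: "\<And>w. continuous_on ({0..1} \<times> UNIV) (\<lambda>(u, z). dH u z w)" and H0: "H 0 = id"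
    using assms unfolding plane_isotopy_def by blast
  show "bij (H 1)" using bij by simp
  have "cross (dH 1 z 1) (dH 1 z \<i>) > 0" for z
  proof (rule ccontr)
    assume neg: "\<not> cross (dH 1 z 1) (dH 1 z \<i>) > 0"
    let ?f = "\<lambda>u. cross (dH u z 1) (dH u z \<i>)"
    have c: "continuous_on {0..1} (\<lambda>u. dH u z w)" for w
    proof -
      have "continuous_on {0..1} ((\<lambda>(u, z). dH u z w) \<circ> (\<lambda>u. (u, z)))"
        by (intro continuous_on_compose continuous_intros continuous_on_subset[OF cont]) auto
      then show ?thesis by (simp add: o_def)
    qed
    have "continuous_on {0..1} ?f" unfolding cross_def by (intro continuous_intros c)
    moreover have "(H 0 has_derivative dH 0 z) (at z)" using dH by simp
    then have "dH 0 z = (\<lambda>w. w)" unfolding H0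
      using has_derivative_unique has_derivative_ident unfolding id_def by blast
    then have "?f 0 = 1" by (simp add: cross_def)
    ultimately obtain u where "0 \<le> u" "u \<le> 1" "?f u = 0"
      using IVT2'[of ?f 1 0 0] neg by auto
    then show False using dH(2)[of u z] by auto
  qed
  then show "\<exists>dh. \<forall>z. (H 1 has_derivative dh z) (at z) \<and> cross (dh z 1) (dh z \<i>) > 0"
    using dH(1)[of 1] by (intro exI[of _ "dH 1"]) auto
qed

text \<open>
  An orientation preserving diffeomorphism keeps the positive pairs of tangents, and a monotone change of
  parameter keeps the cyclic order of the passages. The combinatorics depends on nothing else.
\<close>

lemma isotopy_intersections:
  assumes D: "diagram D" "diagram D'" and m: "isotopy h D D'"
  shows "inj h" "crossings D' = h ` crossings D"
    "u \<in> crossings D \<Longrightarrow> w \<in> crossings D \<Longrightarrow> left_right D' (h u) (h w) = left_right D u w"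
    "u \<in> crossings D \<Longrightarrow> index_parity D' (h u) = index_parity D u"
proof -
  obtain H where H: "plane_isotopy H" "H 1 = h" using m by (auto simp: isotopy_def)
  obtain \<theta> \<theta>' where \<theta>: "\<And>t. (\<theta> has_real_derivative \<theta>' t) (at t)" "\<And>t. \<theta>' t > 0" "\<And>t. \<theta> (t + 1) = \<theta> t + 1"
    and cu: "\<And>t. curve D' (\<theta> t) = h (curve D t)"
    using m unfolding isotopy_def by metis
  show cr: "crossings D' = h ` crossings D" using m by (simp add: isotopy_def)
  show inj: "inj h" using plane_isotopy_op_diffeo(1)[OF H(1)] H(2) by (simp add: bij_def)
  obtain dh where dh: "\<And>z. (h has_derivative dh z) (at z)" "\<And>z. cross (dh z 1) (dh z \<i>) > 0"
    using plane_isotopy_op_diffeo(2)[OF H(1)] H(2) by auto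
  have mono: "strict_mono \<theta>"
    unfolding strict_mono_def using \<theta>(1,2) DERIV_pos_imp_increasing by metis
  have tan: "\<theta>' t *\<^sub>R tangent D' (\<theta> t) = dh (curve D t) (tangent D t)" for t
  proof -
    have "((curve D' \<circ> \<theta>) has_vector_derivative \<theta>' t *\<^sub>R tangent D' (\<theta> t)) (at t)"
      using \<theta>(1) has_tangent[OF D(2)]
      by (intro vector_diff_chain_at) (simp_all add: has_real_derivative_iff_has_vector_derivative)
    moreover have "((h \<circ> curve D) has_vector_derivative dh (curve D t) (tangent D t)) (at t)"
      using has_tangent[OF D(1), of t] dh(1)[of "curve D t"]
      by (intro vector_derivative_diff_chain_within[where f = "curve D" and g = h and S = UNIV, simplified])
        (auto intro: has_derivative_at_withinI)
    moreover have "curve D' \<circ> \<theta> = h \<circ> curve D" using cu by auto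
    ultimately show ?thesis using vector_derivative_unique_at by metis
  qed
  have ends: "sw D' (h v) = frac (\<theta> (sw D v))" "se D' (h v) = frac (\<theta> (se D v))" if v: "v \<in> crossings D" for v
  proof -
    note s = sw_se[OF D(1) v]
    have lin: "bounded_linear (dh v)" using dh(1) by (rule has_derivative_bounded_linear)
    have "\<theta>' (sw D v) * \<theta>' (se D v) * cross (tangent D' (\<theta> (sw D v))) (tangent D' (\<theta> (se D v)))
        = cross (dh v (tangent D (sw D v))) (dh v (tangent D (se D v)))"
      unfolding cross_scaleR[symmetric] tan using s by simp
    also have "\<dots> = cross (dh v 1) (dh v \<i>) * cross (tangent D (sw D v)) (tangent D (se D v))"
      by (rule cross_linear[OF lin])
    also have "\<dots> > 0" using s dh(2) by simp
    finally have "cross (tangent D' (\<theta> (sw D v))) (tangent D' (\<theta> (se D v))) > 0"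
      by (rule zero_less_mult_pos) (simp add: \<theta>(2))
    then show "sw D' (h v) = frac (\<theta> (sw D v))" "se D' (h v) = frac (\<theta> (se D v))"
      using sw_se_eqI[OF D(2), of "\<theta> (sw D v)" "h v" "\<theta> (se D v)"] cu s by auto
  qed
  have fr: "arcs_between (frac s) (frac t) (frac z) = arcs_between s t z" 
    "enters (frac s) (frac t) (frac z) = enters s t z" for s t z
    by (rule arcs_between_cong; simp add: frac_def)+
  define agree :: "chain \<Rightarrow> chain \<Rightarrow> bool" where "agree = (\<lambda>C C'. \<forall>v\<in>crossings D. C' (sw D' (h v)) = C (sw D v) \<and> C' (se D' (h v)) = C (se D v) \<and>
     C' (arc_in D' (sw D' (h v))) = C (arc_in D (sw D v)) \<and> C' (arc_in D' (se D' (h v))) = C (arc_in D (se D v)))"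
  have same: "intersection D' C' E' = intersection D C E" if "agree C C'" "agree E E'" for C C' E E'
    using that inj unfolding intersection_def cr
    by (subst sum.reindex) (auto simp: agree_def inj_on_def inj_def intro!: sum.cong)
  have half: "agree (arcs_between s t) (arcs_between s' t')"
    if st: "{s, t} = {sw D v, se D v}" and st': "s' = frac (\<theta> s)" "t' = frac (\<theta> t)" and v: "v \<in> crossings D" for s t s' t' v
  proof -
    have hv: "h v \<in> crossings D'" using v cr by simp
    have "{s', t'} = {sw D' (h v), se D' (h v)}" using st st' ends[OF v] by (auto simp: doubleton_eq_iff)
    then have p: "s \<in> passages D" "t \<in> passages D" "s' \<in> passages D'" "t' \<in> passages D'" "s \<noteq> t" "s' \<noteq> t'"
      using st sw_se_passages[OF D(1) v] sw_se_passages[OF D(2) hv] sw_se_distinct(3)[OF D(1) v v] sw_se_distinct(3)[OF D(2) hv hv]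
      by (auto simp: doubleton_eq_iff)
    show ?thesis unfolding agree_def
    proof
      fix z assume z: "z \<in> crossings D"
      then have hz: "h z \<in> crossings D'" using cr by simp
      note pz = sw_se_passages[OF D(1) z] sw_se_passages[OF D(2) hz]
      show "arcs_between s' t' (sw D' (h z)) = arcs_between s t (sw D z) \<and>
         arcs_between s' t' (se D' (h z)) = arcs_between s t (se D z) \<and>
         arcs_between s' t' (arc_in D' (sw D' (h z))) = arcs_between s t (arc_in D (sw D z)) \<and>
         arcs_between s' t' (arc_in D' (se D' (h z))) = arcs_between s t (arc_in D (se D z))"
        unfolding arcs_between_arc_in[OF D(1) p(1,2,5) pz(1)] arcs_between_arc_in[OF D(1) p(1,2,5) pz(2)]
          arcs_between_arc_in[OF D(2) p(3,4,6) pz(3)] arcs_between_arc_in[OF D(2) p(3,4,6) pz(4)]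
        unfolding st' ends[OF z] fr using arcs_between_equivariant[OF mono \<theta>(3)] by simp
    qed
  qed
  have L: "agree (left_half D v) (left_half D' (h v))" and R: "agree (right_half D v) (right_half D' (h v))"
    if "v \<in> crossings D" for v
    unfolding left_half_def right_half_def using that ends[OF that] by (auto intro!: half)
  have W: "agree whole whole" by (simp add: agree_def whole_def)
  show "u \<in> crossings D \<Longrightarrow> w \<in> crossings D \<Longrightarrow> left_right D' (h u) (h w) = left_right D u w"
    using same L R by blast
  show "u \<in> crossings D \<Longrightarrow> index_parity D' (h u) = index_parity D u"
    using same L W by (simp add: index_parity_def)
qed


section \<open>Strands in a disc\<close>

text \<open>
  \<open>\<rho>\<close> is the parameter of the model curve \<open>m\<close>; it increases or decreases along the strand according to the
  sign \<open>e\<close>. The last clause computes tangents up to a positive factor, which suffices for their orientation.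
\<close>

definition strand_parameter ::
  "vdiagram \<Rightarrow> real \<Rightarrow> real \<Rightarrow> real \<Rightarrow> (complex \<Rightarrow> complex) \<Rightarrow> (complex \<Rightarrow> complex \<Rightarrow> complex) \<Rightarrow>
   (real \<Rightarrow> complex) \<Rightarrow> (real \<Rightarrow> real) \<Rightarrow> bool" where
  "strand_parameter D a b e \<psi> d\<psi> m \<rho> \<longleftrightarrow>
     (\<forall>t\<in>{a..b}. curve D t = \<psi> (m (\<rho> t))) \<and>
     (\<forall>s\<in>{a..b}. \<forall>t\<in>{a..b}. s < t \<longrightarrow> e * \<rho> s < e * \<rho> t) \<and>
     (\<forall>t\<in>{a..b}. \<forall>w. (m has_vector_derivative w) (at (\<rho> t)) \<longrightarrow>
        (\<exists>c>0. tangent D t = (c * e) *\<^sub>R d\<psi> (m (\<rho> t)) w))"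

lemma strand_parameterD:
  assumes "strand_parameter D a b e \<psi> d\<psi> m \<rho>"
  shows "t \<in> {a..b} \<Longrightarrow> curve D t = \<psi> (m (\<rho> t))"
    and "s \<in> {a..b} \<Longrightarrow> t \<in> {a..b} \<Longrightarrow> s < t \<Longrightarrow> e * \<rho> s < e * \<rho> t"
    and "t \<in> {a..b} \<Longrightarrow> (m has_vector_derivative w) (at (\<rho> t)) \<Longrightarrow>
       \<exists>c>0. tangent D t = (c * e) *\<^sub>R d\<psi> (m (\<rho> t)) w"
    and "s \<in> {a..b} \<Longrightarrow> t \<in> {a..b} \<Longrightarrow> \<rho> s = \<rho> t \<Longrightarrow> s = t"
proof -
  show mono: "e * \<rho> s < e * \<rho> t" if "s \<in> {a..b}" "t \<in> {a..b}" "s < t" for s t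
    using assms that by (simp add: strand_parameter_def)
  show "s \<in> {a..b} \<Longrightarrow> t \<in> {a..b} \<Longrightarrow> \<rho> s = \<rho> t \<Longrightarrow> s = t"
    using mono[of s t] mono[of t s] by (cases s t rule: linorder_cases) auto
qed (use assms in \<open>simp_all add: strand_parameter_def\<close>)

text \<open>
  The derivatives of a strand are one-sided at its ends. There the tangent of the diagram, which
  is differentiable on the whole line, must agree with the one-sided derivative.
\<close>

lemma strand_model:
  assumes D: "diagram D" and ab: "a < b" and e: "e = 1 \<or> e = - 1"
    and st: "strand D a b (\<lambda>s. \<psi> (m (e * s)))"
    and d\<psi>: "\<And>z. (\<psi> has_derivative d\<psi> z) (at z)"
  obtains \<rho> where "strand_parameter D a b e \<psi> d\<psi> m \<rho>"
proof -
  obtain \<tau> \<tau>' where \<tau>: "\<And>t. t \<in> {a..b} \<Longrightarrow> (\<tau> has_real_derivative \<tau>' t) (at t within {a..b})"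
      "\<And>t. t \<in> {a..b} \<Longrightarrow> \<tau>' t > 0" "\<And>t. t \<in> {a..b} \<Longrightarrow> curve D t = \<psi> (m (e * \<tau> t))"
    using st unfolding strand_def by blast
  have ee: "e * (e * x) = x" for x using e by auto
  have inc: "\<tau> s < \<tau> t" if "s \<in> {a..b}" "t \<in> {a..b}" "s < t" for s t
  proof (rule DERIV_pos_imp_increasing_open[OF that(3)])
    fix x assume x: "s < x" "x < t"
    then have "x \<in> {a..b}" "at x within {a..b} = at x" using that by (auto intro: at_within_Icc_at)
    then show "\<exists>y. (\<tau> has_real_derivative y) (at x) \<and> 0 < y" using \<tau>(1,2)[of x] by auto
  next
    have "continuous_on {a..b} \<tau>" using \<tau>(1) by (rule DERIV_continuous_on)
    then show "continuous_on {s..t} \<tau>" by (rule continuous_on_subset) (use that in auto)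
  qed
  show thesis
  proof (rule that[of "\<lambda>t. e * \<tau> t"], unfold strand_parameter_def, intro conjI ballI allI impI)
    show "curve D t = \<psi> (m (e * \<tau> t))" if "t \<in> {a..b}" for t using \<tau>(3)[OF that] .
    show "e * (e * \<tau> s) < e * (e * \<tau> t)" if "s \<in> {a..b}" "t \<in> {a..b}" "s < t" for s t
      using inc[OF that] by (simp add: ee)
    fix t w assume t: "t \<in> {a..b}" and w: "(m has_vector_derivative w) (at (e * \<tau> t))"
    have 1: "((\<lambda>t. e * \<tau> t) has_vector_derivative e * \<tau>' t) (at t within {a..b})"
      using \<tau>(1)[OF t] by (auto simp flip: has_real_derivative_iff_has_vector_derivative intro: DERIV_cmult)
    have 2: "((m \<circ> (\<lambda>t. e * \<tau> t)) has_vector_derivative (e * \<tau>' t) *\<^sub>R w) (at t within {a..b})"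
      using 1 w by (intro vector_diff_chain_within) (auto intro: has_vector_derivative_at_within)
    have 3: "((\<psi> \<circ> (m \<circ> (\<lambda>t. e * \<tau> t))) has_vector_derivative d\<psi> (m (e * \<tau> t)) ((e * \<tau>' t) *\<^sub>R w)) (at t within {a..b})"
      using 2 by (rule vector_derivative_diff_chain_within) (simp add: d\<psi> has_derivative_at_withinI)
    have "(curve D has_vector_derivative d\<psi> (m (e * \<tau> t)) ((e * \<tau>' t) *\<^sub>R w)) (at t within {a..b})"
      by (rule has_vector_derivative_transform[OF t _ 3]) (use \<tau>(3) in auto)
    moreover have "(curve D has_vector_derivative tangent D t) (at t within {a..b})"
      using has_tangent[OF D] by (rule has_vector_derivative_at_within)
    ultimately have "tangent D t = d\<psi> (m (e * \<tau> t)) ((e * \<tau>' t) *\<^sub>R w)"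
      using ab t vector_derivative_unique_within_closed_interval[of a b t] by (metis box_real(2))
    also have "\<dots> = (\<tau>' t * e) *\<^sub>R d\<psi> (m (e * \<tau> t)) w"
      using linear_scale[OF bounded_linear.linear[OF has_derivative_bounded_linear[OF d\<psi>]]] by (simp add: mult.commute)
    finally show "\<exists>c>0. tangent D t = (c * e) *\<^sub>R d\<psi> (m (e * \<tau> t)) w"
      using \<tau>(2)[OF t] by blast
  qed
qed

lemma op_diffeoD:
  assumes "op_diffeo \<psi>"
  shows "inj \<psi>"
  and "\<exists>d\<psi>. (\<forall>z. (\<psi> has_derivative d\<psi> z) (at z)) \<and> (\<forall>z. cross (d\<psi> z 1) (d\<psi> z \<i>) > 0)"
  using assms unfolding op_diffeo_def bij_def by blast+

text \<open>
  The embedding \<open>\<psi>\<close> preserves orientation, so the sign of a crossing is the one in the model, up to the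
  directions of the two strands.
\<close>

lemma cross_tangents:
  assumes d\<psi>: "\<And>z. (\<psi> has_derivative d\<psi> z) (at z)" "\<And>z. cross (d\<psi> z 1) (d\<psi> z \<i>) > 0"
    and s: "\<exists>c>0. tangent D s = (c * e) *\<^sub>R d\<psi> z w" and t: "\<exists>c>0. tangent D t = (c * e') *\<^sub>R d\<psi> z w'"
    and pos: "e * e' * cross w w' > 0"
  shows "cross (tangent D s) (tangent D t) > 0"
proof -
  obtain c c' where c: "c > 0" "c' > 0" "tangent D s = (c * e) *\<^sub>R d\<psi> z w" "tangent D t = (c' * e') *\<^sub>R d\<psi> z w'"
    using s t by blast
  have "cross (tangent D s) (tangent D t) = (c * c' * cross (d\<psi> z 1) (d\<psi> z \<i>)) * (e * e' * cross w w')"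
    unfolding c(3,4) cross_scaleR cross_linear[OF has_derivative_bounded_linear[OF d\<psi>(1)[of z]], of w w']
    by (simp add: mult_ac)
  then show ?thesis using c(1,2) pos d\<psi>(2)[of z] by simp
qed

lemma local_changeD:
  assumes "local_change n a b e m m' \<psi> \<psi>' D D'"
  shows "op_diffeo \<psi>" "op_diffeo \<psi>'" "\<psi> ` cball 0 1 = \<psi>' ` cball 0 1"
    and "i < n \<Longrightarrow> e i = 1 \<or> e i = - 1"
    and "i < n \<Longrightarrow> strand D (a i) (b i) (\<lambda>s. \<psi> (m i (e i * s)))"
    and "i < n \<Longrightarrow> strand D' (a i) (b i) (\<lambda>s. \<psi>' (m' i (e i * s)))"
  using assms unfolding local_change_def by simp_all

lemma local_change_strands:
  assumes "local_change n a b e m m' \<psi> \<psi>' D D'"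
  shows "strands n a b"
proof
  fix i j :: nat and t :: real
  assume "i < n" "j < n" "t \<in> periodic_interval (a i) (b i)" "t \<in> periodic_interval (a j) (b j)"
  then show "i = j" using assms unfolding local_change_def by blast
qed (use assms in \<open>auto simp: local_change_def\<close>)

lemma local_change_disc:
  assumes "local_change n a b e m m' \<psi> \<psi>' D D'"
  shows "curve D t \<in> \<psi> ` cball 0 1 \<longleftrightarrow> (\<exists>i<n. t \<in> periodic_interval (a i) (b i))"
    "curve D' t \<in> \<psi> ` cball 0 1 \<longleftrightarrow> (\<exists>i<n. t \<in> periodic_interval (a i) (b i))"
    "\<forall>i<n. t \<notin> periodic_interval (a i) (b i) \<Longrightarrow> curve D' t = curve D t"
proof -
  have ins: "\<forall>t\<in>(\<Union>i<n. periodic_interval (a i) (b i)). curve D t \<in> \<psi> ` cball 0 1 \<and> curve D' t \<in> \<psi> ` cball 0 1"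
    and out: "\<forall>t. t \<notin> (\<Union>i<n. periodic_interval (a i) (b i)) \<longrightarrow> curve D t \<notin> \<psi> ` cball 0 1 \<and> curve D' t = curve D t"
    using assms unfolding local_change_def by blast+
  show "\<forall>i<n. t \<notin> periodic_interval (a i) (b i) \<Longrightarrow> curve D' t = curve D t" using out by blast
  have eq: "t \<in> (\<Union>i<n. periodic_interval (a i) (b i)) \<longleftrightarrow> (\<exists>i<n. t \<in> periodic_interval (a i) (b i))" by blast
  show "curve D t \<in> \<psi> ` cball 0 1 \<longleftrightarrow> (\<exists>i<n. t \<in> periodic_interval (a i) (b i))"
    using ins out eq by metis
  show "curve D' t \<in> \<psi> ` cball 0 1 \<longleftrightarrow> (\<exists>i<n. t \<in> periodic_interval (a i) (b i))"
    using ins out eq by metis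
qed

text \<open>
  The curve is inside the disc exactly during the intervals of the strands. Hence the passages of a
  crossing outside the disc are parameters outside the intervals, where the two curves agree.
\<close>

lemma local_change_outer:
  assumes lc: "local_change n a b e m m' \<psi> \<psi>' D D'" and D: "diagram D" "diagram D'"
    and u: "u \<in> crossings D" "u \<in> crossings D'" "u \<notin> \<psi> ` cball 0 1"
  shows "strands.outer n a b D D' u"
proof -
  interpret strands n a b by (rule local_change_strands[OF lc])
  show ?thesis
    using local_change_disc[OF lc] sw_se(1,2)[OF D(1) u(1)] u(3) by (intro outerI D u) metis+
qed

context strands
begin

lemma passages_in_strands:
  assumes D: "diagram D" and u: "u \<in> crossings D" and cell: "\<And>t. curve D t = u \<Longrightarrow> \<exists>i<n. t \<in> I i"
  shows "\<exists>i j s t. i < n \<and> j < n \<and> s \<in> {a i..b i} \<and> t \<in> {a j..b j} \<and> curve D s = u \<and> curve D t = u \<and> s - t \<notin> \<int>"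
proof -
  note ss = sw_se[OF D u]
  obtain i j where ij: "i < n" "sw D u \<in> I i" "j < n" "se D u \<in> I j" using cell ss(1,2) by metis
  obtain s t where st: "s - sw D u \<in> \<int>" "s \<in> {a i..b i}" "t - se D u \<in> \<int>" "t \<in> {a j..b j}"
    using ij by (auto simp: periodic_interval_iff)
  have "curve D s = u" "curve D t = u" using curve_cong[OF D st(1)] curve_cong[OF D st(3)] ss by auto
  moreover have "s - t \<notin> \<int>" using ss(7) st(1,3) Ints_diff_trans Ints_diff_sym by blast
  ultimately show ?thesis using ij(1,3) st(2,4) by blast
qed

lemma only_passages_consecutive:
  assumes only: "only_passages D x y" and k: "k < n" and "x k < y k"
    and "curve D (x k) \<in> crossings D" "curve D (y k) \<in> crossings D"
  shows "consecutive D (x k) (y k)"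
  unfolding consecutive_def
proof (intro conjI allI impI)
  have bd: "a k \<le> x k" "y k \<le> b k" using only k by (auto simp: only_passages_def)
  then show "y k \<le> x k + 1" using bounds(2)[OF k] by simp
  fix z assume z: "x k < z \<and> z < y k"
  then have "a k \<le> z" "z \<le> b k" using bd by auto
  then show "curve D z \<notin> crossings D" using only k z unfolding only_passages_def by (metis less_irrefl)
qed (use assms in auto)

end

lemma Complex_scaleR: "Complex x y = x *\<^sub>R 1 + y *\<^sub>R \<i>"
  by (simp add: complex_eq_iff)

lemma has_vector_derivative_Complex:
  assumes "(f has_real_derivative f') (at t)" "(g has_real_derivative g') (at t)"
  shows "((\<lambda>s. Complex (f s) (g s)) has_vector_derivative Complex f' g') (at t)"
  unfolding Complex_scaleR by (auto intro!: derivative_eq_intros assms)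


section \<open>First Reidemeister moves\<close>

text \<open>
  The model chord is injective, so there are no crossings in the disc before the move. The model curl
  takes the value 0 only at \<open>1\<close> and \<open>- 1\<close>, so afterwards \<open>v\<close> is the only crossing there, and it has
  its two passages on the strand, one right after the other.
\<close>

lemma r1_increasing_kink:
  assumes D: "diagram D" "diagram D'" and m: "r1_increasing a b v D D'"
  obtains x y where "kink D' v x y" "strands 1 (\<lambda>_. a) (\<lambda>_. b)" "v \<notin> crossings D"
    "\<forall>u\<in>crossings D. strands.outer 1 (\<lambda>_. a) (\<lambda>_. b) D D' u" "crossings D' = insert v (crossings D)"
    "loop_is_left_half D' a b v \<longleftrightarrow> se D' v = frac x"
proof -
  obtain e \<psi> \<psi>' where lc: "local_change 1 (\<lambda>_. a) (\<lambda>_. b) e (\<lambda>_ s. Complex (1 / 2) s)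
           (\<lambda>_ s. Complex ((s\<^sup>2 - 1) / 4) (s * (s\<^sup>2 - 1) / 4)) \<psi> \<psi>' D D'"
    and v: "v = \<psi>' 0" and cr: "crossings D' = insert v (crossings D)"
    using m unfolding r1_increasing_def by blast
  interpret strands 1 "\<lambda>_. a" "\<lambda>_. b" by (rule local_change_strands[OF lc])
  have ab: "a < b" "b < a + 1" using bounds by auto
  have dif: "op_diffeo \<psi>" "op_diffeo \<psi>'" and img: "\<psi> ` cball 0 1 = \<psi>' ` cball 0 1" and e: "e 0 = 1 \<or> e 0 = - 1"
    and st: "strand D a b (\<lambda>s. \<psi> (Complex (1 / 2) (e 0 * s)))"
    and st': "strand D' a b (\<lambda>s. \<psi>' (Complex (((e 0 * s)\<^sup>2 - 1) / 4) (e 0 * s * ((e 0 * s)\<^sup>2 - 1) / 4)))"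
    using local_changeD[OF lc] by simp_all
  note disc = local_change_disc[OF lc]
  obtain d\<psi> where d\<psi>: "\<And>z. (\<psi> has_derivative d\<psi> z) (at z)" using op_diffeoD(2)[OF dif(1)] by blast
  obtain d\<psi>' where d\<psi>': "\<And>z. (\<psi>' has_derivative d\<psi>' z) (at z)" using op_diffeoD(2)[OF dif(2)] by blast
  obtain \<rho> where "strand_parameter D a b (e 0) \<psi> d\<psi> (\<lambda>s. Complex (1 / 2) s) \<rho>"
    by (rule strand_model[OF D(1) ab(1) e, of \<psi> "\<lambda>s. Complex (1 / 2) s", OF st d\<psi>])
  note \<rho> = strand_parameterD[OF this]
  obtain \<rho>' where "strand_parameter D' a b (e 0) \<psi>' d\<psi>' (\<lambda>s. Complex ((s\<^sup>2 - 1) / 4) (s * (s\<^sup>2 - 1) / 4)) \<rho>'"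
    by (rule strand_model[OF D(2) ab(1) e, of \<psi>' "\<lambda>s. Complex ((s\<^sup>2 - 1) / 4) (s * (s\<^sup>2 - 1) / 4)", OF st' d\<psi>'])
  note \<rho>' = strand_parameterD[OF this]
  have pt: "x = y" if "curve D s = \<psi> x" "curve D t = \<psi> y" "curve D s = u" "curve D t = u" for s t x y u
    using that injD[OF op_diffeoD(1)[OF dif(1)], of x y] by simp
  have pt': "x = y" if "curve D' s = \<psi>' x" "curve D' t = \<psi>' y" "curve D' s = u" "curve D' t = u" for s t x y u
    using that injD[OF op_diffeoD(1)[OF dif(2)], of x y] by simp
  have out: "u \<notin> \<psi> ` cball 0 1" if u: "u \<in> crossings D" for u
  proof
    assume "u \<in> \<psi> ` cball 0 1"
    then have cell: "\<exists>i<1. t \<in> I i" if "curve D t = u" for t using disc(1)[of t] that by simp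
    obtain s t where st: "s \<in> {a..b}" "t \<in> {a..b}" "curve D s = u" "curve D t = u" "s - t \<notin> \<int>"
      using passages_in_strands[OF D(1) u cell] by blast
    then have "\<rho> s = \<rho> t" using pt[OF \<rho>(1)[OF st(1)] \<rho>(1)[OF st(2)] st(3,4)] by simp
    then have "s = t" using \<rho>(4) st by blast
    then show False using st by simp
  qed
  have vB: "v \<in> \<psi> ` cball 0 1" unfolding img v by auto
  have vD: "v \<notin> crossings D" using out vB by blast
  have v': "v \<in> crossings D'" using cr by simp
  have outer: "outer D D' u" if "u \<in> crossings D" for u
    using local_change_outer[OF lc D that] out[OF that] that cr by blast
  \<comment> \<open>the model curl passes its double point only at these parameters\<close>
  have \<rho>v: "\<rho>' z = 1 \<or> \<rho>' z = - 1" if "z \<in> {a..b}" "curve D' z = v" for z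
  proof -
    have "Complex (((\<rho>' z)\<^sup>2 - 1) / 4) (\<rho>' z * ((\<rho>' z)\<^sup>2 - 1) / 4) = 0"
      using \<rho>'(1)[OF that(1)] that(2) v injD[OF op_diffeoD(1)[OF dif(2)]] by simp
    then have "(\<rho>' z)\<^sup>2 = 1" by (simp add: complex_eq_iff)
    then show ?thesis by (simp add: power2_eq_1_iff)
  qed
  have cell: "\<exists>i<1. t \<in> I i" if "curve D' t = v" for t using disc(2)[of t] that vB by simp
  obtain s t where st: "s \<in> {a..b}" "t \<in> {a..b}" "curve D' s = v" "curve D' t = v" "s - t \<notin> \<int>"
    using passages_in_strands[OF D(2) v' cell] by blast
  have "s \<noteq> t" using st(5) by auto
  define x y where "x = min s t" and "y = max s t"
  have xy: "x \<in> {a..b}" "y \<in> {a..b}" "curve D' x = v" "curve D' y = v" "x < y" "x - y \<notin> \<int>"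
    using st Ints_diff_sym \<open>s \<noteq> t\<close> by (auto simp: x_def y_def min_def max_def)
  have only: "z = x \<or> z = y" if z: "z \<in> {a..b}" "curve D' z = v" for z
  proof (rule ccontr)
    assume n: "\<not> (z = x \<or> z = y)"
    have "e 0 * \<rho>' x < e 0 * \<rho>' y" using \<rho>'(2) xy by blast
    moreover have "e 0 * \<rho>' z < e 0 * \<rho>' x \<or> e 0 * \<rho>' x < e 0 * \<rho>' z" "e 0 * \<rho>' z < e 0 * \<rho>' y \<or> e 0 * \<rho>' y < e 0 * \<rho>' z"
      using \<rho>'(2) xy z n by (metis linorder_less_linear)+
    ultimately show False using \<rho>v[OF z] \<rho>v[OF xy(1,3)] \<rho>v[OF xy(2,4)] e by auto
  qed
  have "kink D' v x y" unfolding kink_def consecutive_def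
  proof (intro conjI allI impI)
    show "y \<le> x + 1" using xy ab by auto
    fix z assume z: "x < z \<and> z < y"
    then have zab: "z \<in> {a..b}" using xy by auto
    then have "curve D' z \<in> \<psi> ` cball 0 1" using disc(2) in_periodic_interval[of a z b] by auto
    moreover have "curve D' z \<noteq> v" using only[OF zab] z by auto
    ultimately show "curve D' z \<notin> crossings D'" using out cr by auto
  qed (use xy v' in auto)
  moreover have "loop_is_left_half D' a b v \<longleftrightarrow> se D' v = frac x"
  proof
    assume "loop_is_left_half D' a b v"
    then obtain p q where pq: "a \<le> p" "p < q" "q \<le> b" "curve D' p = v" "curve D' q = v" "frac p = se D' v"
      unfolding loop_is_left_half_def by blast
    then have "p = x" using only[of p] only[of q] xy by auto
    then show "se D' v = frac x" using pq by simp
  next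
    assume "se D' v = frac x"
    then show "loop_is_left_half D' a b v"
      unfolding loop_is_left_half_def using xy by (intro exI[of _ x] exI[of _ y]) auto
  qed
  ultimately show thesis using that[of x y] strands_axioms vD outer cr by blast
qed


section \<open>Second Reidemeister moves\<close>

text \<open>
  The models before the move are injective and disjoint. After the move, each strand meets both crossings,
  which are at the model parameters \<open>1 / 2\<close> and \<open>- 1 / 2\<close> of both strands. The slopes \<open>1\<close> and \<open>- 1\<close> of the parabola at
  these points have opposite signs, so exactly one of the crossings has \<open>sw\<close> on the axis.
\<close>

lemma r2_increasing_bigon:
  assumes D: "diagram D" "diagram D'" and m: "r2_increasing v\<^sub>1 v\<^sub>2 D D'"
  obtains a b x y l m where "bigon_move a b D D' x y l m v\<^sub>1 v\<^sub>2"
proof -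
  obtain a b e \<psi> \<psi>' where lc: "local_change 2 a b e
           (\<lambda>i s. if i = 0 then Complex s 0 else Complex s (s\<^sup>2 + 1 / 4))
           (\<lambda>i s. if i = 0 then Complex s 0 else Complex s (s\<^sup>2 - 1 / 4)) \<psi> \<psi>' D D'"
    and v: "{v\<^sub>1, v\<^sub>2} = {\<psi>' (- 1 / 2), \<psi>' (1 / 2)}" and cr: "crossings D' = crossings D \<union> {v\<^sub>1, v\<^sub>2}"
    using m unfolding r2_increasing_def by blast
  interpret strands 2 a b by (rule local_change_strands[OF lc])
  note disc = local_change_disc[OF lc]
  note dif = local_changeD(1,2)[OF lc] and img = local_changeD(3)[OF lc]
  have e: "e 0 = 1 \<or> e 0 = - 1" "e 1 = 1 \<or> e 1 = - 1"
    using local_changeD(4)[OF lc, of 0] local_changeD(4)[OF lc, of 1] by simp_all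
  have st: "strand D (a 0) (b 0) (\<lambda>s. \<psi> (Complex (e 0 * s) 0))"
    "strand D (a 1) (b 1) (\<lambda>s. \<psi> (Complex (e 1 * s) ((e 1 * s)\<^sup>2 + 1 / 4)))"
    "strand D' (a 0) (b 0) (\<lambda>s. \<psi>' (Complex (e 0 * s) 0))"
    "strand D' (a 1) (b 1) (\<lambda>s. \<psi>' (Complex (e 1 * s) ((e 1 * s)\<^sup>2 - 1 / 4)))"
    using local_changeD(5)[OF lc, of 0] local_changeD(5)[OF lc, of 1]
      local_changeD(6)[OF lc, of 0] local_changeD(6)[OF lc, of 1] by simp_all
  have ab: "a 0 < b 0" "a 1 < b 1" using bounds by auto
  obtain d\<psi> where d\<psi>: "\<And>z. (\<psi> has_derivative d\<psi> z) (at z)" using op_diffeoD(2)[OF dif(1)] by blast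
  obtain d\<psi>' where d\<psi>': "\<And>z. (\<psi>' has_derivative d\<psi>' z) (at z)" "\<And>z. cross (d\<psi>' z 1) (d\<psi>' z \<i>) > 0"
    using op_diffeoD(2)[OF dif(2)] by blast
  obtain p where "strand_parameter D (a 0) (b 0) (e 0) \<psi> d\<psi> (\<lambda>s. Complex s 0) p"
    by (rule strand_model[OF D(1) ab(1) e(1), of \<psi> "\<lambda>s. Complex s 0", OF st(1) d\<psi>])
  note p = strand_parameterD[OF this]
  obtain q where "strand_parameter D (a 1) (b 1) (e 1) \<psi> d\<psi> (\<lambda>s. Complex s (s\<^sup>2 + 1 / 4)) q"
    by (rule strand_model[OF D(1) ab(2) e(2), of \<psi> "\<lambda>s. Complex s (s\<^sup>2 + 1 / 4)", OF st(2) d\<psi>])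
  note q = strand_parameterD[OF this]
  obtain p' where "strand_parameter D' (a 0) (b 0) (e 0) \<psi>' d\<psi>' (\<lambda>s. Complex s 0) p'"
    by (rule strand_model[OF D(2) ab(1) e(1), of \<psi>' "\<lambda>s. Complex s 0", OF st(3) d\<psi>'(1)])
  note p' = strand_parameterD[OF this]
  obtain q' where "strand_parameter D' (a 1) (b 1) (e 1) \<psi>' d\<psi>' (\<lambda>s. Complex s (s\<^sup>2 - 1 / 4)) q'"
    by (rule strand_model[OF D(2) ab(2) e(2), of \<psi>' "\<lambda>s. Complex s (s\<^sup>2 - 1 / 4)", OF st(4) d\<psi>'(1)])
  note q' = strand_parameterD[OF this]
  have pt: "x = y" if "curve D s = \<psi> x" "curve D t = \<psi> y" "curve D s = u" "curve D t = u" for s t x y u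
    using that injD[OF op_diffeoD(1)[OF dif(1)], of x y] by simp
  have pt': "x = y" if "curve D' s = \<psi>' x" "curve D' t = \<psi>' y" "curve D' s = u" "curve D' t = u" for s t x y u
    using that injD[OF op_diffeoD(1)[OF dif(2)], of x y] by simp
  have two: "i = 0 \<or> i = 1" if "i < 2" for i :: nat using that by linarith
  have out: "u \<notin> \<psi> ` cball 0 1" if u: "u \<in> crossings D" for u
  proof
    assume "u \<in> \<psi> ` cball 0 1"
    then have cell: "\<exists>i<2. t \<in> I i" if "curve D t = u" for t using disc(1)[of t] that by simp
    obtain i j s t where ij: "i < 2" "j < 2" and st: "s \<in> {a i..b i}" "t \<in> {a j..b j}" "curve D s = u" "curve D t = u" "s - t \<notin> \<int>"
      using passages_in_strands[OF D(1) u cell] by blast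
    consider "i = 0" "j = 0" | "i = 1" "j = 1" | "i = 0" "j = 1" | "i = 1" "j = 0" using two ij by metis
    then show False
    proof cases
      case 1
      then have mem: "s \<in> {a 0..b 0}" "t \<in> {a 0..b 0}" using st(1,2) by simp_all
      then have "p s = p t" using pt[OF p(1)[OF mem(1)] p(1)[OF mem(2)] st(3,4)] by simp
      then have "s = t" using p(4)[OF mem] by simp
      then show False using st by simp
    next
      case 2
      then have mem: "s \<in> {a 1..b 1}" "t \<in> {a 1..b 1}" using st(1,2) by simp_all
      then have "q s = q t" using pt[OF q(1)[OF mem(1)] q(1)[OF mem(2)] st(3,4)] by simp
      then have "s = t" using q(4)[OF mem] by simp
      then show False using st by simp
    next
      case 3
      then have mem: "s \<in> {a 0..b 0}" "t \<in> {a 1..b 1}" using st(1,2) by simp_all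
      have "Complex (p s) 0 = Complex (q t) ((q t)\<^sup>2 + 1 / 4)" by (rule pt[OF p(1)[OF mem(1)] q(1)[OF mem(2)] st(3,4)])
      then have "(q t)\<^sup>2 + 1 / 4 = 0" by simp
      then show False using zero_le_power2[of "q t"] by linarith
    next
      case 4
      then have mem: "t \<in> {a 0..b 0}" "s \<in> {a 1..b 1}" using st(1,2) by simp_all
      have "Complex (p t) 0 = Complex (q s) ((q s)\<^sup>2 + 1 / 4)" by (rule pt[OF p(1)[OF mem(1)] q(1)[OF mem(2)] st(4,3)])
      then have "(q s)\<^sup>2 + 1 / 4 = 0" by simp
      then show False using zero_le_power2[of "q s"] by linarith
    qed
  qed
  have halves: "- 1 / 2 = Complex (- 1 / 2) 0" "1 / 2 = Complex (1 / 2) 0" by (simp_all add: complex_eq_iff)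
  have "norm (- 1 / 2 :: complex) \<le> 1" "norm (1 / 2 :: complex) \<le> 1" by (simp_all add: norm_divide)
  then have "\<psi>' (- 1 / 2) \<in> \<psi>' ` cball 0 1" "\<psi>' (1 / 2) \<in> \<psi>' ` cball 0 1" by auto
  then have vB: "v\<^sub>1 \<in> \<psi> ` cball 0 1" "v\<^sub>2 \<in> \<psi> ` cball 0 1" unfolding img using v by (auto simp: doubleton_eq_iff)
  have vD: "v\<^sub>1 \<notin> crossings D" "v\<^sub>2 \<notin> crossings D" using out vB by blast+
  have outer: "outer D D' u" if "u \<in> crossings D" for u
    using local_change_outer[OF lc D that] out[OF that] that cr by blast
  \<comment> \<open>at the crossing with model parameter \<open>\<sigma> / 2\<close>, the sign of the pair (axis, parabola) is \<open>e 0 * e 1 * \<sigma>\<close>\<close>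
  have pas: "\<exists>s t. s \<in> {a 0..b 0} \<and> t \<in> {a 1..b 1} \<and> curve D' s = u \<and> curve D' t = u \<and> p' s = \<sigma> / 2 \<and> q' t = \<sigma> / 2 \<and>
      (if e 0 * e 1 * \<sigma> = 1 then sw D' u = frac s \<and> se D' u = frac t else sw D' u = frac t \<and> se D' u = frac s)"
    if u: "u \<in> {v\<^sub>1, v\<^sub>2}" "u = \<psi>' (Complex (\<sigma> / 2) 0)" and \<sigma>: "\<sigma> = 1 \<or> \<sigma> = - 1" for u \<sigma>
  proof -
    have uD: "u \<in> crossings D'" "u \<in> \<psi> ` cball 0 1" using u vB cr by auto
    have cell: "\<exists>i<2. t \<in> I i" if "curve D' t = u" for t using disc(2)[of t] that uD(2) by simp
    obtain i j s t where ij: "i < 2" "j < 2" and st: "s \<in> {a i..b i}" "t \<in> {a j..b j}" "curve D' s = u" "curve D' t = u" "s - t \<notin> \<int>"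
      using passages_in_strands[OF D(2) uD(1) cell] by blast
    have "\<exists>s t. s \<in> {a 0..b 0} \<and> t \<in> {a 1..b 1} \<and> curve D' s = u \<and> curve D' t = u"
    proof -
      consider "i = 0" "j = 0" | "i = 1" "j = 1" | "i = 0" "j = 1" | "i = 1" "j = 0" using two ij by metis
      then show ?thesis
      proof cases
        case 1
        then have mem: "s \<in> {a 0..b 0}" "t \<in> {a 0..b 0}" using st(1,2) by simp_all
        then have "p' s = p' t" using pt'[OF p'(1)[OF mem(1)] p'(1)[OF mem(2)] st(3,4)] by simp
        then have "s = t" using p'(4)[OF mem] by simp
        then show ?thesis using st by simp
      next
        case 2
        then have mem: "s \<in> {a 1..b 1}" "t \<in> {a 1..b 1}" using st(1,2) by simp_all
        then have "q' s = q' t" using pt'[OF q'(1)[OF mem(1)] q'(1)[OF mem(2)] st(3,4)] by simp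
        then have "s = t" using q'(4)[OF mem] by simp
        then show ?thesis using st by simp
      qed (use st in auto)
    qed
    then obtain s t where st: "s \<in> {a 0..b 0}" "t \<in> {a 1..b 1}" "curve D' s = u" "curve D' t = u" by blast
    have "Complex (p' s) 0 = Complex (\<sigma> / 2) 0" "Complex (q' t) ((q' t)\<^sup>2 - 1 / 4) = Complex (\<sigma> / 2) 0"
      using pt'[OF p'(1)[OF st(1)] _ st(3,3)] pt'[OF q'(1)[OF st(2)] _ st(4,4)] st(3,4) u(2) by auto
    then have eq: "p' s = \<sigma> / 2" "q' t = \<sigma> / 2" "(q' t)\<^sup>2 - 1 / 4 = 0" by auto
    let ?z = "Complex (\<sigma> / 2) 0"
    have ts: "\<exists>c>0. tangent D' s = (c * e 0) *\<^sub>R d\<psi>' ?z (Complex 1 0)"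
      using p'(3)[OF st(1) has_vector_derivative_Complex[OF DERIV_ident DERIV_const]] eq by simp
    have deriv: "((\<lambda>s. s\<^sup>2 - 1 / 4) has_real_derivative \<sigma>) (at (q' t))"
      by (auto intro!: derivative_eq_intros simp: eq)
    have zt: "Complex (q' t) ((q' t)\<^sup>2 - 1 / 4) = ?z" using eq by simp
    have tt: "\<exists>c>0. tangent D' t = (c * e 1) *\<^sub>R d\<psi>' ?z (Complex 1 \<sigma>)"
      using q'(3)[OF st(2) has_vector_derivative_Complex[OF DERIV_ident deriv]] unfolding zt .
    have "if e 0 * e 1 * \<sigma> = 1 then sw D' u = frac s \<and> se D' u = frac t else sw D' u = frac t \<and> se D' u = frac s"
    proof (cases "e 0 * e 1 * \<sigma> = 1")
      case True
      then have "e 0 * e 1 * cross (Complex 1 0) (Complex 1 \<sigma>) > 0" by (simp add: cross_def)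
      then have "cross (tangent D' s) (tangent D' t) > 0" by (rule cross_tangents[OF d\<psi>' ts tt])
      then show ?thesis using sw_se_eqI[OF D(2) st(3,4)] True by simp
    next
      case False
      then have "e 0 * e 1 * \<sigma> = - 1" using e \<sigma> by auto
      then have "e 1 * e 0 * cross (Complex 1 \<sigma>) (Complex 1 0) > 0" by (simp add: cross_def mult.commute)
      then have "cross (tangent D' t) (tangent D' s) > 0" by (rule cross_tangents[OF d\<psi>' tt ts])
      then show ?thesis using sw_se_eqI[OF D(2) st(4,3)] False by simp
    qed
    then show ?thesis using st eq by blast
  qed
  obtain \<sigma> where \<sigma>: "\<sigma> = 1 \<or> \<sigma> = - 1" "v\<^sub>1 = \<psi>' (Complex (\<sigma> / 2) 0)" "v\<^sub>2 = \<psi>' (Complex (- \<sigma> / 2) 0)"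
  proof -
    consider "v\<^sub>1 = \<psi>' (- 1 / 2)" "v\<^sub>2 = \<psi>' (1 / 2)" | "v\<^sub>1 = \<psi>' (1 / 2)" "v\<^sub>2 = \<psi>' (- 1 / 2)"
      using v by (auto simp: doubleton_eq_iff)
    then show thesis by cases (use that[of "-1"] that[of 1] halves in auto)
  qed
  obtain s\<^sub>1 t\<^sub>1 where s1: "s\<^sub>1 \<in> {a 0..b 0}" "t\<^sub>1 \<in> {a 1..b 1}" "curve D' s\<^sub>1 = v\<^sub>1" "curve D' t\<^sub>1 = v\<^sub>1" "p' s\<^sub>1 = \<sigma> / 2" "q' t\<^sub>1 = \<sigma> / 2"
    "if e 0 * e 1 * \<sigma> = 1 then sw D' v\<^sub>1 = frac s\<^sub>1 \<and> se D' v\<^sub>1 = frac t\<^sub>1 else sw D' v\<^sub>1 = frac t\<^sub>1 \<and> se D' v\<^sub>1 = frac s\<^sub>1"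
    using pas[of v\<^sub>1 \<sigma>] \<sigma> by auto
  have m\<sigma>: "- \<sigma> = 1 \<or> - \<sigma> = - 1" using \<sigma>(1) by auto
  obtain s\<^sub>2 t\<^sub>2 where s2: "s\<^sub>2 \<in> {a 0..b 0}" "t\<^sub>2 \<in> {a 1..b 1}" "curve D' s\<^sub>2 = v\<^sub>2" "curve D' t\<^sub>2 = v\<^sub>2" "p' s\<^sub>2 = - \<sigma> / 2" "q' t\<^sub>2 = - \<sigma> / 2"
    "if e 0 * e 1 * - \<sigma> = 1 then sw D' v\<^sub>2 = frac s\<^sub>2 \<and> se D' v\<^sub>2 = frac t\<^sub>2 else sw D' v\<^sub>2 = frac t\<^sub>2 \<and> se D' v\<^sub>2 = frac s\<^sub>2"
    using pas[of v\<^sub>2 "- \<sigma>", OF _ \<sigma>(3) m\<sigma>] by blast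
  have ne: "v\<^sub>1 \<noteq> v\<^sub>2" "s\<^sub>1 \<noteq> s\<^sub>2" "t\<^sub>1 \<noteq> t\<^sub>2"
  proof -
    have "\<sigma> / 2 \<noteq> - \<sigma> / 2" using \<sigma>(1) by auto
    then show "s\<^sub>1 \<noteq> s\<^sub>2" "t\<^sub>1 \<noteq> t\<^sub>2" using s1(5,6) s2(5,6) by auto
    show "v\<^sub>1 \<noteq> v\<^sub>2"
    proof
      assume "v\<^sub>1 = v\<^sub>2"
      then have "\<psi>' (Complex (\<sigma> / 2) 0) = \<psi>' (Complex (- \<sigma> / 2) 0)" using \<sigma>(2,3) by simp
      then have "Complex (\<sigma> / 2) 0 = Complex (- \<sigma> / 2) 0" by (rule injD[OF op_diffeoD(1)[OF dif(2)]])
      then show False using \<open>\<sigma> / 2 \<noteq> - \<sigma> / 2\<close> by simp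
    qed
  qed
  define x y where "x = (\<lambda>k::nat. if k = 0 then min s\<^sub>1 s\<^sub>2 else min t\<^sub>1 t\<^sub>2)"
    and "y = (\<lambda>k::nat. if k = 0 then max s\<^sub>1 s\<^sub>2 else max t\<^sub>1 t\<^sub>2)"
  have hit: "z \<in> {s\<^sub>1, s\<^sub>2}" if z: "z \<in> {a 0..b 0}" "curve D' z \<in> crossings D'" for z
  proof -
    have "\<exists>i<2. z \<in> I i" using in_periodic_interval[of "a 0" z "b 0"] z(1) by (intro exI[of _ 0]) auto
    then have "curve D' z \<in> \<psi> ` cball 0 1" using disc(2) by blast
    then have "curve D' z \<in> {v\<^sub>1, v\<^sub>2}" using out z cr by auto
    then have "p' z = p' s\<^sub>1 \<or> p' z = p' s\<^sub>2"
      using pt'[OF p'(1)[OF z(1)] p'(1)[OF s1(1)] _ s1(3)] pt'[OF p'(1)[OF z(1)] p'(1)[OF s2(1)] _ s2(3)] by auto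
    then show ?thesis using p'(4)[OF z(1) s1(1)] p'(4)[OF z(1) s2(1)] by blast
  qed
  have hit': "z \<in> {t\<^sub>1, t\<^sub>2}" if z: "z \<in> {a 1..b 1}" "curve D' z \<in> crossings D'" for z
  proof -
    have "\<exists>i<2. z \<in> I i" using in_periodic_interval[of "a 1" z "b 1"] z(1) by (intro exI[of _ 1]) auto
    then have "curve D' z \<in> \<psi> ` cball 0 1" using disc(2) by blast
    then have "curve D' z \<in> {v\<^sub>1, v\<^sub>2}" using out z cr by auto
    then have "q' z = q' t\<^sub>1 \<or> q' z = q' t\<^sub>2"
      using pt'[OF q'(1)[OF z(1)] q'(1)[OF s1(2)] _ s1(4)] pt'[OF q'(1)[OF z(1)] q'(1)[OF s2(2)] _ s2(4)] by auto
    then show ?thesis using q'(4)[OF z(1) s1(2)] q'(4)[OF z(1) s2(2)] by blast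
  qed
  have only: "only_passages D' x y" unfolding only_passages_def
  proof (intro allI impI)
    fix k :: nat assume "k < 2"
    then consider "k = 0" | "k = 1" by linarith
    then show "a k \<le> x k \<and> x k \<le> b k \<and> a k \<le> y k \<and> y k \<le> b k \<and>
        (\<forall>z. a k \<le> z \<and> z \<le> b k \<and> curve D' z \<in> crossings D' \<longrightarrow> z = x k \<or> z = y k)"
    proof cases
      case 1
      then show ?thesis using s1(1) s2(1) hit by (auto simp: x_def y_def min_def max_def)
    next
      case 2
      then show ?thesis using s1(2) s2(2) hit' by (auto simp: x_def y_def min_def max_def)
    qed
  qed
  have con: "consecutive D' (x k) (y k)" if "k < 2" for k
    using two[OF that] ne s1 s2 cr
    by (intro only_passages_consecutive[OF only that]) (auto simp: x_def y_def min_def max_def)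
  \<comment> \<open>the strand through the passage \<open>sw\<close> of \<open>v\<^sub>1\<close>\<close>
  define l where "l = (if e 0 * e 1 * \<sigma> = 1 then 0 else 1::nat)"
  have sgn: "e 0 * e 1 * \<sigma> = 1 \<or> e 0 * e 1 * \<sigma> = - 1" using e \<sigma>(1) by auto
  have "bigon_move a b D D' x y l (1 - l) v\<^sub>1 v\<^sub>2"
  proof unfold_locales
    show "bigon D' v\<^sub>1 v\<^sub>2 (x l) (y l) (x (1 - l)) (y (1 - l))"
      unfolding bigon_def
    proof (intro conjI)
      show "consecutive D' (x l) (y l)" "consecutive D' (x (1 - l)) (y (1 - l))" by (rule con; simp add: l_def)+
      show "{sw D' v\<^sub>1, se D' v\<^sub>2} = {frac (x l), frac (y l)}" "{se D' v\<^sub>1, sw D' v\<^sub>2} = {frac (x (1 - l)), frac (y (1 - l))}"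
        using sgn s1(7) s2(7) by (auto simp: l_def x_def y_def min_def max_def)
    qed (use cr ne in auto)
  qed (use D only outer cr vD in \<open>auto simp: l_def\<close>)
  then show thesis by (rule that)
qed


section \<open>Third Reidemeister moves\<close>

definition line :: "nat \<Rightarrow> real \<Rightarrow> complex" where
  "line i s = cis (2 * pi / 3) ^ i * Complex s (- 1 / 4)"

definition corner :: "nat \<Rightarrow> complex" where
  "corner i = cis (2 * pi / 3) ^ i * Complex (sqrt 3 / 4) (- 1 / 4)"

lemma cis_third: "cis (2 * pi / 3) = Complex (- 1 / 2) (sqrt 3 / 2)"
proof -
  have "cos (2 * pi / 3) = cos (pi - pi / 3)" "sin (2 * pi / 3) = sin (pi - pi / 3)"
    by (simp_all add: field_simps)
  then have "cos (2 * pi / 3) = - 1 / 2" "sin (2 * pi / 3) = sqrt 3 / 2"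
    by (simp_all only: cos_pi_minus sin_pi_minus cos_60 sin_60)
  then show ?thesis by (simp add: complex_eq_iff)
qed

lemma cis_third_cubed: "cis (2 * pi / 3) ^ 3 = 1"
  by (simp add: Complex.DeMoivre)

lemma line_nxt: "i < 3 \<Longrightarrow> line (nxt i) t = cis (2 * pi / 3) ^ i * (cis (2 * pi / 3) * Complex t (- 1 / 4))"
  using cis_third_cubed
  by (elim less_3_cases) (simp_all add: line_def power2_eq_square power3_eq_cube mult.assoc[symmetric])

text \<open>
  Consecutive lines differ by a rotation of order 3, which reduces the intersection to two linear equations.
\<close>

lemma lines_meet:
  assumes i: "i < 3" and eq: "line i s = line (nxt i) t"
  shows "s = sqrt 3 / 4" "t = - sqrt 3 / 4"
proof -
  have "Complex s (- 1 / 4) = cis (2 * pi / 3) * Complex t (- 1 / 4)"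
    using eq unfolding line_nxt[OF i] by (simp add: line_def)
  then have s: "s = - t / 2 + sqrt 3 / 8" and "- 1 / 4 = t * sqrt 3 / 2 + 1 / 8"
    unfolding cis_third by (simp_all add: complex_eq_iff algebra_simps)
  then have "t * sqrt 3 = - 3 / 4" by simp
  then have "t * sqrt 3 * sqrt 3 = - 3 / 4 * sqrt 3" by simp
  then show "t = - sqrt 3 / 4" by (simp add: mult.assoc)
  then show "s = sqrt 3 / 4" using s by simp
qed

lemma corner_lines:
  assumes "i < 3"
  shows "line i (sqrt 3 / 4) = corner i" "line (nxt i) (- sqrt 3 / 4) = corner i"
proof -
  show "line i (sqrt 3 / 4) = corner i" by (simp add: line_def corner_def)
  have "cis (2 * pi / 3) * Complex (- sqrt 3 / 4) (- 1 / 4) = Complex (sqrt 3 / 4) (- 1 / 4)"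
    by (simp add: cis_third complex_eq_iff)
  then show "line (nxt i) (- sqrt 3 / 4) = corner i"
    unfolding line_nxt[OF assms] corner_def by simp
qed

lemma line_inj: "line i s = line i t \<longleftrightarrow> s = t"
  by (simp add: line_def)

lemma nxt_cases:
  assumes "i < 3" "j < 3" "i \<noteq> j"
  shows "j = nxt i \<or> i = nxt j"
  using assms by (elim less_3_cases) auto

lemma nxt_facts: "i < 3 \<Longrightarrow> nxt i < 3" "i < 3 \<Longrightarrow> nxt i \<noteq> i" "i < 3 \<Longrightarrow> prv i < 3" "i < 3 \<Longrightarrow> nxt (prv i) = i" "i < 3 \<Longrightarrow> prv (nxt i) = i"
  by (auto elim!: less_3_cases)

text \<open>
  Each corner lies on exactly two of the lines, at the parameter \<open>sqrt 3 / 4\<close> of one of them and \<open>- sqrt 3 / 4\<close> of the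
  other.
\<close>

lemma corner_on_line:
  assumes "i < 3" "k < 3" "line k s = corner i"
  shows "k = i \<and> s = sqrt 3 / 4 \<or> k = nxt i \<and> s = - sqrt 3 / 4"
proof (cases "k = i")
  case True
  then show ?thesis using assms(3) corner_lines(1)[OF assms(1)] line_inj by metis
next
  case False
  then consider "k = nxt i" | "i = nxt k" using nxt_cases[OF assms(2,1)] by blast
  then show ?thesis
  proof cases
    case 1
    then show ?thesis using assms(3) corner_lines(2)[OF assms(1)] line_inj by metis
  next
    case 2
    have "line k s = line (nxt k) (sqrt 3 / 4)" using assms(3) corner_lines(1)[OF assms(1)] 2 by simp
    then have "sqrt 3 / 4 = - sqrt 3 / 4" using lines_meet(2)[OF assms(2)] by blast
    then show ?thesis by simp
  qed
qed

lemma corner_inj: "i < 3 \<Longrightarrow> j < 3 \<Longrightarrow> corner i = corner j \<Longrightarrow> i = j"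
  using corner_on_line[of j i "sqrt 3 / 4"] corner_lines(1)[of i] by auto

lemma norm_corner: "norm (corner i) \<le> 1"
proof -
  have "norm (Complex (sqrt 3 / 4) (- 1 / 4)) = 1 / 2"
    by (simp add: complex_norm power_divide real_sqrt_divide)
  then show ?thesis by (simp add: corner_def norm_mult norm_power)
qed

lemma line_has_vector_derivative: "(line i has_vector_derivative cis (2 * pi / 3) ^ i) (at s)"
proof -
  have "((\<lambda>s. Complex s (- 1 / 4)) has_vector_derivative Complex 1 0) (at s)"
    by (rule has_vector_derivative_Complex[OF DERIV_ident DERIV_const])
  then have "((\<lambda>s. cis (2 * pi / 3) ^ i * Complex s (- 1 / 4)) has_vector_derivative cis (2 * pi / 3) ^ i * Complex 1 0) (at s)"
    by (rule has_vector_derivative_mult_right)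
  moreover have "Complex 1 0 = 1" by (simp add: complex_eq_iff)
  ultimately show ?thesis by (simp add: line_def[abs_def])
qed

text \<open>
  Each line is turned by 120 degrees against the previous one, so that it crosses the previous one
  positively, as far as both have the model direction.
\<close>

lemma cross_directions:
  assumes "i < 3"
  shows "cross (cis (2 * pi / 3) ^ i) (cis (2 * pi / 3) ^ nxt i) = sqrt 3 / 2"
proof -
  have rot: "cross (z * w) (z * w') = (norm z)\<^sup>2 * cross w w'" for z w w'
    unfolding cmod_power2 by (simp add: cross_def power2_eq_square algebra_simps)
  have "cis (2 * pi / 3) ^ nxt i = cis (2 * pi / 3) ^ i * cis (2 * pi / 3)"
    using assms cis_third_cubed by (elim less_3_cases) (simp_all add: power2_eq_square power3_eq_cube)
  then have "cross (cis (2 * pi / 3) ^ i) (cis (2 * pi / 3) ^ nxt i)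
      = (norm (cis (2 * pi / 3) ^ i))\<^sup>2 * cross 1 (cis (2 * pi / 3))"
    using rot[of "cis (2 * pi / 3) ^ i" 1 "cis (2 * pi / 3)"] by simp
  also have "norm (cis (2 * pi / 3) ^ i) = 1" by (simp add: norm_power)
  finally show ?thesis by (simp add: cross_def cis_third)
qed

context strands
begin

text \<open>
  Reads off the triangle from the three lines. The passage \<open>P i\<close> is at the parameter \<open>sqrt 3 / 4\<close> of the line \<open>i\<close> and
  \<open>Q i\<close> at \<open>- sqrt 3 / 4\<close>, so \<open>Q i\<close> comes first iff the strand has the model direction. It is stated for one diagram,
  since it applies to both sides of the move.
\<close>

lemma lines_triangle:
  assumes n: "n = 3" and D: "diagram D" and dif: "op_diffeo \<psi>"
    and e: "\<And>i. i < 3 \<Longrightarrow> e i = 1 \<or> e i = - 1"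
    and st: "\<And>i. i < 3 \<Longrightarrow> strand D (a i) (b i) (\<lambda>s. \<psi> (line i (e i * s)))"
    and v: "\<And>i. i < 3 \<Longrightarrow> v i = \<psi> (corner i)" "\<And>i. i < 3 \<Longrightarrow> v i \<in> crossings D"
    and disc: "\<And>t. curve D t \<in> B \<longleftrightarrow> (\<exists>i<n. t \<in> I i)" and B: "B = \<psi> ` cball 0 1"
  shows "\<exists>P Q. triangle D (\<lambda>i. e i = 1) P Q v \<and> only_passages D P Q"
    and "u \<in> crossings D \<Longrightarrow> u \<in> B \<Longrightarrow> u \<in> v ` {..<3}"
proof -
  obtain d\<psi> where d\<psi>: "\<And>z. (\<psi> has_derivative d\<psi> z) (at z)" "\<And>z. cross (d\<psi> z 1) (d\<psi> z \<i>) > 0"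
    using op_diffeoD(2)[OF dif] by blast
  have "\<exists>\<rho>. strand_parameter D (a i) (b i) (e i) \<psi> d\<psi> (line i) \<rho>" if i: "i < 3" for i
  proof -
    have "a i < b i" using bounds(1) i n by simp
    then obtain \<rho> where "strand_parameter D (a i) (b i) (e i) \<psi> d\<psi> (line i) \<rho>"
      by (rule strand_model[OF D _ e[OF i] st[OF i] d\<psi>(1)])
    then show ?thesis by blast
  qed
  then obtain \<rho> where \<rho>: "\<And>i. i < 3 \<Longrightarrow> strand_parameter D (a i) (b i) (e i) \<psi> d\<psi> (line i) (\<rho> i)"
    by metis
  note cu = strand_parameterD(1)[OF \<rho>] and mono = strand_parameterD(2)[OF \<rho>]
    and tan = strand_parameterD(3)[OF \<rho>] and inj = strand_parameterD(4)[OF \<rho>]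
  have pt: "x = y" if "curve D s = \<psi> x" "curve D t = \<psi> y" "curve D s = u" "curve D t = u" for s t x y u
    using that injD[OF op_diffeoD(1)[OF dif], of x y] by simp
  have vB: "v i \<in> B" if "i < 3" for i using v(1)[OF that] norm_corner unfolding B by auto
  have in_disc: "\<exists>i<3. u = v i \<and> (\<exists>p q. p \<in> {a i..b i} \<and> q \<in> {a (nxt i)..b (nxt i)} \<and> curve D p = u \<and> curve D q = u)"
    if u: "u \<in> crossings D" "u \<in> B" for u
  proof -
    have cell: "\<exists>i<n. t \<in> I i" if "curve D t = u" for t using disc[of t] that u(2) by simp
    obtain i j s t where ij: "i < 3" "j < 3" and st: "s \<in> {a i..b i}" "t \<in> {a j..b j}" "curve D s = u" "curve D t = u" "s - t \<notin> \<int>"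
      using passages_in_strands[OF D u(1) cell] n by blast
    have ln: "line i (\<rho> i s) = line j (\<rho> j t)"
      by (rule pt[OF cu[OF ij(1) st(1)] cu[OF ij(2) st(2)] st(3,4)])
    have "i \<noteq> j"
    proof
      assume "i = j"
      then have "s = t" using inj[OF ij(1) st(1), of t] st(2) ln line_inj by simp
      then show False using st(5) by simp
    qed
    then consider "j = nxt i" | "i = nxt j" using nxt_cases[OF ij] by blast
    then show ?thesis
    proof cases
      case 1
      have "\<rho> i s = sqrt 3 / 4" using lines_meet(1)[OF ij(1)] ln 1 by blast
      then have "line i (\<rho> i s) = corner i" using corner_lines(1)[OF ij(1)] by (simp only:)
      then have "u = v i" using cu[OF ij(1) st(1)] st(3) v(1)[OF ij(1)] by simp
      then show ?thesis using ij st 1 by blast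
    next
      case 2
      have "\<rho> j t = sqrt 3 / 4" using lines_meet(1)[OF ij(2)] ln[symmetric] 2 by blast
      then have "line j (\<rho> j t) = corner j" using corner_lines(1)[OF ij(2)] by (simp only:)
      then have "u = v j" using cu[OF ij(2) st(2)] st(4) v(1)[OF ij(2)] by simp
      then show ?thesis using ij st 2 by blast
    qed
  qed
  then show "u \<in> crossings D \<Longrightarrow> u \<in> B \<Longrightarrow> u \<in> v ` {..<3}" by blast
  have inj_v: "inj_on v {..<3}"
  proof (rule inj_onI)
    fix i j :: nat assume ij: "i \<in> {..<3}" "j \<in> {..<3}" and eq: "v i = v j"
    then have "corner i = corner j" using v(1)[of i] v(1)[of j] injD[OF op_diffeoD(1)[OF dif]] by simp
    then show "i = j" using corner_inj ij by simp
  qed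
  have "\<exists>p q. p \<in> {a i..b i} \<and> q \<in> {a (nxt i)..b (nxt i)} \<and> curve D p = v i \<and> curve D q = v i" if i: "i < 3" for i
  proof -
    obtain j where "j < 3" "v i = v j" and *: "\<exists>p q. p \<in> {a j..b j} \<and> q \<in> {a (nxt j)..b (nxt j)} \<and> curve D p = v i \<and> curve D q = v i"
      using in_disc[OF v(2)[OF i] vB[OF i]] by blast
    then have "j = i" using inj_onD[OF inj_v, of i j] i by simp
    then show ?thesis using * by simp
  qed
  then obtain P Q' where PQ': "\<And>i. i < 3 \<Longrightarrow> P i \<in> {a i..b i}" "\<And>i. i < 3 \<Longrightarrow> Q' i \<in> {a (nxt i)..b (nxt i)}"
    "\<And>i. i < 3 \<Longrightarrow> curve D (P i) = v i" "\<And>i. i < 3 \<Longrightarrow> curve D (Q' i) = v i"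
    by metis
  define Q where "Q = (\<lambda>i. Q' (prv i))"
  have P: "P i \<in> {a i..b i}" "curve D (P i) = v i" "\<rho> i (P i) = sqrt 3 / 4" if i: "i < 3" for i
  proof -
    show "P i \<in> {a i..b i}" "curve D (P i) = v i" using PQ' i by auto
    then have "line i (\<rho> i (P i)) = corner i" using pt[OF cu[OF i] v(1)[OF i, folded PQ'(3)[OF i]]] by simp
    then show "\<rho> i (P i) = sqrt 3 / 4" using corner_on_line[OF i i] nxt_facts(2)[OF i] by metis
  qed
  have Q: "Q (nxt i) \<in> {a (nxt i)..b (nxt i)}" "curve D (Q (nxt i)) = v i" "\<rho> (nxt i) (Q (nxt i)) = - sqrt 3 / 4" if i: "i < 3" for i
  proof -
    note n' = nxt_facts[OF i]
    show mem: "Q (nxt i) \<in> {a (nxt i)..b (nxt i)}" and c: "curve D (Q (nxt i)) = v i"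
      using PQ'(2,4)[OF i] n' by (auto simp: Q_def)
    have "line (nxt i) (\<rho> (nxt i) (Q (nxt i))) = corner i"
      by (rule pt[OF cu[OF n'(1) mem] _ c c]) (use c v(1)[OF i] in simp)
    then show "\<rho> (nxt i) (Q (nxt i)) = - sqrt 3 / 4" using corner_on_line[OF i n'(1)] n'(2) by metis
  qed
  have Q'': "Q i \<in> {a i..b i}" "curve D (Q i) = v (prv i)" "\<rho> i (Q i) = - sqrt 3 / 4" if i: "i < 3" for i
    using Q[OF nxt_facts(3)[OF i]] unfolding nxt_facts(4)[OF i] by auto
  have only: "only_passages D P Q" unfolding only_passages_def
  proof (intro allI impI)
    fix k assume "k < n"
    then have k: "k < 3" using n by simp
    have "z = P k \<or> z = Q k" if z: "a k \<le> z" "z \<le> b k" "curve D z \<in> crossings D" for z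
    proof -
      have zk: "z \<in> {a k..b k}" using z by simp
      have "curve D z \<in> B" using disc in_periodic_interval[OF z(1,2)] k n by auto
      then obtain i where i: "i < 3" "curve D z = v i" using in_disc[OF z(3)] by blast
      have "line k (\<rho> k z) = corner i"
        by (rule pt[OF cu[OF k zk] _ i(2,2)]) (use i v(1)[OF i(1)] in simp)
      then have "\<rho> k z = \<rho> k (P k) \<or> \<rho> k z = \<rho> k (Q k)"
        unfolding P(3)[OF k] Q''(3)[OF k] using corner_on_line[OF i(1) k] by blast
      then show ?thesis using inj[OF k zk P(1)[OF k]] inj[OF k zk Q''(1)[OF k]] by blast
    qed
    then show "a k \<le> P k \<and> P k \<le> b k \<and> a k \<le> Q k \<and> Q k \<le> b k \<and>
        (\<forall>z. a k \<le> z \<and> z \<le> b k \<and> curve D z \<in> crossings D \<longrightarrow> z = P k \<or> z = Q k)"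
      using P(1)[OF k] Q''(1)[OF k] by auto
  qed
  have "triangle D (\<lambda>i. e i = 1) P Q v"
    unfolding triangle_def
  proof (intro conjI allI impI inj_v)
    fix i :: nat assume i: "i < 3"
    note n' = nxt_facts[OF i]
    show "v i \<in> crossings D" by (rule v(2)[OF i])
    show "curve D (P i) = v i" by (rule P(2)[OF i])
    show "curve D (Q (nxt i)) = v i" by (rule Q(2)[OF i])
    have sq: "sqrt 3 > (0::real)" by simp
    have less: "if e i = 1 then Q i < P i else P i < Q i"
    proof (cases "e i = 1")
      case True
      have "\<not> P i \<le> Q i"
        using mono[OF i P(1)[OF i] Q''(1)[OF i]] P(3)[OF i] Q''(3)[OF i] True sq by (auto simp: le_less)
      then show ?thesis using True by simp
    next
      case False
      then have "e i = - 1" using e[OF i] by blast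
      then have "\<not> Q i \<le> P i"
        using mono[OF i Q''(1)[OF i] P(1)[OF i]] P(3)[OF i] Q''(3)[OF i] sq by (auto simp: le_less)
      then show ?thesis using False by simp
    qed
    have only': "only_passages D (\<lambda>i. if e i = 1 then Q i else P i) (\<lambda>i. if e i = 1 then P i else Q i)"
      using only unfolding only_passages_def by auto
    show "consecutive D (if e i = 1 then Q i else P i) (if e i = 1 then P i else Q i)"
      by (rule only_passages_consecutive[OF only'])
        (use i n less P(2)[OF i] Q''(2)[OF i] v(2)[OF i] v(2)[OF nxt_facts(3)[OF i]] in auto)
    have zP: "line i (\<rho> i (P i)) = corner i" "line (nxt i) (\<rho> (nxt i) (Q (nxt i))) = corner i"
      using corner_lines[OF i] P(3)[OF i] Q(3)[OF i] by (simp_all only:)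
    have tP: "\<exists>c>0. tangent D (P i) = (c * e i) *\<^sub>R d\<psi> (corner i) (cis (2 * pi / 3) ^ i)"
      using tan[OF i P(1)[OF i] line_has_vector_derivative] unfolding zP .
    have tQ: "\<exists>c>0. tangent D (Q (nxt i)) = (c * e (nxt i)) *\<^sub>R d\<psi> (corner i) (cis (2 * pi / 3) ^ nxt i)"
      using tan[OF n'(1) Q(1)[OF i] line_has_vector_derivative] unfolding zP .
    have "if e i = 1 \<longleftrightarrow> e (nxt i) = 1 then sw D (v i) = frac (P i) \<and> se D (v i) = frac (Q (nxt i))
        else sw D (v i) = frac (Q (nxt i)) \<and> se D (v i) = frac (P i)"
    proof (cases "e i = 1 \<longleftrightarrow> e (nxt i) = 1")
      case True
      then have "e i * e (nxt i) = 1" using e[OF i] e[OF n'(1)] by auto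
      then have "e i * e (nxt i) * cross (cis (2 * pi / 3) ^ i) (cis (2 * pi / 3) ^ nxt i) > 0"
        by (simp add: cross_directions[OF i])
      then have "cross (tangent D (P i)) (tangent D (Q (nxt i))) > 0"
        by (rule cross_tangents[OF d\<psi> tP tQ])
      then show ?thesis using sw_se_eqI[OF D P(2)[OF i] Q(2)[OF i]] True by simp
    next
      case False
      then have "e (nxt i) * e i = - 1" using e[OF i] e[OF n'(1)] by auto
      moreover have "cross (cis (2 * pi / 3) ^ nxt i) (cis (2 * pi / 3) ^ i) = - (sqrt 3 / 2)"
        using cross_directions[OF i] cross_swap[of "cis (2 * pi / 3) ^ nxt i" "cis (2 * pi / 3) ^ i"] by (simp only:)
      ultimately have "e (nxt i) * e i * cross (cis (2 * pi / 3) ^ nxt i) (cis (2 * pi / 3) ^ i) > 0" by (simp only:) simp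
      then have "cross (tangent D (Q (nxt i))) (tangent D (P i)) > 0"
        by (rule cross_tangents[OF d\<psi> tQ tP])
      then show ?thesis using sw_se_eqI[OF D Q(2)[OF i] P(2)[OF i]] False by simp
    qed
    then show "sw D (v i) = frac (if (e i = 1) = (e (nxt i) = 1) then P i else Q (nxt i))"
      "se D (v i) = frac (if (e i = 1) = (e (nxt i) = 1) then Q (nxt i) else P i)"
      by (auto split: if_splits)
  qed
  then show "\<exists>P Q. triangle D (\<lambda>i. e i = 1) P Q v \<and> only_passages D P Q" using only by blast
qed

end

text \<open>
  A half turn of the model disc takes the lines after the move to the lines before the move,
  with the opposite direction.
\<close>

lemma op_diffeo_rotate:
  assumes "op_diffeo \<psi>"
  shows "op_diffeo (\<lambda>z. \<psi> (- z))"
proof -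
  obtain d\<psi> where d\<psi>: "\<And>z. (\<psi> has_derivative d\<psi> z) (at z)" "\<And>z. cross (d\<psi> z 1) (d\<psi> z \<i>) > 0"
    "\<And>w. continuous_on UNIV (\<lambda>z. d\<psi> z w)" and bij: "bij \<psi>"
    using assms unfolding op_diffeo_def by blast
  show ?thesis unfolding op_diffeo_def
  proof (intro conjI exI[of _ "\<lambda>z w. d\<psi> (- z) (- w)"] allI)
    show "bij (\<lambda>z. \<psi> (- z))" using bij_comp[OF bij_uminus bij] by (simp add: o_def)
    fix z
    show "((\<lambda>z. \<psi> (- z)) has_derivative (\<lambda>w. d\<psi> (- z) (- w))) (at z)"
      by (rule has_derivative_compose[OF _ d\<psi>(1)]) (auto intro!: derivative_eq_intros)
    have "bounded_linear (d\<psi> (- z))" using d\<psi>(1) by (rule has_derivative_bounded_linear)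
    from cross_linear[OF this, of "- 1" "- \<i>"]
    show "cross (d\<psi> (- z) (- 1)) (d\<psi> (- z) (- \<i>)) > 0" using d\<psi>(2) by (simp add: cross_def)
  next
    fix w
    have "continuous_on UNIV ((\<lambda>z. d\<psi> z (- w)) \<circ> uminus)"
      by (intro continuous_on_compose continuous_intros continuous_on_subset[OF d\<psi>(3)]) auto
    then show "continuous_on UNIV (\<lambda>z. d\<psi> (- z) (- w))" by (simp add: o_def)
  qed
qed

lemma triangle_cong:
  assumes "\<And>i. i < 3 \<Longrightarrow> e i = e' i"
  shows "triangle D e P Q v = triangle D e' P Q v"
  unfolding triangle_def using assms nxt_facts(1) by (intro conj_cong refl all_cong) auto

lemma r3_triangle_move:
  assumes D: "diagram D" "diagram D'" and m: "r3 a b v v' D D'"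
  obtains e P Q P' Q' where "triangle_move a b D D' e P Q P' Q' v v'"
proof -
  obtain e \<psi> \<psi>' where lc: "local_change 3 a b e
           (\<lambda>i s. cis (2 * pi / 3) ^ i * Complex s (- 1 / 4))
           (\<lambda>i s. cis (2 * pi / 3) ^ i * Complex s (1 / 4)) \<psi> \<psi>' D D'"
    and v: "\<forall>i<3. v i = \<psi> (cis (2 * pi / 3) ^ i * Complex (sqrt 3 / 4) (- 1 / 4)) \<and>
               v' i = \<psi>' (- (cis (2 * pi / 3) ^ i * Complex (sqrt 3 / 4) (- 1 / 4)))"
    using m[unfolded r3_def, THEN conjunct1] by (elim exE conjE) (rule that)
  have cr: "v ` {..<3} \<subseteq> crossings D" "v' ` {..<3} \<subseteq> crossings D'"
      "crossings D' - v' ` {..<3} = crossings D - v ` {..<3}"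
    using m[unfolded r3_def, THEN conjunct2] by (simp_all only:)
  interpret strands 3 a b by (rule local_change_strands[OF lc])
  note disc = local_change_disc[OF lc]
  note lcD = local_changeD[OF lc]
  have st: "strand D (a i) (b i) (\<lambda>s. \<psi> (line i (e i * s)))" if "i < 3" for i
    using lcD(5)[OF that] by (simp add: line_def)
  \<comment> \<open>the lines after the move are the old lines after a half turn, traversed backwards\<close>
  have mirror: "cis (2 * pi / 3) ^ i * Complex s (1 / 4) = - line i (- s)" for i s
  proof -
    have "Complex s (1 / 4) = - Complex (- s) (- 1 / 4)" by (simp add: complex_eq_iff)
    then show ?thesis by (simp add: line_def)
  qed
  have st': "strand D' (a i) (b i) (\<lambda>s. \<psi>' (- line i (- e i * s)))" if "i < 3" for i
    using lcD(6)[OF that] unfolding mirror by simp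
  have ball: "\<psi> ` cball 0 1 = (\<lambda>z. \<psi>' (- z)) ` cball 0 1"
  proof -
    have "\<psi>' x \<in> (\<lambda>z. \<psi>' (- z)) ` cball 0 1" "\<psi>' (- x) \<in> \<psi>' ` cball 0 1" if "x \<in> cball 0 1" for x
      using that image_eqI[of "\<psi>' x" "\<lambda>z. \<psi>' (- z)" "- x" "cball 0 1"] by auto
    then have "(\<lambda>z. \<psi>' (- z)) ` cball 0 1 = \<psi>' ` cball 0 1" by blast
    then show ?thesis using lcD(3) by simp
  qed
  have vi: "v i = \<psi> (corner i)" "v i \<in> crossings D" "v' i = \<psi>' (- corner i)" "v' i \<in> crossings D'" if "i < 3" for i
    using v cr that by (auto simp: corner_def)
  have me: "- e i = 1 \<or> - e i = - 1" if "i < 3" for i using lcD(4)[OF that] by auto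
  note T = lines_triangle[OF refl D(1) lcD(1,4) st vi(1,2) disc(1) refl]
  note T' = lines_triangle[OF refl D(2) op_diffeo_rotate[OF lcD(2)] me st' vi(3,4) disc(2) ball]
  obtain P Q where PQ: "triangle D (\<lambda>i. e i = 1) P Q v" "only_passages D P Q" using T(1) by blast
  obtain P' Q' where PQ': "triangle D' (\<lambda>i. - e i = 1) P' Q' v'" "only_passages D' P' Q'" using T'(1) by blast
  have "triangle D' (\<lambda>i. - e i = 1) P' Q' v' = triangle D' (\<lambda>i. \<not> e i = 1) P' Q' v'"
    by (rule triangle_cong) (use lcD(4) in force)
  then have PQ'': "triangle D' (\<lambda>i. \<not> e i = 1) P' Q' v'" using PQ'(1) by simp
  have out: "outer D D' u" if "u \<in> crossings D - v ` {..<3}" for u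
  proof -
    have "u \<notin> \<psi> ` cball 0 1" using T(2)[of u] that by blast
    moreover have "u \<in> crossings D'" using cr that by blast
    ultimately show ?thesis using local_change_outer[OF lc D] that by blast
  qed
  have "triangle_move a b D D' (\<lambda>i. e i = 1) P Q P' Q' v v'"
    by unfold_locales (use D PQ PQ'(2) PQ'' out cr in auto)
  then show thesis by (rule that)
qed


section \<open>Products of powers in an abelian group\<close>

context comm_group
begin

lemma finprod_int_pow_sum:
  assumes "x \<in> carrier G"
  shows "(\<Otimes>v\<in>V. x [^] (f v :: int)) = x [^] (\<Sum>v\<in>V. f v)"
  by (induction V rule: infinite_finite_induct) (simp_all add: assms int_pow_mult Pi_def)

lemma finprod_int_pow_add:
  assumes "x \<in> V \<rightarrow> carrier G"
  shows "(\<Otimes>v\<in>V. x v [^] (f v + g v :: int)) = (\<Otimes>v\<in>V. x v [^] f v) \<otimes> (\<Otimes>v\<in>V. x v [^] g v)"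
proof -
  have "(\<Otimes>v\<in>V. x v [^] (f v + g v)) = (\<Otimes>v\<in>V. x v [^] f v \<otimes> x v [^] g v)"
    using assms by (intro finprod_cong') (auto simp: int_pow_mult Pi_def)
  then show ?thesis using assms by (simp add: Pi_def)
qed

lemma finprod_int_pow_scale:
  assumes "x \<in> V \<rightarrow> carrier G"
  shows "(\<Otimes>v\<in>V. x v [^] (c * f v :: int)) = (\<Otimes>v\<in>V. x v [^] f v) [^] c"
  using assms
proof (induction V rule: infinite_finite_induct)
  case (insert v V)
  then show ?case
    by (simp add: int_pow_distrib int_pow_pow mult.commute Pi_def)
qed (simp_all add: int_pow_one)

lemma finprod_int_pow_lincomb:
  assumes "finite I" "x \<in> V \<rightarrow> carrier G"
  shows "(\<Otimes>i\<in>I. (\<Otimes>v\<in>V. x v [^] (f i v :: int)) [^] (c i :: int)) = (\<Otimes>v\<in>V. x v [^] (\<Sum>i\<in>I. c i * f i v))"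
  using assms(1)
proof (induction I rule: finite_induct)
  case (insert i I)
  have *: "(\<Otimes>v\<in>V. x v [^] f i v) \<in> carrier G" for i
    using assms(2) by (intro finprod_closed) auto
  have "(\<Otimes>v\<in>V. x v [^] (\<Sum>j\<in>insert i I. c j * f j v)) = (\<Otimes>v\<in>V. x v [^] (c i * f i v + (\<Sum>j\<in>I. c j * f j v)))"
    using insert(1,2) by simp
  also have "\<dots> = (\<Otimes>v\<in>V. x v [^] (c i * f i v)) \<otimes> (\<Otimes>v\<in>V. x v [^] (\<Sum>j\<in>I. c j * f j v))"
    by (rule finprod_int_pow_add[OF assms(2)])
  finally show ?case
    using insert * by (simp add: finprod_int_pow_scale[OF assms(2)] Pi_def)
qed simp

text \<open>
  The inverse is the shear by the inverse of \<open>\<delta>\<close>.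
\<close>

lemma shear_iso:
  assumes \<delta>: "\<delta> \<in> carrier G"
  shows "(\<lambda>(x, y). (x \<otimes> \<delta> [^] y, y)) \<in> iso (G \<times>\<times> integer_group) (G \<times>\<times> integer_group)"
proof (rule isoI)
  show "(\<lambda>(x, y). (x \<otimes> \<delta> [^] y, y)) \<in> hom (G \<times>\<times> integer_group) (G \<times>\<times> integer_group)"
    using \<delta> by (auto simp: hom_def int_pow_mult m_ac)
  show "bij_betw (\<lambda>(x, y). (x \<otimes> \<delta> [^] y, y)) (carrier (G \<times>\<times> integer_group)) (carrier (G \<times>\<times> integer_group))"
    by (rule bij_betw_byWitness[where f' = "\<lambda>(x, y). (x \<otimes> inv (\<delta> [^] y), y)"])
      (use \<delta> in \<open>auto simp: m_assoc\<close>)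
qed

end

lemma partial_iso_total:
  assumes "\<phi> \<in> iso G H" "group G" "group H"
  shows "partial_iso G H ((Some \<circ> \<phi>) |` carrier G)"
proof -
  have bij: "bij_betw \<phi> (carrier G) (carrier H)" and hom: "\<phi> \<in> hom G H" using assms(1) by (auto simp: iso_def)
  have dom: "dom ((Some \<circ> \<phi>) |` carrier G) = carrier G" by auto
  have ran: "ran ((Some \<circ> \<phi>) |` carrier G) = carrier H"
  proof -
    have "ran ((Some \<circ> \<phi>) |` carrier G) = \<phi> ` carrier G"
      by (force simp: ran_def restrict_map_def split: if_splits)
    then show ?thesis using bij by (simp add: bij_betw_def)
  qed
  have "(\<lambda>x. the (((Some \<circ> \<phi>) |` carrier G) x)) \<in> iso G H"
  proof (rule isoI)
    show "(\<lambda>x. the (((Some \<circ> \<phi>) |` carrier G) x)) \<in> hom G H"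
      using hom group.is_monoid[OF assms(2)] by (auto simp: hom_def monoid.m_closed)
    show "bij_betw (\<lambda>x. the (((Some \<circ> \<phi>) |` carrier G) x)) (carrier G) (carrier H)"
      using bij by (subst bij_betw_cong[where g = \<phi>]) auto
  qed
  then show ?thesis
    unfolding partial_iso_def dom ran using group.subgroup_self[OF assms(2)] group.subgroup_self[OF assms(3)] by simp
qed


section \<open>Quasi-indices on a virtual knot\<close>

lemma virtual_knots_diagram:
  assumes "K \<in> virtual_knots" "D \<in> K"
  shows "diagram D"
  using assms by (auto simp: virtual_knots_def quotient_def)

abbreviation linked :: "vdiagram \<Rightarrow> vdiagram \<Rightarrow> bool" where
  "linked \<equiv> equivclp (\<lambda>E E'. \<exists>f. is_move E f E')"

lemma virtual_knots_closed:
  assumes "K \<in> virtual_knots" "D \<in> K"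
  shows "D' \<in> K \<longleftrightarrow> diagram D' \<and> linked D D'"
proof -
  obtain E where "diagram E" and K: "K = {D'. diagram D' \<and> linked E D'}"
    using assms(1) by (auto simp: virtual_knots_def quotient_def)
  then have "linked E D" using assms(2) by simp
  then have "linked E D' \<longleftrightarrow> linked D D'"
    using equivclp_trans[OF \<open>linked E D\<close>] equivclp_trans[OF equivclp_sym[OF \<open>linked E D\<close>]] by iprover
  then show ?thesis unfolding K by simp
qed

locale knot_quasi_index = comm_group A for A (structure) +
  fixes K :: "vdiagram set" and \<pi> :: "vdiagram \<Rightarrow> complex \<Rightarrow> 'a"
  assumes knot: "K \<in> virtual_knots" and quasi: "quasi_index A K \<pi>"
begin

lemma diagram_K: "D \<in> K \<Longrightarrow> diagram D"
  by (rule virtual_knots_diagram[OF knot])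

lemma move_K:
  assumes "D \<in> K" "is_move D f D'"
  shows "D' \<in> K"
  using assms virtual_knots_closed[OF knot assms(1)] by (auto simp: is_move_def)

lemmas quasi_conjuncts = quasi[unfolded quasi_index_def]

lemmas \<pi>_closed = quasi_conjuncts[THEN conjunct1, rule_format]

lemmas \<pi>_bigon = quasi_conjuncts[THEN conjunct2, THEN conjunct2, THEN conjunct1, rule_format]

lemmas \<pi>_triangle = quasi_conjuncts[THEN conjunct2, THEN conjunct2, THEN conjunct2, rule_format]

lemma \<pi>_fun: "D \<in> K \<Longrightarrow> \<pi> D \<in> crossings D \<rightarrow> carrier A"
  using \<pi>_closed by blast

lemma \<pi>_survivor:
  assumes "D \<in> K" "is_move D f D'" "v \<notin> participants f" "corr D f v = Some w"
  shows "\<pi> D' w = \<pi> D v"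
  by (rule quasi_conjuncts[THEN conjunct2, THEN conjunct1, rule_format, symmetric]) (use assms in auto)

text \<open>
  In additive notation, the sum of \<open>f(v) \<pi>(v)\<close> over all crossings. The parity has this form, and so,
  up to sign, has the signature.
\<close>

definition weighted :: "vdiagram \<Rightarrow> (complex \<Rightarrow> int) \<Rightarrow> 'a" where
  "weighted D f = (\<Otimes>v\<in>crossings D. \<pi> D v [^] f v)"

abbreviation parity :: "vdiagram \<Rightarrow> complex \<Rightarrow> 'a" where
  "parity D v \<equiv> weighted D (\<lambda>w. left_right D v w)"

lemma weighted_closed: "D \<in> K \<Longrightarrow> weighted D f \<in> carrier A"
  unfolding weighted_def using \<pi>_closed by (intro finprod_closed) auto

lemma signature_weighted: "signature A \<pi> D = inv (weighted D (index_parity D))"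
  by (simp add: signature_def weighted_def)

lemma signature_closed: "D \<in> K \<Longrightarrow> signature A \<pi> D \<in> carrier A"
  by (simp add: signature_weighted weighted_closed)

text \<open>
  The effect of a move on the parity before passing to the quotient: corresponding crossings have the same
  index, and the parity changes by \<open>\<delta>\<close> times the index. The signature is included since it is obtained by the same
  computation, and its invariance is needed for the quotient to make sense.
\<close>

definition parity_shift :: "vdiagram \<Rightarrow> vdiagram \<Rightarrow> (complex \<rightharpoonup> complex) \<Rightarrow> 'a \<Rightarrow> bool" where
  "parity_shift D D' \<kappa> \<delta> \<longleftrightarrow> \<delta> \<in> carrier A \<and> signature A \<pi> D' = signature A \<pi> D \<and>
     (\<forall>u w. \<kappa> u = Some w \<longrightarrow> u \<in> crossings D \<and> w \<in> crossings D' \<and>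
        index_parity D' w = index_parity D u \<and> parity D' w = parity D u \<otimes> \<delta> [^] index_parity D u)"

text \<open>
  New crossings \<open>N\<close>, all of weight \<open>l\<close>, on a relation with coefficients 1. They add \<open>l\<close> times \<open>\<Sum> L_u \<cdot> R_v\<close> over \<open>v\<close> in \<open>N\<close>
  to the parity of \<open>u\<close>, and \<open>l\<close> times the sum of their indices, which is 0, to the signature.
\<close>

lemma shift_extension:
  assumes K: "D \<in> K" "D' \<in> K"
    and N: "crossings D' = crossings D \<union> N" "crossings D \<inter> N = {}"
    and \<pi>: "\<And>u. u \<in> crossings D \<Longrightarrow> \<pi> D' u = \<pi> D u" "\<And>u. u \<in> N \<Longrightarrow> \<pi> D' u = l" and l: "l \<in> carrier A"
    and same: "\<And>u w. u \<in> crossings D \<Longrightarrow> w \<in> crossings D \<Longrightarrow> left_right D' u w = left_right D u w"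
      "\<And>u. u \<in> crossings D \<Longrightarrow> index_parity D' u = index_parity D u"
    and null: "\<And>E. cycle D' E \<Longrightarrow> intersection D' (relation_chain D' N (\<lambda>_. 1) id k) E = 0"
  shows "parity_shift D D' (Some |` crossings D) (inv (l [^] k))"
proof -
  note dK = diagram_K[OF K(1)] diagram_K[OF K(2)]
  have fin: "finite (crossings D)" "finite N" using finite_crossings[OF dK(2)] N(1) by auto
  note rel = relation_consequences[OF dK(2) _ null, simplified]
  have split: "weighted D' f = weighted D f \<otimes> l [^] (\<Sum>v\<in>N. f v)" for f
  proof -
    have "weighted D' f = (\<Otimes>v\<in>crossings D. \<pi> D' v [^] f v) \<otimes> (\<Otimes>v\<in>N. \<pi> D' v [^] f v)"
      unfolding weighted_def N(1) using fin N \<pi>_closed[OF K(2)]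
      by (intro finprod_Un_disjoint) auto
    also have "(\<Otimes>v\<in>crossings D. \<pi> D' v [^] f v) = weighted D f"
      unfolding weighted_def using \<pi>(1) \<pi>_closed[OF K(1)] by (intro finprod_cong') auto
    also have "(\<Otimes>v\<in>N. \<pi> D' v [^] f v) = (\<Otimes>v\<in>N. l [^] f v)"
      using \<pi>(2) l by (intro finprod_cong') auto
    finally show ?thesis by (simp add: finprod_int_pow_sum[OF l])
  qed
  have cong: "weighted D f = weighted D g" if "\<And>v. v \<in> crossings D \<Longrightarrow> f v = g v" for f g
    unfolding weighted_def using that \<pi>_closed[OF K(1)] by (intro finprod_cong') auto
  have "weighted D' (index_parity D') = weighted D (index_parity D) \<otimes> l [^] (0::int)"
    unfolding split using rel(3) N(1) cong[of "index_parity D'" "index_parity D"] same(2) by simp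
  then have sig: "signature A \<pi> D' = signature A \<pi> D"
    using weighted_closed[OF K(1)] by (simp add: signature_weighted)
  have "parity D' u = parity D u \<otimes> inv (l [^] k) [^] index_parity D u" if u: "u \<in> crossings D" for u
  proof -
    have "(\<Sum>v\<in>N. left_right D' u v) = - k * index_parity D u"
      using rel(1)[of u] N(1) same(2) u by simp
    then have "parity D' u = parity D u \<otimes> l [^] (- k * index_parity D u)"
      unfolding split using cong[of "left_right D' u" "left_right D u"] same(1) u by simp
    also have "l [^] (- k * index_parity D u) = inv (l [^] k) [^] index_parity D u"
      using l by (simp add: int_pow_neg[symmetric] int_pow_pow)
    finally show ?thesis .
  qed
  then show ?thesis
    unfolding parity_shift_def using sig l same(2) N(1) by (auto simp: restrict_map_def split: if_splits)
qed

text \<open>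
  The crossings correspond to each other and keep their intersection numbers, but the weights change by
  multiples \<open>s u\<close> of \<open>l\<close>. The sum of \<open>s\<close> times the right halves is equivalent to \<open>k\<close> times the whole cycle.
\<close>

lemma shift_bijection:
  assumes K: "D \<in> K" "D' \<in> K"
    and c: "crossings D' = c ` crossings D" "inj_on c (crossings D)"
    and \<pi>: "\<And>u. u \<in> crossings D \<Longrightarrow> \<pi> D' (c u) = \<pi> D u \<otimes> l [^] (s u :: int)" and l: "l \<in> carrier A"
    and same: "\<And>u w. u \<in> crossings D \<Longrightarrow> w \<in> crossings D \<Longrightarrow> left_right D' (c u) (c w) = left_right D u w"
      "\<And>u. u \<in> crossings D \<Longrightarrow> index_parity D' (c u) = index_parity D u"
    and rel: "\<And>u. u \<in> crossings D \<Longrightarrow> (\<Sum>w\<in>crossings D. s w * left_right D u w) = - k * index_parity D u"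
      "(\<Sum>w\<in>crossings D. s w * index_parity D w) = 0"
  shows "parity_shift D D' ((Some \<circ> c) |` crossings D) (inv (l [^] k))"
proof -
  have carry: "weighted D' f = weighted D (\<lambda>v. f (c v)) \<otimes> l [^] (\<Sum>v\<in>crossings D. s v * f (c v))" for f
  proof -
    have "weighted D' f = (\<Otimes>v\<in>crossings D. \<pi> D' (c v) [^] f (c v))"
      unfolding weighted_def c(1) using c \<pi>_closed[OF K(2)] by (intro finprod_reindex) auto
    also have "\<dots> = (\<Otimes>v\<in>crossings D. \<pi> D v [^] f (c v) \<otimes> l [^] (s v * f (c v)))"
      using \<pi> \<pi>_closed[OF K(1)] l
      by (intro finprod_cong') (auto simp: int_pow_distrib int_pow_pow)
    also have "\<dots> = weighted D (\<lambda>v. f (c v)) \<otimes> (\<Otimes>v\<in>crossings D. l [^] (s v * f (c v)))"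
      unfolding weighted_def using \<pi>_closed[OF K(1)] l by (intro finprod_multf) auto
    finally show ?thesis by (simp add: finprod_int_pow_sum[OF l])
  qed
  have cong: "weighted D f = weighted D g" if "\<And>v. v \<in> crossings D \<Longrightarrow> f v = g v" for f g
    unfolding weighted_def using that \<pi>_closed[OF K(1)] by (intro finprod_cong') auto
  have "weighted D' (index_parity D') = weighted D (index_parity D) \<otimes> l [^] (0::int)"
  proof -
    have "(\<Sum>v\<in>crossings D. s v * index_parity D' (c v)) = 0" using rel(2) same(2) by simp
    then show ?thesis unfolding carry using cong[of "\<lambda>v. index_parity D' (c v)" "index_parity D"] same(2) by simp
  qed
  then have sig: "signature A \<pi> D' = signature A \<pi> D"
    using weighted_closed[OF K(1)] by (simp add: signature_weighted)
  have "parity D' (c u) = parity D u \<otimes> inv (l [^] k) [^] index_parity D u" if u: "u \<in> crossings D" for u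
  proof -
    have "(\<Sum>v\<in>crossings D. s v * left_right D' (c u) (c v)) = - k * index_parity D u" using rel(1)[OF u] same(1) u by simp
    then have "parity D' (c u) = parity D u \<otimes> l [^] (- k * index_parity D u)"
      unfolding carry using cong[of "\<lambda>v. left_right D' (c u) (c v)" "left_right D u"] same(1) u by simp
    also have "l [^] (- k * index_parity D u) = inv (l [^] k) [^] index_parity D u"
      using l by (simp add: int_pow_neg[symmetric] int_pow_pow)
    finally show ?thesis .
  qed
  then show ?thesis
    unfolding parity_shift_def using sig l same(2) c(1) by (auto simp: restrict_map_def split: if_splits)
qed

lemma shift_inverse:
  assumes "D \<in> K" "parity_shift D D' (Some |` crossings D) \<delta>"
  shows "parity_shift D' D (Some |` crossings D) (inv \<delta>)"
proof -
  have "parity D u = parity D' u \<otimes> inv \<delta> [^] index_parity D' u" if "u \<in> crossings D" for u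
  proof -
    have \<delta>: "\<delta> \<in> carrier A" and eq: "index_parity D' u = index_parity D u" "parity D' u = parity D u \<otimes> \<delta> [^] index_parity D u"
      using assms(2) that by (auto simp: parity_shift_def restrict_map_def)
    then show ?thesis using weighted_closed[OF assms(1)]
      by (simp add: m_assoc int_pow_inv)
  qed
  then show ?thesis
    using assms(2) by (auto simp: parity_shift_def restrict_map_def split: if_splits)
qed

lemma shift_R1:
  assumes K: "D \<in> K" and m: "is_move D (R1_inc a b v) D'"
  shows "parity_shift D D' (Some |` crossings D) (increment A \<pi> D (R1_inc a b v) D')"
proof -
  have K': "D' \<in> K" by (rule move_K[OF K m])
  note D = diagram_K[OF K] diagram_K[OF K']
  have "r1_increasing a b v D D'" using m by (simp add: is_move_def)
  then obtain x y where k: "kink D' v x y" "strands 1 (\<lambda>_. a) (\<lambda>_. b)" "v \<notin> crossings D"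
    "\<forall>u\<in>crossings D. strands.outer 1 (\<lambda>_. a) (\<lambda>_. b) D D' u" "crossings D' = insert v (crossings D)"
    "loop_is_left_half D' a b v \<longleftrightarrow> se D' v = frac x"
    by (rule r1_increasing_kink[OF D])
  interpret S: strands 1 "\<lambda>_. a" "\<lambda>_. b" by (rule k(2))
  have N: "crossings D' = crossings D \<union> {v}" "crossings D \<inter> {v} = {}" using k by auto
  have same: "left_right D' u w = left_right D u w" "index_parity D' u = index_parity D u"
    if "u \<in> crossings D" "w \<in> crossings D" for u w
    using S.intersections_outer[OF D bspec[OF k(4)] N _ that] vertex_term_kink[OF D(2) k(1)] by simp_all
  have \<pi>: "\<pi> D' u = \<pi> D u" if "u \<in> crossings D" for u
    by (rule \<pi>_survivor[OF K m]) (use that in auto)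
  have c: "\<pi> D' v \<in> carrier A" using \<pi>_closed[OF K'] N by simp
  have "parity_shift D D' (Some |` crossings D) (inv (\<pi> D' v [^] (if se D' v = frac x then 1 else 0 :: int)))"
    by (rule shift_extension[OF K K' N]) (use \<pi> same kink_relation[OF D(2) k(1)] c in auto)
  then show ?thesis using k(6) c by (auto split: if_splits)
qed

lemma shift_R2:
  assumes K: "D \<in> K" and m: "is_move D (R2_inc v\<^sub>1 v\<^sub>2) D'"
  shows "parity_shift D D' (Some |` crossings D) (increment A \<pi> D (R2_inc v\<^sub>1 v\<^sub>2) D')"
proof -
  have K': "D' \<in> K" by (rule move_K[OF K m])
  note D = diagram_K[OF K] diagram_K[OF K']
  have "r2_increasing v\<^sub>1 v\<^sub>2 D D'" using m by (simp add: is_move_def)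
  then obtain a b x y l n where B: "bigon_move a b D D' x y l n v\<^sub>1 v\<^sub>2"
    by (rule r2_increasing_bigon[OF D])
  interpret B: bigon_move a b D D' x y l n v\<^sub>1 v\<^sub>2 by (rule B)
  have N: "crossings D' = crossings D \<union> {v\<^sub>1, v\<^sub>2}" "crossings D \<inter> {v\<^sub>1, v\<^sub>2} = {}" using B.rest by auto
  have \<pi>: "\<pi> D' u = \<pi> D u" if "u \<in> crossings D" for u
    by (rule \<pi>_survivor[OF K m]) (use that in auto)
  have "is_move D' (R2_dec v\<^sub>1 v\<^sub>2) D" using m by (simp add: is_move_def)
  then have "\<pi> D' v\<^sub>2 = \<pi> D' v\<^sub>1" by (rule \<pi>_bigon[OF K', symmetric])
  moreover have c: "\<pi> D' v\<^sub>1 \<in> carrier A" using \<pi>_closed[OF K'] N by simp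
  ultimately have "parity_shift D D' (Some |` crossings D) (inv (\<pi> D' v\<^sub>1 [^] (1::int)))"
    by (intro shift_extension[OF K K' N]) (use \<pi> B.intersections_unchanged B.bigon_relation in auto)
  then show ?thesis using c by simp
qed

text \<open>
  A corner sign is \<open>1\<close> or \<open>- 1\<close>, so already a single corner determines \<open>\<lambda>(f)\<close>.
\<close>

lemma r3_lambda_spec:
  assumes K: "D \<in> K" and m: "is_move D (R3 a b v v') D'"
  defines "l \<equiv> r3_lambda A \<pi> D D' a b v v'"
  shows "l \<in> carrier A" "i < 3 \<Longrightarrow> \<pi> D' (v' i) = \<pi> D (v i) \<otimes> l [^] corner_sign D (sides D a b) (v i)"
proof -
  obtain j where j: "j \<in> carrier A" "\<forall>i<3. \<pi> D' (v' i) = \<pi> D (v i) \<otimes> j [^] corner_sign D (sides D a b) (v i)"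
    using \<pi>_triangle[OF K m] by blast
  have "r3 a b v v' D D'" using m by (simp add: is_move_def)
  then have "v ` {..<3} \<subseteq> crossings D" by (simp only: r3_def)
  then have "v 0 \<in> crossings D" by auto
  then have v0: "\<pi> D (v 0) \<in> carrier A" by (rule \<pi>_closed[OF K])
  have "l = j" unfolding l_def r3_lambda_def
  proof (rule the_equality)
    fix h assume h: "h \<in> carrier A \<and> (\<forall>i<3. \<pi> D' (v' i) = \<pi> D (v i) \<otimes> h [^] corner_sign D (sides D a b) (v i))"
    then have "\<pi> D (v 0) \<otimes> h [^] corner_sign D (sides D a b) (v 0) = \<pi> D (v 0) \<otimes> j [^] corner_sign D (sides D a b) (v 0)"
      using j(2) by (metis zero_less_numeral)
    then have "h [^] corner_sign D (sides D a b) (v 0) = j [^] corner_sign D (sides D a b) (v 0)"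
      using h j(1) v0 by simp
    moreover have "corner_sign D (sides D a b) (v 0) = 1 \<or> corner_sign D (sides D a b) (v 0) = - 1"
      by (simp add: corner_sign_def)
    ultimately have "h = j \<or> inv h = inv j" using h j(1) by (auto simp only: int_pow_neg int_pow_1)
    then show "h = j" using h j(1) by (metis inv_inv)
  qed (use j in blast)
  then show "l \<in> carrier A" "i < 3 \<Longrightarrow> \<pi> D' (v' i) = \<pi> D (v i) \<otimes> l [^] corner_sign D (sides D a b) (v i)"
    using j by auto
qed

lemma shift_R3:
  assumes K: "D \<in> K" and m: "is_move D (R3 a b v v') D'"
  shows "parity_shift D D' (corr D (R3 a b v v')) (increment A \<pi> D (R3 a b v v') D')"
proof -
  have K': "D' \<in> K" by (rule move_K[OF K m])
  note D = diagram_K[OF K] diagram_K[OF K']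
  have "r3 a b v v' D D'" using m by (simp add: is_move_def)
  then obtain e P Q P' Q' where T: "triangle_move a b D D' e P Q P' Q' v v'"
    by (rule r3_triangle_move[OF D])
  interpret T: triangle_move a b D D' e P Q P' Q' v v' by (rule T)
  have vD: "v ` {..<3} \<subseteq> crossings D" "v' ` {..<3} \<subseteq> crossings D'" and inj: "inj_on v {..<3}" "inj_on v' {..<3}"
    using T.T T.T' by (auto simp: triangle_def)
  have carry: "T.carry (v i) = v' i" if "i < 3" for i
    using that inj(1) by (simp add: T.carry_def the_inv_into_f_f)
  have stay: "T.carry u = u" if "u \<notin> v ` {..<3}" for u using that by (simp add: T.carry_def)
  have img: "T.carry ` v ` {..<3} = v' ` {..<3}" using carry by (auto simp: image_iff)
  have "T.carry ` (crossings D - v ` {..<3}) = (\<lambda>u. u) ` (crossings D - v ` {..<3})"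
    by (rule image_cong) (use stay in auto)
  then have "T.carry ` (crossings D - v ` {..<3}) = crossings D' - v' ` {..<3}" using T.rest by simp
  moreover have "T.carry ` crossings D = T.carry ` v ` {..<3} \<union> T.carry ` (crossings D - v ` {..<3})"
    using vD(1) by blast
  ultimately have cimg: "crossings D' = T.carry ` crossings D" using img vD(2) by auto
  \<comment> \<open>a surjection between finite sets of equal cardinality is injective\<close>
  have "card (crossings D') = card (crossings D)"
  proof -
    have "card (crossings D - v ` {..<3}) = card (crossings D) - 3" "card (crossings D' - v' ` {..<3}) = card (crossings D') - 3"
      using vD inj by (simp_all add: card_Diff_subset card_image)
    moreover have "3 \<le> card (crossings D)" "3 \<le> card (crossings D')"
      using card_mono[OF finite_crossings[OF D(1)] vD(1)] card_mono[OF finite_crossings[OF D(2)] vD(2)] inj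
      by (simp_all add: card_image)
    ultimately show ?thesis using T.rest by simp
  qed
  then have cinj: "inj_on T.carry (crossings D)"
    using cimg finite_crossings[OF D(1)] by (metis eq_card_imp_inj_on)
  let ?eps = "corner_sign D (sides D a b)" and ?k = "r3_coefficient D a b v" and ?l = "r3_lambda A \<pi> D D' a b v v'"
  \<comment> \<open>the weights change by the corner signs at the corners of the triangle, and not at all elsewhere\<close>
  define s where "s = (\<lambda>u. if u \<in> v ` {..<3} then ?eps u else 0)"
  have sum_s: "(\<Sum>w\<in>crossings D. s w * f w) = (\<Sum>i<3. ?eps (v i) * f (v i))" for f
  proof -
    have "(\<Sum>w\<in>crossings D. s w * f w) = (\<Sum>w\<in>v ` {..<3}. ?eps w * f w)"
      using vD(1) finite_crossings[OF D(1)] by (intro sum.mono_neutral_cong_right) (auto simp: s_def)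
    then show ?thesis using inj(1) by (simp add: sum.reindex)
  qed
  note rel = relation_consequences[OF D(1) vD(1) T.triangle_relation]
  have \<pi>: "\<pi> D' (T.carry u) = \<pi> D u \<otimes> ?l [^] s u" if u: "u \<in> crossings D" for u
  proof (cases "u \<in> v ` {..<3}")
    case True
    then obtain i where "i < 3" "u = v i" by auto
    then show ?thesis using r3_lambda_spec(2)[OF K m] carry by (simp add: s_def)
  next
    case False
    then have "\<pi> D' u = \<pi> D u" using u by (intro \<pi>_survivor[OF K m]) auto
    then show ?thesis using False u stay \<pi>_closed[OF K] by (simp add: s_def)
  qed
  have "parity_shift D D' ((Some \<circ> T.carry) |` crossings D) (inv (?l [^] ?k))"
    using T.intersections_carry rel sum_s
    by (intro shift_bijection[where s = s, OF K K' cimg cinj \<pi> r3_lambda_spec(1)[OF K m]]) auto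
  moreover have "corr D (R3 a b v v') = (Some \<circ> T.carry) |` crossings D"
    using vD(1) by (auto simp: fun_eq_iff T.carry_def restrict_map_def)
  ultimately show ?thesis by simp
qed

lemma shift_isotopy:
  assumes K: "D \<in> K" and m: "is_move D (Isotopy h) D'"
  shows "parity_shift D D' (corr D (Isotopy h)) \<one>"
proof -
  have K': "D' \<in> K" by (rule move_K[OF K m])
  note D = diagram_K[OF K] diagram_K[OF K']
  have "isotopy h D D'" using m by (simp add: is_move_def)
  note iso = isotopy_intersections[OF D this]
  have \<pi>: "\<pi> D' (h u) = \<pi> D u" if "u \<in> crossings D" for u
    by (rule \<pi>_survivor[OF K m]) (use that in auto)
  have "parity_shift D D' ((Some \<circ> h) |` crossings D) (inv (\<one> [^] (0::int)))"
    using iso \<pi> \<pi>_closed[OF K]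
    by (intro shift_bijection[where s = "\<lambda>_. 0", OF K K']) (auto intro: inj_on_subset)
  then show ?thesis by simp
qed

lemma shift_detour:
  assumes K: "D \<in> K" and m: "is_move D Detour D'"
  shows "parity_shift D D' (Some |` crossings D) \<one>"
proof -
  have K': "D' \<in> K" by (rule move_K[OF K m])
  note D = diagram_K[OF K] diagram_K[OF K']
  have det: "detour D D'" using m by (simp add: is_move_def)
  then have cr: "crossings D' = crossings D" by (simp add: detour_def)
  have \<pi>: "\<pi> D' u = \<pi> D u" if "u \<in> crossings D" for u
    by (rule \<pi>_survivor[OF K m]) (use that in auto)
  have "parity_shift D D' (Some |` crossings D) (inv (\<one> [^] (0::int)))"
    using detour_intersections[OF D det] \<pi> cr
    by (intro shift_extension[where N = "{}", OF K K']) (auto simp: relation_chain_def intersection_zero_left)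
  then show ?thesis by simp
qed

text \<open>
  The inverse of a decreasing move is increasing, and the shear by the inverse increment undoes the shear.
\<close>

theorem move_shift:
  assumes K: "D \<in> K" and m: "is_move D f D'"
  shows "parity_shift D D' (corr D f) (increment A \<pi> D f D')"
proof -
  have K': "D' \<in> K" by (rule move_K[OF K m])
  show ?thesis
  proof (cases f)
    case (Isotopy h)
    then show ?thesis using shift_isotopy[OF K, of h D'] m by simp
  next
    case Detour
    then show ?thesis using shift_detour[OF K, of D'] m by simp
  next
    case (R1_inc a b v)
    then show ?thesis using shift_R1[OF K, of a b v D'] m by simp
  next
    case (R1_dec a b v)
    then have m': "is_move D' (R1_inc a b v) D" using m by (simp add: is_move_def)
    have "r1_increasing a b v D' D" using m' by (simp add: is_move_def)
    then have "crossings D - {v} = crossings D'"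
      by (rule r1_increasing_kink[OF diagram_K[OF K'] diagram_K[OF K]]) simp
    then show ?thesis using shift_inverse[OF K' shift_R1[OF K' m']] R1_dec by simp
  next
    case (R2_inc v\<^sub>1 v\<^sub>2)
    then show ?thesis using shift_R2[OF K, of v\<^sub>1 v\<^sub>2 D'] m by simp
  next
    case (R2_dec v\<^sub>1 v\<^sub>2)
    then have m': "is_move D' (R2_inc v\<^sub>1 v\<^sub>2) D" using m by (simp add: is_move_def)
    have "r2_increasing v\<^sub>1 v\<^sub>2 D' D" using m' by (simp add: is_move_def)
    then obtain a b x y l n where "bigon_move a b D' D x y l n v\<^sub>1 v\<^sub>2"
      by (rule r2_increasing_bigon[OF diagram_K[OF K'] diagram_K[OF K]])
    then have "crossings D - {v\<^sub>1, v\<^sub>2} = crossings D'" using bigon_move.rest[of a b D' D x y l n v\<^sub>1 v\<^sub>2] by auto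
    then show ?thesis using shift_inverse[OF K' shift_R2[OF K' m']] R2_dec by simp
  next
    case (R3 a b v v')
    then show ?thesis using shift_R3[OF K, of a b v v' D'] m by simp
  qed
qed

text \<open>
  A virtual knot is connected by moves, in both directions, and it contains all diagrams on the way.
\<close>

theorem signature_invariant:
  assumes "D \<in> K" "D' \<in> K"
  shows "signature A \<pi> D' = signature A \<pi> D"
proof -
  have "linked D D'"
    using iffD1[OF virtual_knots_closed[OF knot assms(1)] assms(2)] by (rule conjunct2)
  then have "D' \<in> K \<and> signature A \<pi> D' = signature A \<pi> D"
  proof (induction rule: equivclp_induct)
    case base
    then show ?case using assms(1) by simp
  next
    case (step E F)
    then consider f where "is_move E f F" | f where "is_move F f E" by blast
    then show ?case
    proof cases
      case 1
      then show ?thesis using move_shift[of E f F] move_K[of E f F] step.IH by (auto simp: parity_shift_def)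
    next
      case 2
      then have "linked E F" by (intro converse_r_into_equivclp exI)
      moreover have "diagram F" using 2 by (simp add: is_move_def)
      ultimately have "F \<in> K" using virtual_knots_closed[OF knot, of E F] step.IH by simp
      then show ?thesis using move_shift[of F f E] 2 step.IH by (auto simp: parity_shift_def)
    qed
  qed
  then show ?thesis by simp
qed

text \<open>
  Exchange the two sums: the combination of the parities is the quasi-index weighted with
  \<open>\<Sum> c_i (L\<^bsub>w_i\<^esub> \<cdot> R_u) = (k - \<Sum> c_i) ip(u)\<close>, hence a multiple of the signature.
\<close>

lemma relation_parity:
  assumes K: "D \<in> K" and I: "finite I" "w ` I \<subseteq> crossings D"
    and null: "\<And>E. cycle D E \<Longrightarrow> intersection D (relation_chain D I c w k) E = 0"
  shows "(\<Otimes>i\<in>I. parity D (w i) [^] c i) = signature A \<pi> D [^] (sum c I - k)"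
    "(\<Sum>i\<in>I. c i * index_parity D (w i)) = 0"
proof -
  note rel = relation_consequences[OF diagram_K[OF K] I(2) null]
  show "(\<Sum>i\<in>I. c i * index_parity D (w i)) = 0" by (rule rel(3))
  have "(\<Otimes>i\<in>I. parity D (w i) [^] c i) = weighted D (\<lambda>u. \<Sum>i\<in>I. c i * left_right D (w i) u)"
    unfolding weighted_def by (rule finprod_int_pow_lincomb[OF I(1) \<pi>_fun[OF K]])
  also have "\<dots> = weighted D (\<lambda>u. (k - sum c I) * index_parity D u)"
    unfolding weighted_def using rel(2) \<pi>_closed[OF K] by (intro finprod_cong') auto
  also have "\<dots> = weighted D (index_parity D) [^] (k - sum c I)"
    unfolding weighted_def by (rule finprod_int_pow_scale[OF \<pi>_fun[OF K]])
  also have "\<dots> = signature A \<pi> D [^] (sum c I - k)"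
    using weighted_closed[OF K] by (simp add: signature_weighted int_pow_inv int_pow_neg[symmetric])
  finally show "(\<Otimes>i\<in>I. parity D (w i) [^] c i) = signature A \<pi> D [^] (sum c I - k)" .
qed

end


section \<open>The parity functor\<close>

lemma (in normal) finprod_coset_pairs:
  assumes "comm_group G" "finite I" "x \<in> I \<rightarrow> carrier G"
  shows "(\<Otimes>\<^bsub>(G Mod H) \<times>\<times> integer_group\<^esub>i\<in>I. (H #> x i, y i) [^]\<^bsub>(G Mod H) \<times>\<times> integer_group\<^esub> (c i :: int))
    = (H #> (\<Otimes>i\<in>I. x i [^] c i), \<Sum>i\<in>I. c i * y i)"
proof -
  interpret G: comm_group G by fact
  let ?P = "(G Mod H) \<times>\<times> integer_group"
  have cg: "comm_group (G Mod H)" by (rule G.abelian_FactGroup) (rule subgroup_axioms)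
  have gM: "group (G Mod H)" by (rule factorgroup_is_group)
  have gP: "group ?P" using gM by (intro DirProd_group) auto
  interpret P: comm_group ?P
  proof (rule group.group_comm_groupI[OF gP])
    fix p q assume "p \<in> carrier ?P" "q \<in> carrier ?P"
    then show "p \<otimes>\<^bsub>?P\<^esub> q = q \<otimes>\<^bsub>?P\<^esub> p"
      using comm_monoid.m_comm[OF comm_group.axioms(1)[OF cg]] by auto
  qed
  have mem: "(H #> z, n) \<in> carrier ?P" if "z \<in> carrier G" for z n
    using that by (auto simp: carrier_FactGroup)
  have pow: "(H #> z, n) [^]\<^bsub>?P\<^esub> (m::int) = (H #> z [^] m, m * n)" if z: "z \<in> carrier G" for z n m
  proof -
    have "fst \<in> hom ?P (G Mod H)" "snd \<in> hom ?P integer_group" by (auto simp: hom_def)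
    then have "fst ((H #> z, n) [^]\<^bsub>?P\<^esub> m) = (H #> z) [^]\<^bsub>G Mod H\<^esub> m"
      "snd ((H #> z, n) [^]\<^bsub>?P\<^esub> m) = n [^]\<^bsub>integer_group\<^esub> m"
      using hom_int_pow[of fst ?P "G Mod H" "(H #> z, n)"] hom_int_pow[of snd ?P integer_group "(H #> z, n)"]
        mem[OF z] gP gM by simp_all
    then show ?thesis using FactGroup_int_pow[OF z] by (simp add: prod_eq_iff)
  qed
  show ?thesis using assms(2,3)
  proof (induction I rule: finite_induct)
    case empty
    then show ?case using coset_join2[of \<one>] subgroup_axioms by (simp add: one_DirProd)
  next
    case (insert i I)
    then have x: "x i \<in> carrier G" "x \<in> I \<rightarrow> carrier G" by auto
    have "(\<Otimes>i\<in>I. x i [^] c i) \<in> carrier G" using x by (intro G.finprod_closed) auto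
    then show ?case
      using insert x mem pow by (simp add: rcos_sum Pi_def)
  qed
qed

theorem theorem11:
  fixes A :: "('a, 'b) monoid_scheme"
    and K :: "vdiagram set"
    and \<pi> :: "vdiagram \<Rightarrow> complex \<Rightarrow> 'a"
    and D\<^sub>0 :: vdiagram
  assumes "comm_group A"
    and "K \<in> virtual_knots"
    and "quasi_index A K \<pi>"
    and "D\<^sub>0 \<in> K"
  shows
    "let H = generate A {signature A \<pi> D\<^sub>0};
         Abar = A Mod H;
         G = (\<lambda>D::vdiagram. Abar \<times>\<times> integer_group);
         P = (\<lambda>D v. (H #>\<^bsub>A\<^esub> (\<Otimes>\<^bsub>A\<^esub>v'\<in>crossings D.
                        \<pi> D v' [^]\<^bsub>A\<^esub> intersection D (left_half D v) (right_half D v')),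
                      index_parity D v));
         \<phi> = (\<lambda>D f D'. \<lambda>(x, y). (x \<otimes>\<^bsub>Abar\<^esub> (H #>\<^bsub>A\<^esub> increment A \<pi> D f D') [^]\<^bsub>Abar\<^esub> y, y))
     in oriented_parity_functor K G P (\<lambda>D f D'. (Some \<circ> \<phi> D f D') |` carrier (G D)) \<and>
        (\<forall>D\<in>K. \<forall>f D'. is_move D f D' \<longrightarrow> \<phi> D f D' \<in> iso (G D) (G D'))"
proof -
  interpret knot_quasi_index A K \<pi>
    using assms(1-3) by (simp add: knot_quasi_index_def knot_quasi_index_axioms_def)
  define H where "H = generate A {signature A \<pi> D\<^sub>0}"
  define Abar where "Abar = A Mod H"
  define G where "G = Abar \<times>\<times> integer_group"
  define P where "P = (\<lambda>D v. (H #>\<^bsub>A\<^esub> parity D v, index_parity D v))"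
  define \<phi> :: "vdiagram \<Rightarrow> vmove \<Rightarrow> vdiagram \<Rightarrow> 'a set \<times> int \<Rightarrow> 'a set \<times> int" where "\<phi> = (\<lambda>D f D'. \<lambda>(x, y). (x \<otimes>\<^bsub>Abar\<^esub> (H #>\<^bsub>A\<^esub> increment A \<pi> D f D') [^]\<^bsub>Abar\<^esub> y, y))"
  have sub: "subgroup H A" unfolding H_def using signature_closed[OF assms(4)] by (intro generate_is_subgroup) auto
  then have "H \<lhd> A" by (simp add: normal_iff_subgroup)
  then interpret H: normal H A .
  have cb: "comm_group Abar" unfolding Abar_def by (rule abelian_FactGroup[OF sub])
  then interpret B: comm_group Abar .
  have gG: "group G" unfolding G_def using B.is_group by (intro DirProd_group) auto
  have coset: "H #>\<^bsub>A\<^esub> x \<in> carrier Abar" if "x \<in> carrier A" for x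
    using that by (auto simp: Abar_def carrier_FactGroup)
  have sig: "signature A \<pi> D [^]\<^bsub>A\<^esub> (n::int) \<in> H" if "D \<in> K" for D n
  proof -
    have "signature A \<pi> D = signature A \<pi> D\<^sub>0" by (rule signature_invariant[OF assms(4) that])
    then have "signature A \<pi> D \<in> H" unfolding H_def by (auto intro: generate.incl)
    then show ?thesis by (rule subgroup_int_pow_closed[OF sub])
  qed
  have inc: "increment A \<pi> D f D' \<in> carrier A" if "D \<in> K" "is_move D f D'" for D f D'
    using move_shift[OF that] by (simp add: parity_shift_def)
  have iso: "\<phi> D f D' \<in> iso G G" if "D \<in> K" "is_move D f D'" for D f D'
    unfolding \<phi>_def G_def by (rule B.shear_iso[OF coset[OF inc[OF that]]])
  have PG: "P D v \<in> carrier G" if "D \<in> K" for D v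
    using coset[OF weighted_closed[OF that]] by (simp add: P_def G_def)
  have P0: "((Some \<circ> \<phi> D f D') |` carrier G) (P D v) = Some (P D' w)"
    if "D \<in> K" "is_move D f D'" "corr D f v = Some w" for D f D' v w
  proof -
    let ?d = "increment A \<pi> D f D'"
    have "index_parity D' w = index_parity D v" "parity D' w = parity D v \<otimes>\<^bsub>A\<^esub> ?d [^]\<^bsub>A\<^esub> index_parity D v"
      using move_shift[OF that(1,2)] that(3) by (auto simp: parity_shift_def)
    moreover have "(H #>\<^bsub>A\<^esub> parity D v) \<otimes>\<^bsub>Abar\<^esub> (H #>\<^bsub>A\<^esub> ?d) [^]\<^bsub>Abar\<^esub> index_parity D v
        = H #>\<^bsub>A\<^esub> (parity D v \<otimes>\<^bsub>A\<^esub> ?d [^]\<^bsub>A\<^esub> index_parity D v)"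
      using H.FactGroup_int_pow[OF inc[OF that(1,2)]] inc[OF that(1,2)] weighted_closed[OF that(1)]
      by (simp add: Abar_def H.rcos_sum)
    ultimately show ?thesis using PG[OF that(1)] by (simp add: P_def \<phi>_def)
  qed
  \<comment> \<open>the properties (P1), (P2) and (P3+) are instances of this, for the three kinds of relations\<close>
  have trivial: "(\<Otimes>\<^bsub>G\<^esub>i\<in>I. P D (w i) [^]\<^bsub>G\<^esub> (c i :: int)) = \<one>\<^bsub>G\<^esub>"
    if D: "D \<in> K" and I: "finite I" "w ` I \<subseteq> crossings D"
      and null: "\<And>E. cycle D E \<Longrightarrow> intersection D (relation_chain D I c w k) E = 0"
    for D and I :: "'i set" and c w k
  proof -
    have "(\<Otimes>\<^bsub>G\<^esub>i\<in>I. P D (w i) [^]\<^bsub>G\<^esub> c i)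
        = (H #>\<^bsub>A\<^esub> (\<Otimes>\<^bsub>A\<^esub>i\<in>I. parity D (w i) [^]\<^bsub>A\<^esub> c i), \<Sum>i\<in>I. c i * index_parity D (w i))"
      unfolding P_def G_def Abar_def
      using weighted_closed[OF D] by (intro H.finprod_coset_pairs[OF assms(1) I(1)]) auto
    also have "\<dots> = (H #>\<^bsub>A\<^esub> (signature A \<pi> D [^]\<^bsub>A\<^esub> (sum c I - k)), 0)"
      using relation_parity[OF D I null] by simp
    also have "H #>\<^bsub>A\<^esub> (signature A \<pi> D [^]\<^bsub>A\<^esub> (sum c I - k)) = H"
      using sig[OF D] H.rcos_const by (metis is_group)
    finally show ?thesis by (simp add: G_def Abar_def one_DirProd)
  qed
  interpret GG: group G by (rule gG)
  have G_comm: "comm_group G"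
  proof (rule group.group_comm_groupI[OF gG])
    fix p q assume "p \<in> carrier G" "q \<in> carrier G"
    then show "p \<otimes>\<^bsub>G\<^esub> q = q \<otimes>\<^bsub>G\<^esub> p" using B.m_comm by (auto simp: G_def)
  qed
  then interpret GG: comm_group G .
  have P1: "P D v = \<one>\<^bsub>G\<^esub>" if D: "D \<in> K" and m: "is_move D (R1_dec a b v) D'" for D a b v D'
  proof -
    have K': "D' \<in> K" by (rule move_K[OF D m])
    have "r1_increasing a b v D' D" using m by (simp add: is_move_def)
    then obtain x y where k: "kink D v x y"
      by (rule r1_increasing_kink[OF diagram_K[OF K'] diagram_K[OF D]])
    have "(\<Otimes>\<^bsub>G\<^esub>i\<in>{v}. P D (id i) [^]\<^bsub>G\<^esub> (1::int)) = \<one>\<^bsub>G\<^esub>"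
      using kink_passages(1)[OF diagram_K[OF D] k]
      by (intro trivial[OF D _ _ kink_relation[OF diagram_K[OF D] k]]) auto
    then show ?thesis using PG[OF D] by simp
  qed
  have P2: "P D v\<^sub>1 \<otimes>\<^bsub>G\<^esub> P D v\<^sub>2 = \<one>\<^bsub>G\<^esub>" if D: "D \<in> K" and m: "is_move D (R2_dec v\<^sub>1 v\<^sub>2) D'" for D v\<^sub>1 v\<^sub>2 D'
  proof -
    have K': "D' \<in> K" by (rule move_K[OF D m])
    have "r2_increasing v\<^sub>1 v\<^sub>2 D' D" using m by (simp add: is_move_def)
    then obtain a b x y l n where "bigon_move a b D' D x y l n v\<^sub>1 v\<^sub>2"
      by (rule r2_increasing_bigon[OF diagram_K[OF K'] diagram_K[OF D]])
    then interpret Bi: bigon_move a b D' D x y l n v\<^sub>1 v\<^sub>2 .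
    have v: "v\<^sub>1 \<in> crossings D" "v\<^sub>2 \<in> crossings D" "v\<^sub>1 \<noteq> v\<^sub>2" using Bi.B by (auto simp: bigon_def)
    have "(\<Otimes>\<^bsub>G\<^esub>i\<in>{v\<^sub>1, v\<^sub>2}. P D (id i) [^]\<^bsub>G\<^esub> (1::int)) = \<one>\<^bsub>G\<^esub>"
      using v by (intro trivial[OF D _ _ Bi.bigon_relation]) auto
    then show ?thesis using PG[OF D] v(3) by simp
  qed
  have P3: "(\<Otimes>\<^bsub>G\<^esub>i\<in>{..<3}. P D (v i) [^]\<^bsub>G\<^esub> corner_sign D (sides D a b) (v i)) = \<one>\<^bsub>G\<^esub>"
    if D: "D \<in> K" and m: "is_move D (R3 a b v v') D'" for D a b v v' D'
  proof -
    have K': "D' \<in> K" by (rule move_K[OF D m])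
    have "r3 a b v v' D D'" using m by (simp add: is_move_def)
    then obtain e Q R Q' R' where "triangle_move a b D D' e Q R Q' R' v v'"
      by (rule r3_triangle_move[OF diagram_K[OF D] diagram_K[OF K']])
    then interpret T: triangle_move a b D D' e Q R Q' R' v v' .
    have "v ` {..<3} \<subseteq> crossings D" using T.T by (auto simp: triangle_def)
    then show ?thesis by (intro trivial[OF D _ _ T.triangle_relation]) auto
  qed
  have "oriented_parity_functor K (\<lambda>_. G) P (\<lambda>D f D'. (Some \<circ> \<phi> D f D') |` carrier G)"
    unfolding oriented_parity_functor_def
    by (intro conjI ballI allI impI G_comm) (assumption | rule PG P0 P1 P2 P3 partial_iso_total[OF iso gG gG])+
  moreover have "\<forall>D\<in>K. \<forall>f D'. is_move D f D' \<longrightarrow> \<phi> D f D' \<in> iso G G"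
    by (intro ballI allI impI iso)
  ultimately show ?thesis
    unfolding Let_def P_def \<phi>_def G_def Abar_def H_def weighted_def by (rule conjI)
qed

end
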